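(* Let $n\ge 1$ and let $$X=\{(x_1,\ldots,x_n,d)\in\mathbf{C}^n\times\mathbf{C} : d^2=\text{discriminant of } z^n+x_1z^{n-1}+\ldots+x_n\}.$$ Consider the algebraic function $\mathbf{z}$ satisfying $\mathbf{z}^n+x_1\mathbf{z}^{n-1}+\ldots+x_n=0$ as an algebraic function on $X$. Then $\mathbf{z}$ cannot be rationally induced from an algebraic function on a variety of dimension $<2\lfloor n/4\rfloor$.
   Context: Varieties are over $\mathbf{C}$; Zariski open subsets are nonempty. A branched covering over an irreducible variety $X$ is a finite surjective morphism $\tilde X\to X$ of varieties ($\tilde X$ not necessarily irreducible, each irreducible component of $\tilde X$ dominating $X$). An algebraic function $z$ on an irreducible variety $X$ is a branched covering $p:\tilde X\to X$ together with a regular function $z:\tilde X\to\mathbf{C}$. Its values at $x\in X$ are the numbers $z(\tilde x)$, $p(\tilde x)=x$; algebraic functions are regarded as equivalent if they have the same set $\{(x,t): t \text{ is a value of } z \text{ at } x\}\subset X\times\mathbf{C}$. The function $\mathbf{z}$ in the claim has as its values at $(x_1,\ldots,x_n,d)$ all roots of $t^n+x_1t^{n-1}+\ldots+x_n$. The discriminant of a monic polynomial with roots $z_1,\ldots,z_n$ is $\prod_{i<j}(z_i-z_j)^2$. An algebraic function $\mathbf{z}$ defined over a Zariski open subset of an irreducible variety $X$ is rationally induced from an algebraic function $\mathbf{w}$ defined over a Zariski open subset of an irreducible variety $Y$ if there exist a Zariski open $U\subset X$, a rational morphism $r$ from $X$ to $Y$ and a rational function $R$ on $X\times\mathbf{C}$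 such that $\mathbf{z}(x)$, $r(x)$, $\mathbf{w}(r(x))$ and $R(x,\mathbf{w}(r(x)))$ are defined for all $x\in U$, and $\mathbf{z}(x)$ is a branch of $R(x,\mathbf{w}(r(x)))$ for $x\in U$. Here $R(x,\mathbf{w}(r(x)))$ is the algebraic function on $U$ whose values at $x$ are $R(x,t)$ with $t$ running over the values of $\mathbf{w}$ at $r(x)$, and "is a branch of" means that every value of $\mathbf{z}$ at $x\in U$ is among its values at $x$. *)

theory Defs
  imports
    "HOL-Analysis.Analysis"
    "HOL-Library.Extended_Nat"
    "HOL-Computational_Algebra.Polynomial"
begin

section \<open>Spaces with functions\<close>

text \<open>
  Complex varieties are treated as in Serre's FAC: a set of (closed) points with its Zariski
  topology and the sheaf of complex-valued regular functions. Regular functions on an open set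
  \<open>U\<close> are represented by total functions of which only the values on \<open>U\<close> matter; \<open>reg X U\<close> is
  meaningful only for open \<open>U\<close>.
\<close>

record 'a fspace =
  zar :: "'a topology"
  reg :: "'a set \<Rightarrow> ('a \<Rightarrow> complex) set"

abbreviation points :: "'a fspace \<Rightarrow> 'a set" where
  "points X \<equiv> topspace (zar X)"

definition function_sheaf :: "'a fspace \<Rightarrow> bool" where
  "function_sheaf X \<longleftrightarrow>
     (\<forall>U f g. openin (zar X) U \<and> f \<in> reg X U \<and> (\<forall>x\<in>U. g x = f x) \<longrightarrow> g \<in> reg X U) \<and>
     (\<forall>U V f. openin (zar X) U \<and> openin (zar X) V \<and> V \<subseteq> U \<and> f \<in> reg X U \<longrightarrow> f \<in> reg X V) \<and>
     (\<forall>U f. openin (zar X) U \<and> (\<forall>x\<in>U. \<exists>V. openin (zar X) V \<and> x \<in> V \<and> V \<subseteq> U \<and> f \<in> reg X V)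
        \<longrightarrow> f \<in> reg X U)"

definition morphism :: "'a fspace \<Rightarrow> 'b fspace \<Rightarrow> ('a \<Rightarrow> 'b) \<Rightarrow> bool" where
  "morphism X Y f \<longleftrightarrow>
     continuous_map (zar X) (zar Y) f \<and>
     (\<forall>V g. openin (zar Y) V \<and> g \<in> reg Y V \<longrightarrow> g \<circ> f \<in> reg X {x \<in> points X. f x \<in> V})"

definition isomorphic :: "'a fspace \<Rightarrow> 'b fspace \<Rightarrow> bool" where
  "isomorphic X Y \<longleftrightarrow>
     (\<exists>f g. morphism X Y f \<and> morphism Y X g \<and>
        (\<forall>x\<in>points X. g (f x) = x) \<and> (\<forall>y\<in>points Y. f (g y) = y))"

text \<open>
  The structure induced on a subset: regular functions are locally restrictions of regular
  functions of the ambient space. On open subsets this is the open subvariety, on closed subsets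
  the reduced closed subvariety.
\<close>

definition sub_space :: "'a fspace \<Rightarrow> 'a set \<Rightarrow> 'a fspace" where
  "sub_space X S =
     \<lparr>zar = subtopology (zar X) S,
      reg = (\<lambda>V. {f. \<forall>x\<in>V. \<exists>U g. openin (zar X) U \<and> x \<in> U \<and> g \<in> reg X U \<and>
                              (\<forall>y\<in>U \<inter> V. f y = g y)})\<rparr>"

text \<open>
  The structure on \<open>S\<close> determined by an algebra \<open>P\<close> of functions: non-vanishing loci of elements
  of \<open>P\<close> form a base of the topology, and regular functions are locally fractions.
\<close>

definition alg_space :: "'a set \<Rightarrow> ('a \<Rightarrow> complex) set \<Rightarrow> 'a fspace" where
  "alg_space S P =
     \<lparr>zar = topology_generated_by {{x \<in> S. f x \<noteq> 0} | f. f \<in> P},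
      reg = (\<lambda>U. {F. \<forall>x\<in>U. \<exists>f\<in>P. \<exists>g\<in>P. g x \<noteq> 0 \<and>
                              (\<forall>y\<in>U. g y \<noteq> 0 \<longrightarrow> F y = f y / g y)})\<rparr>"

text \<open>
  Coordinates on affine \<open>N\<close>-space are indexed by \<open>1, \<dots>, N\<close>; all other entries of a point are zero.
\<close>

definition affine_points :: "nat \<Rightarrow> (nat \<Rightarrow> complex) set" where
  "affine_points N = {x. \<forall>i. i \<notin> {1..N} \<longrightarrow> x i = 0}"

inductive_set poly_functions :: "nat \<Rightarrow> ((nat \<Rightarrow> complex) \<Rightarrow> complex) set" for N :: nat where
  const: "(\<lambda>x. c) \<in> poly_functions N"
| coord: "i \<in> {1..N} \<Longrightarrow> (\<lambda>x. x i) \<in> poly_functions N"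
| add: "f \<in> poly_functions N \<Longrightarrow> g \<in> poly_functions N \<Longrightarrow> (\<lambda>x. f x + g x) \<in> poly_functions N"
| mult: "f \<in> poly_functions N \<Longrightarrow> g \<in> poly_functions N \<Longrightarrow> (\<lambda>x. f x * g x) \<in> poly_functions N"

definition affine_space :: "nat \<Rightarrow> (nat \<Rightarrow> complex) fspace" where
  "affine_space N = alg_space (affine_points N) (poly_functions N)"

definition affine_line :: "complex fspace" where
  "affine_line = alg_space UNIV (range poly)"

definition affine_variety :: "'a fspace \<Rightarrow> bool" where
  "affine_variety X \<longleftrightarrow>
     (\<exists>N S. closedin (zar (affine_space N)) S \<and> isomorphic X (sub_space (affine_space N) S))"

text \<open>
  The product of varieties. Its topology is in general finer than the product topology.
\<close>

definition tensor_functions ::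
    "'a fspace \<Rightarrow> 'b fspace \<Rightarrow> 'a set \<Rightarrow> 'b set \<Rightarrow> ('a \<times> 'b \<Rightarrow> complex) set" where
  "tensor_functions X Y U V =
     {\<lambda>(x, y). (\<Sum>i<k. f i x * g i y) | (k::nat) f g. (\<forall>i<k. f i \<in> reg X U \<and> g i \<in> reg Y V)}"

definition prod_space :: "'a fspace \<Rightarrow> 'b fspace \<Rightarrow> ('a \<times> 'b) fspace" where
  "prod_space X Y =
     \<lparr>zar = topology_generated_by
              {{q \<in> U \<times> V. h q \<noteq> 0} | U V h.
                 openin (zar X) U \<and> openin (zar Y) V \<and> h \<in> tensor_functions X Y U V},
      reg = (\<lambda>W. {F. \<forall>p\<in>W. \<exists>U V. openin (zar X) U \<and> openin (zar Y) V \<and> p \<in> U \<times> V \<and>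
                  (\<exists>a\<in>tensor_functions X Y U V. \<exists>b\<in>tensor_functions X Y U V.
                     b p \<noteq> 0 \<and> (\<forall>q\<in>W \<inter> U \<times> V. b q \<noteq> 0 \<longrightarrow> F q = a q / b q))})\<rparr>"


section \<open>Varieties\<close>

definition variety :: "'a fspace \<Rightarrow> bool" where
  "variety X \<longleftrightarrow>
     function_sheaf X \<and>
     (\<exists>\<U>. finite \<U> \<and> \<Union>\<U> = points X \<and>
        (\<forall>U\<in>\<U>. openin (zar X) U \<and> affine_variety (sub_space X U))) \<and>
     closedin (zar (prod_space X X)) {(x, x) | x. x \<in> points X}"

definition irreducible_in :: "'a topology \<Rightarrow> 'a set \<Rightarrow> bool" where
  "irreducible_in T Z \<longleftrightarrow>
     Z \<subseteq> topspace T \<and> Z \<noteq> {} \<and>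
     (\<forall>A B. closedin T A \<and> closedin T B \<and> Z \<subseteq> A \<union> B \<longrightarrow> Z \<subseteq> A \<or> Z \<subseteq> B)"

definition irreducible_variety :: "'a fspace \<Rightarrow> bool" where
  "irreducible_variety X \<longleftrightarrow> variety X \<and> irreducible_in (zar X) (points X)"

definition irreducible_component :: "'a topology \<Rightarrow> 'a set \<Rightarrow> bool" where
  "irreducible_component T Z \<longleftrightarrow>
     irreducible_in T Z \<and> (\<forall>Z'. irreducible_in T Z' \<and> Z \<subseteq> Z' \<longrightarrow> Z' = Z)"

definition krull_dim :: "'a topology \<Rightarrow> enat" where
  "krull_dim T =
     Sup {enat k | k Z. (\<forall>i\<le>k. closedin T (Z i) \<and> irreducible_in T (Z i)) \<and>
                        (\<forall>i<k. Z i \<subset> Z (Suc i))}"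

definition zariski_open :: "'a fspace \<Rightarrow> 'a set \<Rightarrow> bool" where
  "zariski_open X U \<longleftrightarrow> openin (zar X) U \<and> U \<noteq> {}"


section \<open>Algebraic functions\<close>

definition finite_morphism :: "'a fspace \<Rightarrow> 'b fspace \<Rightarrow> ('a \<Rightarrow> 'b) \<Rightarrow> bool" where
  "finite_morphism X Y p \<longleftrightarrow>
     morphism X Y p \<and>
     (\<forall>y\<in>points Y. \<exists>V. openin (zar Y) V \<and> y \<in> V \<and> affine_variety (sub_space Y V) \<and>
        (let U = {x \<in> points X. p x \<in> V} in
           affine_variety (sub_space X U) \<and>
           (\<exists>B. finite B \<and> B \<subseteq> reg X U \<and>
              (\<forall>f\<in>reg X U. \<exists>c. (\<forall>b\<in>B. c b \<in> reg Y V) \<and>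
                 (\<forall>x\<in>U. f x = (\<Sum>b\<in>B. c b (p x) * b x))))))"

definition branched_covering :: "'a fspace \<Rightarrow> 'c fspace \<Rightarrow> ('c \<Rightarrow> 'a) \<Rightarrow> bool" where
  "branched_covering X C p \<longleftrightarrow>
     variety C \<and> finite_morphism C X p \<and> p ` points C = points X \<and>
     (\<forall>Z. irreducible_component (zar C) Z \<longrightarrow> zar X closure_of (p ` Z) = points X)"

record ('a, 'c) alg_fun =
  cover :: "'c fspace"
  cover_map :: "'c \<Rightarrow> 'a"
  cover_fun :: "'c \<Rightarrow> complex"

definition algebraic_function :: "'a fspace \<Rightarrow> ('a, 'c) alg_fun \<Rightarrow> bool" where
  "algebraic_function X z \<longleftrightarrow>
     branched_covering X (cover z) (cover_map z) \<and>
     cover_fun z \<in> reg (cover z) (points (cover z))"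

definition af_values :: "('a, 'c) alg_fun \<Rightarrow> 'a \<Rightarrow> complex set" where
  "af_values z x = cover_fun z ` {c \<in> points (cover z). cover_map z c = x}"

text \<open>
  A rational map or function is given by a representative regular on a nonempty open set \<open>V\<close>; it
  is defined at the points of \<open>V\<close>. (On irreducible varieties there is a representative with
  largest \<open>V\<close>, so this loses nothing when representatives are existentially quantified.)
\<close>

definition rational_map :: "'a fspace \<Rightarrow> 'b fspace \<Rightarrow> 'a set \<Rightarrow> ('a \<Rightarrow> 'b) \<Rightarrow> bool" where
  "rational_map X Y V r \<longleftrightarrow> zariski_open X V \<and> morphism (sub_space X V) Y r"

definition rational_function :: "'a fspace \<Rightarrow> 'a set \<Rightarrow> ('a \<Rightarrow> complex) \<Rightarrow> bool" where
  "rational_function X W R \<longleftrightarrow> zariski_open X W \<and> R \<in> reg X W"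

text \<open>
  Here \<open>z\<close> is an algebraic function on the open subset \<open>D\<close> of \<open>X\<close>, and \<open>w\<close> one on the open
  subset \<open>E\<close> of \<open>Y\<close>.
\<close>

definition rationally_induced ::
    "'a fspace \<Rightarrow> 'a set \<Rightarrow> ('a, 'c) alg_fun \<Rightarrow> 'b fspace \<Rightarrow> 'b set \<Rightarrow> ('b, 'd) alg_fun \<Rightarrow> bool" where
  "rationally_induced X D z Y E w \<longleftrightarrow>
     (\<exists>U V r W R.
        zariski_open X U \<and>
        rational_map X Y V r \<and>
        rational_function (prod_space X affine_line) W R \<and>
        (\<forall>x\<in>U. x \<in> D \<and> x \<in> V \<and> r x \<in> E \<and> (\<forall>t\<in>af_values w (r x). (x, t) \<in> W)) \<and>
        (\<forall>x\<in>U. af_values z x \<subseteq> (\<lambda>t. R (x, t)) ` af_values w (r x)))"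


section \<open>The universal algebraic function with square root of the discriminant\<close>

definition roots_discriminant :: "complex list \<Rightarrow> complex" where
  "roots_discriminant zs = (\<Prod>j<length zs. \<Prod>i<j. (zs ! i - zs ! j)\<^sup>2)"

definition discriminant :: "complex poly \<Rightarrow> complex" where
  "discriminant p = (THE D. \<exists>zs. p = (\<Prod>z\<leftarrow>zs. [:- z, 1:]) \<and> D = roots_discriminant zs)"

definition generic_poly :: "nat \<Rightarrow> (nat \<Rightarrow> complex) \<Rightarrow> complex poly" where
  "generic_poly n x = monom 1 n + (\<Sum>i=1..n. monom (x i) (n - i))"

definition disc_variety :: "nat \<Rightarrow> ((nat \<Rightarrow> complex) \<times> complex) fspace" where
  "disc_variety n =
     sub_space (prod_space (affine_space n) affine_line)
       {(x, d). x \<in> affine_points n \<and> d\<^sup>2 = discriminant (generic_poly n x)}"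

definition root_function ::
    "nat \<Rightarrow> ((nat \<Rightarrow> complex) \<times> complex, ((nat \<Rightarrow> complex) \<times> complex) \<times> complex) alg_fun" where
  "root_function n =
     \<lparr>cover = sub_space (prod_space (disc_variety n) affine_line)
                {((x, d), t). (x, d) \<in> points (disc_variety n) \<and> poly (generic_poly n x) t = 0},
      cover_map = fst,
      cover_fun = snd\<rparr>"


section \<open>Basic facts\<close>

lemma roots_discriminant_Cons:
  "roots_discriminant (a # zs) = (\<Prod>z\<leftarrow>zs. (a - z)\<^sup>2) * roots_discriminant zs"
proof -
  have "(\<Prod>z\<leftarrow>zs. (a - z)\<^sup>2) = (\<Prod>j<length zs. (a - zs ! j)\<^sup>2)"
    by (simp add: prod.list_conv_set_nth atLeast0LessThan)
  then show ?thesis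
    by (simp add: roots_discriminant_def prod.lessThan_Suc_shift prod.distrib
             del: prod.lessThan_Suc)
qed

lemma roots_discriminant_remove1:
  "a \<in> set zs \<Longrightarrow> roots_discriminant (a # remove1 a zs) = roots_discriminant zs"
proof (induction zs)
  case (Cons b zs)
  show ?case
  proof (cases "a = b")
    case False
    then have a: "a \<in> set zs" using Cons.prems by simp
    have m: "mset zs = add_mset a (mset (remove1 a zs))" using a by simp
    have "(\<Prod>z\<leftarrow>zs. (b - z)\<^sup>2) = (b - a)\<^sup>2 * (\<Prod>z\<leftarrow>remove1 a zs. (b - z)\<^sup>2)"
      using arg_cong[OF m, of "\<lambda>M. prod_mset (image_mset (\<lambda>z. (b - z)\<^sup>2) M)"]
      by (simp flip: prod_mset_prod_list)
    then show ?thesis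
      using False Cons.IH[OF a]
      by (auto simp: roots_discriminant_Cons power2_commute[of a b] mult_ac)
  qed simp
qed simp

lemma roots_discriminant_mset:
  "mset zs = mset ws \<Longrightarrow> roots_discriminant zs = roots_discriminant ws"
proof (induction zs arbitrary: ws)
  case (Cons a zs)
  have a: "a \<in> set ws" using Cons.prems by (metis list.set_intros(1) set_mset_mset)
  have m: "mset zs = mset (remove1 a ws)" using Cons.prems by (metis mset_remove1 remove1.simps(2))
  have "(\<Prod>z\<leftarrow>zs. (a - z)\<^sup>2) = (\<Prod>z\<leftarrow>remove1 a ws. (a - z)\<^sup>2)"
    using arg_cong[OF m, of "\<lambda>M. prod_mset (image_mset (\<lambda>z. (a - z)\<^sup>2) M)"]
    by (simp flip: prod_mset_prod_list)
  then have "roots_discriminant (a # zs) = roots_discriminant (a # remove1 a ws)"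
    using Cons.IH[OF m] by (simp add: roots_discriminant_Cons)
  then show ?case using roots_discriminant_remove1[OF a] by simp
qed simp

lemma discriminant_eq: "discriminant (\<Prod>z\<leftarrow>zs. [:- z, 1:]) = roots_discriminant zs"
proof -
  have "mset zs = mset ws"
    if "(\<Prod>z\<leftarrow>zs. [:- z, 1:]) = (\<Prod>z\<leftarrow>ws. [:- z, 1:])" for ws :: "complex list"
  proof -
    have "proots (\<Prod>z\<leftarrow>us. [:- z, 1:]) = mset us" for us :: "complex list"
    proof (induction us)
      case (Cons u us)
      have "(\<Prod>z\<leftarrow>us. [:- z, 1:]) \<noteq> (0 :: complex poly)"
        by (auto simp: prod_list_zero_iff)
      then have "proots ([:- u, 1:] * (\<Prod>z\<leftarrow>us. [:- z, 1:])) =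
                 proots [:- u, 1:] + proots (\<Prod>z\<leftarrow>us. [:- z, 1:])"
        by (intro proots_mult) auto
      then show ?case using Cons.IH by (simp del: mult_pCons_left)
    qed simp
    then show ?thesis using that by metis
  qed
  then show ?thesis
    unfolding discriminant_def by (intro the_equality) (blast, metis roots_discriminant_mset)
qed

lemma points_sub_space [simp]: "points (sub_space X S) = points X \<inter> S"
  by (simp add: sub_space_def)

lemma points_alg_space:
  assumes "(\<lambda>x. 1) \<in> P"
  shows "points (alg_space S P) = S"
proof -
  have "S \<in> {{x \<in> S. f x \<noteq> 0} | f. f \<in> P}"
    by (rule CollectI, rule exI[of _ "\<lambda>_. 1"]) (simp add: assms)
  then have "S \<subseteq> \<Union>{{x \<in> S. f x \<noteq> 0} | f. f \<in> P}" by (rule Union_upper)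
  moreover have "\<Union>{{x \<in> S. f x \<noteq> 0} | f. f \<in> P} \<subseteq> S" by blast
  ultimately show ?thesis by (simp add: alg_space_def)
qed

lemma one_range_poly: "(\<lambda>x. 1) \<in> range (poly :: complex poly \<Rightarrow> _)"
proof -
  have "poly 1 = (\<lambda>x :: complex. 1)" by auto
  then show ?thesis by (metis rangeI)
qed

lemma points_affine_space [simp]: "points (affine_space N) = affine_points N"
  unfolding affine_space_def by (intro points_alg_space poly_functions.const)

lemma points_affine_line [simp]: "points affine_line = UNIV"
  unfolding affine_line_def by (rule points_alg_space[OF one_range_poly])

lemma one_tensor_functions:
  assumes "(\<lambda>x. 1) \<in> reg X U" "(\<lambda>y. 1) \<in> reg Y V"
  shows "(\<lambda>q. 1) \<in> tensor_functions X Y U V"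
  unfolding tensor_functions_def
  by (rule CollectI, rule exI[of _ "Suc 0"], rule exI[of _ "\<lambda>_ _. 1"], rule exI[of _ "\<lambda>_ _. 1"])
     (auto simp: assms)

lemma points_prod_space:
  assumes "(\<lambda>x. 1) \<in> reg X (points X)" "(\<lambda>y. 1) \<in> reg Y (points Y)"
  shows "points (prod_space X Y) = points X \<times> points Y"
proof -
  note h = one_tensor_functions[OF assms]
  let ?S = "{{q \<in> U \<times> V. h q \<noteq> 0} | U V h.
          openin (zar X) U \<and> openin (zar Y) V \<and> h \<in> tensor_functions X Y U V}"
  have eq: "points (prod_space X Y) = \<Union>?S"
    by (simp only: prod_space_def fspace.simps topology_generated_by_topspace)
  have "{q \<in> points X \<times> points Y. (\<lambda>_. 1 :: complex) q \<noteq> 0} \<in> ?S"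
    by (rule CollectI, rule exI[of _ "points X"], rule exI[of _ "points Y"],
        rule exI[of _ "\<lambda>_. 1"]) (simp add: h)
  then have "points X \<times> points Y \<subseteq> \<Union>?S" by (intro Union_upper) simp
  moreover have "\<Union>?S \<subseteq> points X \<times> points Y"
    by (auto dest: openin_subset)
  ultimately show ?thesis unfolding eq by (rule equalityI[rotated])
qed

lemma one_reg_alg_space:
  assumes "(\<lambda>x. 1) \<in> P"
  shows "(\<lambda>x. 1) \<in> reg (alg_space S P) U"
  using assms unfolding alg_space_def fspace.simps
  by (intro CollectI ballI bexI[of _ "\<lambda>_. 1"]) simp_all

lemma one_reg_affine_space: "(\<lambda>x. 1) \<in> reg (affine_space N) U"
  unfolding affine_space_def by (intro one_reg_alg_space poly_functions.const)

lemma one_reg_affine_line: "(\<lambda>x. 1) \<in> reg affine_line U"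
  unfolding affine_line_def by (rule one_reg_alg_space[OF one_range_poly])

lemma one_reg_prod_space:
  assumes "(\<lambda>x. 1) \<in> reg X (points X)" "(\<lambda>y. 1) \<in> reg Y (points Y)" "W \<subseteq> points X \<times> points Y"
  shows "(\<lambda>q. 1) \<in> reg (prod_space X Y) W"
  unfolding prod_space_def fspace.simps
proof (intro CollectI ballI)
  fix p assume "p \<in> W"
  note h = one_tensor_functions[OF assms(1,2)]
  have "\<exists>a\<in>tensor_functions X Y (points X) (points Y).
        \<exists>b\<in>tensor_functions X Y (points X) (points Y).
             b p \<noteq> 0 \<and> (\<forall>q\<in>W \<inter> points X \<times> points Y. b q \<noteq> 0 \<longrightarrow> 1 = a q / b q)"
    by (rule bexI[OF _ h], rule bexI[OF _ h]) simp
  moreover have "p \<in> points X \<times> points Y" using \<open>p \<in> W\<close> assms(3) by (rule subsetD[rotated])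
  ultimately
  show "\<exists>U V. openin (zar X) U \<and> openin (zar Y) V \<and> p \<in> U \<times> V \<and>
          (\<exists>a\<in>tensor_functions X Y U V. \<exists>b\<in>tensor_functions X Y U V.
             b p \<noteq> 0 \<and> (\<forall>q\<in>W \<inter> U \<times> V. b q \<noteq> 0 \<longrightarrow> 1 = a q / b q))"
    by (intro exI[of _ "points X"], intro exI[of _ "points Y"])
       (simp only: openin_topspace simp_thms)
qed

lemma one_reg_sub_space:
  assumes "(\<lambda>x. 1) \<in> reg X (points X)" "V \<subseteq> points X"
  shows "(\<lambda>x. 1) \<in> reg (sub_space X S) V"
  unfolding sub_space_def fspace.simps
proof (intro CollectI ballI)
  fix x assume "x \<in> V"
  with assms show "\<exists>U g. openin (zar X) U \<and> x \<in> U \<and> g \<in> reg X U \<and> (\<forall>y\<in>U \<inter> V. 1 = g y)"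
    by (intro exI[of _ "points X"], intro exI[of _ "\<lambda>_. 1"]) auto
qed

lemma points_disc_variety:
  "points (disc_variety n) = {(x, d). x \<in> affine_points n \<and> d\<^sup>2 = discriminant (generic_poly n x)}"
  by (auto simp: disc_variety_def points_prod_space one_reg_affine_space one_reg_affine_line)

lemma one_reg_disc_variety: "(\<lambda>q. 1) \<in> reg (disc_variety n) (points (disc_variety n))"
proof -
  let ?P = "prod_space (affine_space n) affine_line"
  have P: "points ?P = affine_points n \<times> UNIV"
    by (simp add: points_prod_space one_reg_affine_space one_reg_affine_line)
  have "(\<lambda>q. 1) \<in> reg ?P (points ?P)"
    unfolding P
    by (intro one_reg_prod_space one_reg_affine_space one_reg_affine_line) simp
  moreover have "points (disc_variety n) \<subseteq> points ?P"
    by (auto simp: P points_disc_variety)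
  ultimately show ?thesis
    unfolding disc_variety_def by (intro one_reg_sub_space)
qed

lemma af_values_root_function:
  assumes "(x, d) \<in> points (disc_variety n)"
  shows "af_values (root_function n) (x, d) =
           {t. t ^ n + (\<Sum>i=1..n. x i * t ^ (n - i)) = 0}"
proof -
  have "points (cover (root_function n)) =
      {((x, d), t). (x, d) \<in> points (disc_variety n) \<and> poly (generic_poly n x) t = 0}"
    by (auto simp: root_function_def points_prod_space one_reg_disc_variety one_reg_affine_line)
  then have "af_values (root_function n) (x, d) = {t. poly (generic_poly n x) t = 0}"
    using assms by (force simp: af_values_def root_function_def)
  then show ?thesis by (simp add: generic_poly_def poly_monom poly_sum)
qed

end

theory Submission
  imports
    Defs
    "HOL-Computational_Algebra.Primes"
    "HOL-Computational_Algebra.Fundamental_Theorem_Algebra"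
    "HOL-Library.Infinite_Set"
    "Jordan_Normal_Form.Char_Poly"
begin

text \<open>
  Let \<open>m = 2 * (n div 4)\<close>. Polynomials whose roots, in blocks of four, are \<open>p \<plusminus> q s \<plusminus> r t \<plusminus> w s t\<close>
  (with the product of the three signs equal to \<open>+\<close>) form a family over \<open>s \<in> \<complex>\<^sup>m\<close> through a generic point
  of \<open>X\<close>; its coefficients and the square root of its discriminant are invariant under sign changes of the
  coordinates, which permute the roots evenly. Everything is pulled back to this family.

  On the spirals \<open>s\<^sub>i = exp (- (\<rho> log p\<^sub>i + \<i> \<theta> u\<^sub>i))\<close>, with \<open>p\<^sub>i\<close> the \<open>i\<close>-th prime, every rational function
  of \<open>s\<close> is asymptotic to a constant times a monomial as \<open>\<rho> \<rightarrow> \<infinity>\<close>, uniformly in \<open>\<theta>\<close>. Functions with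
  \<open>m\<close> linearly independent exponents are algebraically independent, so if they came from \<open>Y\<close>, the dimension
  of \<open>Y\<close> would be at least \<open>m\<close>. Hence some integral vector \<open>u\<close>, not all of whose entries are even, is
  orthogonal to the exponents of all functions coming from \<open>Y\<close>, and along its spirals these functions are
  nearly constant in \<open>\<theta>\<close>. If \<open>y\<close> is a value of \<open>w\<close>, followed continuously in \<open>\<theta>\<close>, then
  \<open>g \<theta> = y (\<theta> + \<pi>) - y \<theta>\<close> is integral over these functions, so it vanishes or is nearly constant too; the
  latter is impossible because \<open>y\<close> has a finite orbit under \<open>\<theta> \<mapsto> \<theta> + \<pi>\<close>. So the values of \<open>w\<close>, and with
  them all roots that are rational in them, return to themselves under \<open>\<theta> \<mapsto> \<theta> + \<pi>\<close>. But this changes the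
  sign of the coordinates with \<open>u\<^sub>i\<close> odd, which moves some root.
\<close>

section \<open>Algebras of functions\<close>

text \<open>The bound \<open>2 * (n div 4)\<close> is the rank of a product of Klein four-groups,
  one per block of four roots. A fixed square root of the discriminant allows only even
  permutations: double transpositions inside a block qualify, single transpositions do not.
  Logarithms of distinct primes are linearly independent over the rationals, so different exponents
  decay at different rates: \<rho> tending to infinity acts as a real valuation that separates
  monomials, while \<theta> changes only phases. Leading exponents do not depend on
  \<open>u\<close>, which can be chosen once they are known. Two obstacles shape the rest. The
  rational function \<open>R\<close> is only locally a fraction; the fraction valid at the start of
  a path depends on \<rho>, whereas each estimate holds only beyond some \<rho> depending on the
  fraction. The Hilbert basis theorem reduces to finitely many fractions. Also, the values of
  \<open>w\<close> are multivalued, so integral dependence is stated for numbers satisfying an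
  equation at a point, and determinants of explicit matrices replace ring extensions.\<close>

definition fun_algebra :: "('p \<Rightarrow> complex) set \<Rightarrow> bool" where
  "fun_algebra P \<longleftrightarrow>
     (\<forall>c. (\<lambda>_. c) \<in> P) \<and> (\<forall>f\<in>P. \<forall>g\<in>P. (\<lambda>x. f x + g x) \<in> P \<and> (\<lambda>x. f x * g x) \<in> P)"

lemma fun_algebraI:
  assumes "\<And>c. (\<lambda>_. c) \<in> P"
    and "\<And>f g. f \<in> P \<Longrightarrow> g \<in> P \<Longrightarrow> (\<lambda>x. f x + g x) \<in> P"
    and "\<And>f g. f \<in> P \<Longrightarrow> g \<in> P \<Longrightarrow> (\<lambda>x. f x * g x) \<in> P"
  shows "fun_algebra P"
  using assms unfolding fun_algebra_def by blast

lemma fa_const: "fun_algebra P \<Longrightarrow> (\<lambda>_. c) \<in> P"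
  by (auto simp: fun_algebra_def)

lemma fa_add: "fun_algebra P \<Longrightarrow> f \<in> P \<Longrightarrow> g \<in> P \<Longrightarrow> (\<lambda>x. f x + g x) \<in> P"
  by (auto simp: fun_algebra_def)

lemma fa_mult: "fun_algebra P \<Longrightarrow> f \<in> P \<Longrightarrow> g \<in> P \<Longrightarrow> (\<lambda>x. f x * g x) \<in> P"
  by (auto simp: fun_algebra_def)

lemma fa_uminus: "fun_algebra P \<Longrightarrow> f \<in> P \<Longrightarrow> (\<lambda>x. - f x) \<in> P"
  using fa_mult[of P "\<lambda>_. -1" f] by (simp add: fa_const)

lemma fa_diff: "fun_algebra P \<Longrightarrow> f \<in> P \<Longrightarrow> g \<in> P \<Longrightarrow> (\<lambda>x. f x - g x) \<in> P"
  using fa_add[OF _ _ fa_uminus, of P f g] by simp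

lemma fa_sum: "fun_algebra P \<Longrightarrow> (\<And>i. i \<in> I \<Longrightarrow> f i \<in> P) \<Longrightarrow> (\<lambda>x. \<Sum>i\<in>I. f i x) \<in> P"
  by (induction I rule: infinite_finite_induct) (auto intro: fa_const fa_add)

lemma fa_prod: "fun_algebra P \<Longrightarrow> (\<And>i. i \<in> I \<Longrightarrow> f i \<in> P) \<Longrightarrow> (\<lambda>x. \<Prod>i\<in>I. f i x) \<in> P"
  by (induction I rule: infinite_finite_induct) (auto intro: fa_const fa_mult)

lemma fa_power: "fun_algebra P \<Longrightarrow> f \<in> P \<Longrightarrow> (\<lambda>x. f x ^ k) \<in> P"
  by (induction k) (auto intro: fa_const fa_mult)

text \<open>Used for finitely generated polynomial rings and for the algebra generated by
  \<open>reg Y V\<close>. The latter is formed because \<open>function_sheaf\<close> speaks of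
  restriction and gluing, not of sums of regular functions.\<close>

inductive_set alg_gen :: "('p \<Rightarrow> complex) set \<Rightarrow> ('p \<Rightarrow> complex) set" for G where
  const: "(\<lambda>_. c) \<in> alg_gen G"
| gen: "f \<in> G \<Longrightarrow> f \<in> alg_gen G"
| add: "f \<in> alg_gen G \<Longrightarrow> g \<in> alg_gen G \<Longrightarrow> (\<lambda>x. f x + g x) \<in> alg_gen G"
| mult: "f \<in> alg_gen G \<Longrightarrow> g \<in> alg_gen G \<Longrightarrow> (\<lambda>x. f x * g x) \<in> alg_gen G"

lemma fun_algebra_alg_gen: "fun_algebra (alg_gen G)"
  by (intro fun_algebraI alg_gen.const alg_gen.add alg_gen.mult)

lemma fun_algebra_poly_functions: "fun_algebra (poly_functions N)"
  by (intro fun_algebraI poly_functions.intros)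

lemma alg_gen_least: "fun_algebra P \<Longrightarrow> G \<subseteq> P \<Longrightarrow> alg_gen G \<subseteq> P"
proof
  fix f assume "fun_algebra P" "G \<subseteq> P" "f \<in> alg_gen G"
  from this(3,1,2) show "f \<in> P"
    by (induction) (auto intro: fa_const fa_add fa_mult)
qed

lemma fun_algebra_vimage: "fun_algebra P \<Longrightarrow> fun_algebra {f. (\<lambda>x. f (h x)) \<in> P}"
  by (intro fun_algebraI) (auto intro: fa_const fa_add fa_mult)

lemma fun_algebra_range_poly: "fun_algebra (range (poly :: complex poly \<Rightarrow> _))"
proof (intro fun_algebraI)
  fix f g :: "complex \<Rightarrow> complex" assume "f \<in> range poly" "g \<in> range poly"
  then obtain p q where pq: "f = poly p" "g = poly q" by auto
  have "(\<lambda>x. f x + g x) = poly (p + q)" "(\<lambda>x. f x * g x) = poly (p * q)"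
    unfolding pq by auto
  then show "(\<lambda>x. f x + g x) \<in> range poly" "(\<lambda>x. f x * g x) \<in> range poly" by auto
next
  fix c :: complex
  have "(\<lambda>_. c) = poly [:c:]" by auto
  then show "(\<lambda>_. c) \<in> range (poly :: complex poly \<Rightarrow> _)" by auto
qed

text \<open>A polynomial over the algebra \<open>P\<close>, encoded as a family of complex
  polynomials. A determinant of polynomial matrices can then be expanded while its coefficients are
  traced in \<open>P\<close>.\<close>

definition coeffs_in :: "('p \<Rightarrow> complex) set \<Rightarrow> ('p \<Rightarrow> complex poly) \<Rightarrow> bool" where
  "coeffs_in P p \<longleftrightarrow> (\<forall>i. (\<lambda>x. Polynomial.coeff (p x) i) \<in> P)"

lemma coeffs_in_const: "fun_algebra P \<Longrightarrow> coeffs_in P (\<lambda>_. p)"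
  by (auto simp: coeffs_in_def intro: fa_const)

lemma coeffs_in_add: "fun_algebra P \<Longrightarrow> coeffs_in P p \<Longrightarrow> coeffs_in P q \<Longrightarrow> coeffs_in P (\<lambda>x. p x + q x)"
  by (auto simp: coeffs_in_def intro: fa_add)

lemma coeffs_in_mult: "fun_algebra P \<Longrightarrow> coeffs_in P p \<Longrightarrow> coeffs_in P q \<Longrightarrow> coeffs_in P (\<lambda>x. p x * q x)"
  by (auto simp: coeffs_in_def coeff_mult intro!: fa_sum fa_mult)

lemma coeffs_in_pCons: 
  "fun_algebra P \<Longrightarrow> f \<in> P \<Longrightarrow> coeffs_in P q \<Longrightarrow> coeffs_in P (\<lambda>x. pCons (f x) (q x))"
  unfolding coeffs_in_def
proof
  fix i assume "f \<in> P" "\<forall>i. (\<lambda>x. Polynomial.coeff (q x) i) \<in> P"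
  then show "(\<lambda>x. Polynomial.coeff (pCons (f x) (q x)) i) \<in> P" by (cases i) auto
qed

lemma coeffs_in_sum:
  "fun_algebra P \<Longrightarrow> (\<And>i. i \<in> I \<Longrightarrow> coeffs_in P (p i)) \<Longrightarrow> coeffs_in P (\<lambda>x. \<Sum>i\<in>I. p i x)"
  by (induction I rule: infinite_finite_induct) (auto intro: coeffs_in_const coeffs_in_add)

lemma coeffs_in_prod:
  "fun_algebra P \<Longrightarrow> (\<And>i. i \<in> I \<Longrightarrow> coeffs_in P (p i)) \<Longrightarrow> coeffs_in P (\<lambda>x. \<Prod>i\<in>I. p i x)"
  by (induction I rule: infinite_finite_induct) (auto intro: coeffs_in_const coeffs_in_mult)

section \<open>Integral dependence\<close>

text \<open>Integral dependence becomes a statement about a point \<open>x\<close> and a number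
  \<open>y\<close>, so that it applies to the values of multivalued functions.\<close>

definition monic_val :: "nat \<Rightarrow> (nat \<Rightarrow> 'p \<Rightarrow> complex) \<Rightarrow> 'p \<Rightarrow> complex \<Rightarrow> complex" where
  "monic_val N q x y = y ^ N + (\<Sum>k<N. q k x * y ^ k)"

text \<open>The determinant trick: the characteristic polynomial of the matrix \<open>c\<close> at
  \<open>x\<close> annihilates every eigenvalue \<open>l\<close>. Its coefficients are polynomials
  in the entries, hence in \<open>P\<close>, and one family \<open>q\<close> serves all points and
  all eigenvectors.\<close>

lemma eigenvalue_monic_nat:
  fixes c :: "nat \<Rightarrow> nat \<Rightarrow> 'p \<Rightarrow> complex"
  assumes P: "fun_algebra P" and c: "\<forall>i<N. \<forall>j<N. c i j \<in> P"
  shows "\<exists>q. (\<forall>k<N. q k \<in> P) \<and>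
     (\<forall>x l b. (\<exists>i<N. b i \<noteq> 0) \<longrightarrow> (\<forall>i<N. l * b i = (\<Sum>j<N. c i j x * b j)) \<longrightarrow> monic_val N q x l = 0)"
proof -
  define A where "A x = Matrix.mat N N (\<lambda>(i, j). c i j x)" for x
  have A: "A x \<in> carrier_mat N N" for x by (auto simp: A_def)
  define q where "q k x = Polynomial.coeff (char_poly (A x)) k" for k x
  have cm: "char_poly_matrix (A x) \<in> carrier_mat N N" for x using A by (auto simp: char_poly_matrix_def)
  have ent: "coeffs_in P (\<lambda>x. char_poly_matrix (A x) $$ (i, j))" if "i < N" "j < N" for i j
  proof -
    have "char_poly_matrix (A x) $$ (i, j) = (if i = j then [:0,1:] else 0) + [:- c i j x:]" for x
      using that unfolding char_poly_matrix_def A_def by (auto simp: one_pCons)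
    then show ?thesis using that c
      by (auto intro!: coeffs_in_const[OF P] coeffs_in_add[OF P] coeffs_in_pCons[OF P] fa_uminus[OF P] fa_const[OF P])
  qed
  have "coeffs_in P (\<lambda>x. char_poly (A x))"
    unfolding char_poly_def det_def'[OF cm]
    by (intro coeffs_in_sum[OF P] coeffs_in_mult[OF P] coeffs_in_prod[OF P] coeffs_in_const[OF P] ent)
       (auto dest: permutes_in_image[of _ _ "_::nat"])
  then have q: "q k \<in> P" for k by (simp add: coeffs_in_def q_def[abs_def])
  have "monic_val N q x l = 0"
    if b: "\<exists>i<N. b i \<noteq> 0" and e: "\<forall>i<N. l * b i = (\<Sum>j<N. c i j x * b j)" for x l b
  proof -
    define v where "v = Matrix.vec N b"
    have "eigenvector (A x) v l"
    proof -
      have "A x *\<^sub>v v = l \<cdot>\<^sub>v v"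
        by (rule eq_vecI) (use e in \<open>auto simp: A_def v_def scalar_prod_def atLeast0LessThan\<close>)
      moreover have "v \<noteq> 0\<^sub>v N" using b by (auto simp: v_def vec_eq_iff)
      ultimately show ?thesis using A[of x] by (auto simp: eigenvector_def v_def)
    qed
    then have "poly (char_poly (A x)) l = 0"
      using eigenvalue_root_char_poly[OF A] by (auto simp: eigenvalue_def)
    moreover have "poly (char_poly (A x)) l = (\<Sum>k\<le>N. q k x * l ^ k)"
      using degree_monic_char_poly[OF A, of x] by (simp add: poly_altdef q_def)
    moreover have "q N x = 1" using degree_monic_char_poly[OF A, of x] by (simp add: q_def)
    ultimately show ?thesis by (simp add: monic_val_def lessThan_Suc_atMost[symmetric] add.commute)
  qed
  with q show ?thesis by blast
qed

lemma eigenvalue_monic: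
  fixes c :: "'j \<Rightarrow> 'j \<Rightarrow> 'p \<Rightarrow> complex"
  assumes P: "fun_algebra P" and J: "finite J" and c: "\<forall>i\<in>J. \<forall>j\<in>J. c i j \<in> P"
  shows "\<exists>q. (\<forall>k<card J. q k \<in> P) \<and>
     (\<forall>x l b. (\<exists>i\<in>J. b i \<noteq> 0) \<longrightarrow> (\<forall>i\<in>J. l * b i = (\<Sum>j\<in>J. c i j x * b j)) \<longrightarrow> monic_val (card J) q x l = 0)"
proof -
  obtain h where h: "bij_betw h {..<card J} J"
    using ex_bij_betw_nat_finite[OF J] by (auto simp: atLeast0LessThan)
  have hJ: "i < card J \<Longrightarrow> h i \<in> J" for i using h by (auto simp: bij_betw_def)
  have "\<forall>i<card J. \<forall>j<card J. c (h i) (h j) \<in> P" using c hJ by blast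
  from eigenvalue_monic_nat[of P "card J" "\<lambda>i j. c (h i) (h j)", OF P this]
  obtain q where q: "\<forall>k<card J. q k \<in> P"
    and r: "\<forall>x l b. (\<exists>i<card J. b i \<noteq> 0) \<longrightarrow>
       (\<forall>i<card J. l * b i = (\<Sum>j<card J. c (h i) (h j) x * b j)) \<longrightarrow> monic_val (card J) q x l = 0"
    by (elim exE conjE)
  have "monic_val (card J) q x l = 0"
    if b: "\<exists>i\<in>J. b i \<noteq> 0" and e: "\<forall>i\<in>J. l * b i = (\<Sum>j\<in>J. c i j x * b j)" for x l b
  proof (rule r[THEN spec, THEN spec, THEN spec, THEN mp, THEN mp, of "\<lambda>i. b (h i)"])
    have "J = h ` {..<card J}" using h by (auto simp: bij_betw_def)
    with b show "\<exists>i<card J. b (h i) \<noteq> 0" by (metis (no_types) imageE lessThan_iff)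
    show "\<forall>i<card J. l * b (h i) = (\<Sum>j<card J. c (h i) (h j) x * b (h j))"
      using e hJ sum.reindex_bij_betw[OF h, of "\<lambda>j. c (h _) j x * b j"] by simp
  qed
  with q show ?thesis by blast
qed

lemma power_reduce:
  assumes P: "fun_algebra P" and p: "\<forall>k<D. p k \<in> P" and D: "D \<ge> 1"
  shows "\<exists>r. (\<forall>j<D. r j \<in> P) \<and> (\<forall>x y. monic_val D p x y = 0 \<longrightarrow> y ^ k = (\<Sum>j<D. r j x * y ^ j))"
proof (induction k)
  case 0
  show ?case
    using D by (intro exI[of _ "\<lambda>j _. if j = 0 then 1 else 0"])
      (auto intro: fa_const[OF P] simp: if_distrib[of "\<lambda>z. z * _"] cong: if_cong)
next
  case (Suc k)
  then obtain r where r: "\<forall>j<D. r j \<in> P"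
    "\<And>x y. monic_val D p x y = 0 \<Longrightarrow> y ^ k = (\<Sum>j<D. r j x * y ^ j)" by blast
  define D' where "D' = D - 1"
  have D': "D = Suc D'" using D by (simp add: D'_def)
  \<comment> \<open>Shift all coefficients up by one degree and rewrite the overflowing
    \<open>y ^ D\<close> by the monic equation.\<close>
  define r' where "r' j x = (if j = 0 then 0 else r (j - 1) x) - r D' x * p j x" for j x
  have "r' j \<in> P" if "j < D" for j
  proof -
    have "(\<lambda>x. if j = 0 then 0 else r (j - 1) x) \<in> P"
      using that r(1) by (cases "j = 0") (simp_all add: fa_const[OF P])
    moreover have "(\<lambda>x. r D' x * p j x) \<in> P"
      by (rule fa_mult[OF P]) (use that r(1) p D' in simp_all)
    ultimately show ?thesis unfolding r'_def[abs_def] by (rule fa_diff[OF P])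
  qed
  moreover have "y ^ Suc k = (\<Sum>j<D. r' j x * y ^ j)" if "monic_val D p x y = 0" for x y
  proof -
    have yD: "y ^ D = - (\<Sum>j<D. p j x * y ^ j)" using that by (simp add: monic_val_def eq_neg_iff_add_eq_0)
    have "y ^ Suc k = (\<Sum>j<D. r j x * y ^ Suc j)"
      using r(2)[OF that] by (simp add: sum_distrib_left mult_ac)
    also have "\<dots> = (\<Sum>j<D'. r j x * y ^ Suc j) + r D' x * y ^ D" by (simp add: D')
    also have "(\<Sum>j<D'. r j x * y ^ Suc j) = (\<Sum>j<D. (if j = 0 then 0 else r (j - 1) x) * y ^ j)"
      unfolding D' by (subst sum.lessThan_Suc_shift) simp
    finally show ?thesis
      by (simp add: yD r'_def algebra_simps sum_subtractf sum_distrib_left)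
  qed
  ultimately show ?case by blast
qed

text \<open>Multiplication by \<open>y - z\<close> acts on the \<open>D * D\<close> products
  \<open>y ^ i * z ^ j\<close> by a matrix with entries in \<open>P\<close>, so the determinant
  trick applies; the vector of products is nonzero because its entry at \<open>(0, 0)\<close> is 1.
  The case of interest is the change of a root after a half turn.\<close>

lemma difference_monic:
  assumes P: "fun_algebra P" and p: "\<forall>k<D. p k \<in> P" and D: "D \<ge> 1"
  shows "\<exists>N q. N \<ge> 1 \<and> (\<forall>k<N. q k \<in> P) \<and>
    (\<forall>x y z. monic_val D p x y = 0 \<longrightarrow> monic_val D p x z = 0 \<longrightarrow> monic_val N q x (y - z) = 0)"
proof -
  have "\<forall>i. \<exists>r. (\<forall>j<D. r j \<in> P) \<and> (\<forall>x y. monic_val D p x y = 0 \<longrightarrow> y ^ i = (\<Sum>j<D. r j x * y ^ j))"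
    using power_reduce[of P D p, OF P p D] by blast
  then obtain r where r: "\<And>i j. j < D \<Longrightarrow> r i j \<in> P"
    "\<And>i x y. monic_val D p x y = 0 \<Longrightarrow> y ^ i = (\<Sum>j<D. r i j x * y ^ j)" by metis
  define J where "J = {..<D} \<times> {..<D}"
  define c where "c = (\<lambda>(i, j) (i', j') x. (if j = j' then r (Suc i) i' x else 0) - (if i = i' then r (Suc j) j' x else 0))"
  have "c a b \<in> P" if "a \<in> J" "b \<in> J" for a b
  proof -
    obtain i j i' j' where ab: "a = (i, j)" "b = (i', j')" by fastforce
    have *: "(\<lambda>x. if Q then f x else 0) \<in> P" if "f \<in> P" for Q f
      using that by (cases Q) (simp_all add: fa_const[OF P])
    show ?thesis unfolding c_def ab prod.case
      using that by (intro fa_diff[OF P] * r(1)) (auto simp: ab J_def)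
  qed
  then have cP: "\<forall>a\<in>J. \<forall>b\<in>J. c a b \<in> P" by blast
  have "finite J" by (simp add: J_def)
  from eigenvalue_monic[of P J c, OF P this cP]
  obtain q where q: "\<forall>k<card J. q k \<in> P"
    and e: "\<forall>x l b. (\<exists>i\<in>J. b i \<noteq> 0) \<longrightarrow> (\<forall>i\<in>J. l * b i = (\<Sum>j\<in>J. c i j x * b j)) \<longrightarrow> monic_val (card J) q x l = 0"
    by (elim exE conjE)
  have "monic_val (card J) q x (y - z) = 0" if y: "monic_val D p x y = 0" and z: "monic_val D p x z = 0" for x y z
  proof (rule e[THEN spec, THEN spec, THEN spec, THEN mp, THEN mp, of "\<lambda>(i, j). y ^ i * z ^ j"])
    show "\<exists>i\<in>J. (case i of (i, j) \<Rightarrow> y ^ i * z ^ j) \<noteq> 0"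
      using D by (intro bexI[of _ "(0,0)"]) (auto simp: J_def)
    show "\<forall>i\<in>J. (y - z) * (case i of (i, j) \<Rightarrow> y ^ i * z ^ j) = (\<Sum>j\<in>J. c i j x * (case j of (i, j) \<Rightarrow> y ^ i * z ^ j))"
    proof
      fix a assume "a \<in> J"
      then obtain i j where a: "a = (i, j)" "i < D" "j < D" by (auto simp: J_def)
      let ?f = "\<lambda>(i, j). y ^ i * z ^ j"
      have "(\<Sum>b\<in>J. c a b x * ?f b) =
        (\<Sum>b\<in>J. (if snd b = j then r (Suc i) (fst b) x * y ^ fst b * z ^ j else 0)) -
        (\<Sum>b\<in>J. (if fst b = i then r (Suc j) (snd b) x * y ^ i * z ^ snd b else 0))"
        unfolding sum_subtractf[symmetric]
        by (intro sum.cong refl) (simp add: c_def a split_beta left_diff_distrib)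
      also have "(\<Sum>b\<in>J. (if snd b = j then r (Suc i) (fst b) x * y ^ fst b * z ^ j else 0)) =
        (\<Sum>i'<D. \<Sum>j'<D. if j' = j then r (Suc i) i' x * y ^ i' * z ^ j else 0)"
        unfolding J_def sum.cartesian_product by (simp add: split_beta)
      also have "\<dots> = (\<Sum>i'<D. r (Suc i) i' x * y ^ i' * z ^ j)"
        using a by (simp only: sum.delta finite_lessThan lessThan_iff if_True)
      also have "(\<Sum>b\<in>J. (if fst b = i then r (Suc j) (snd b) x * y ^ i * z ^ snd b else 0)) =
        (\<Sum>i'<D. \<Sum>j'<D. if i' = i then r (Suc j) j' x * y ^ i * z ^ j' else 0)"
        unfolding J_def sum.cartesian_product by (simp add: split_beta)
      also have "\<dots> = (\<Sum>j'<D. \<Sum>i'<D. if i' = i then r (Suc j) j' x * y ^ i * z ^ j' else 0)"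
        by (rule sum.swap)
      also have "\<dots> = (\<Sum>j'<D. r (Suc j) j' x * y ^ i * z ^ j')"
        using a by (simp only: sum.delta finite_lessThan lessThan_iff if_True)
      also have "(\<Sum>i'<D. r (Suc i) i' x * y ^ i' * z ^ j) - (\<Sum>j'<D. r (Suc j) j' x * y ^ i * z ^ j') =
          y ^ Suc i * z ^ j - y ^ i * z ^ Suc j"
        unfolding r(2)[OF y, of "Suc i"] r(2)[OF z, of "Suc j"] by (simp add: sum_distrib_left sum_distrib_right mult_ac)
      finally show "(y - z) * (case a of (i, j) \<Rightarrow> y ^ i * z ^ j) = (\<Sum>b\<in>J. c a b x * (case b of (i, j) \<Rightarrow> y ^ i * z ^ j))"
        by (simp add: a algebra_simps)
    qed
  qed
  moreover have "card J \<ge> 1" using D by (simp add: J_def)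
  ultimately show ?thesis using q by blast
qed

text \<open>The same argument for multiplication by a polynomial in \<open>y\<close>, acting on the
  powers of \<open>y\<close> below \<open>D\<close>. It makes polynomial expressions in the
  parameters and a root integral, and on spirals such quantities are zero or bounded away from
  zero.\<close>

lemma combination_monic:
  assumes P: "fun_algebra P" and p: "\<forall>k<D. p k \<in> P" and D: "D \<ge> 1"
    and G: "\<forall>k<L. G k \<in> P"
  shows "\<exists>q. (\<forall>k<D. q k \<in> P) \<and>
    (\<forall>x y. monic_val D p x y = 0 \<longrightarrow> monic_val D q x (\<Sum>k<L. G k x * y ^ k) = 0)"
proof -
  have "\<forall>i. \<exists>r. (\<forall>j<D. r j \<in> P) \<and> (\<forall>x y. monic_val D p x y = 0 \<longrightarrow> y ^ i = (\<Sum>j<D. r j x * y ^ j))"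
    using power_reduce[of P D p, OF P p D] by blast
  then obtain r where r: "\<And>i j. j < D \<Longrightarrow> r i j \<in> P"
    "\<And>i x y. monic_val D p x y = 0 \<Longrightarrow> y ^ i = (\<Sum>j<D. r i j x * y ^ j)" by metis
  define c where "c i j x = (\<Sum>k<L. G k x * r (k + i) j x)" for i j x
  have "c i j \<in> P" if "i < D" "j < D" for i j
    unfolding c_def[abs_def] using that G by (intro fa_sum[OF P] fa_mult[OF P] r(1)) auto
  then have cP: "\<forall>i<D. \<forall>j<D. c i j \<in> P" by blast
  from eigenvalue_monic_nat[of P D c, OF P cP]
  obtain q where q: "\<forall>k<D. q k \<in> P"
    and e: "\<forall>x l b. (\<exists>i<D. b i \<noteq> 0) \<longrightarrow> (\<forall>i<D. l * b i = (\<Sum>j<D. c i j x * b j)) \<longrightarrow> monic_val D q x l = 0"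
    by (elim exE conjE)
  have "monic_val D q x (\<Sum>k<L. G k x * y ^ k) = 0" if y: "monic_val D p x y = 0" for x y
  proof (rule e[THEN spec, THEN spec, THEN spec, THEN mp, THEN mp, of "\<lambda>i. y ^ i"])
    show "\<exists>i<D. y ^ i \<noteq> 0" using D by (intro exI[of _ 0]) auto
    show "\<forall>i<D. (\<Sum>k<L. G k x * y ^ k) * y ^ i = (\<Sum>j<D. c i j x * y ^ j)"
    proof (intro allI impI)
      fix i assume "i < D"
      have "(\<Sum>k<L. G k x * y ^ k) * y ^ i = (\<Sum>k<L. G k x * y ^ (k + i))"
        unfolding sum_distrib_right power_add by (simp add: mult.assoc)
      also have "\<dots> = (\<Sum>k<L. \<Sum>j<D. G k x * (r (k + i) j x * y ^ j))"
        by (intro sum.cong refl, subst r(2)[OF y]) (simp only: sum_distrib_left)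
      also have "\<dots> = (\<Sum>j<D. c i j x * y ^ j)"
        unfolding c_def sum_distrib_right by (subst sum.swap) (simp add: mult.assoc)
      finally show "(\<Sum>k<L. G k x * y ^ k) * y ^ i = (\<Sum>j<D. c i j x * y ^ j)" .
    qed
  qed
  with q show ?thesis by blast
qed

section \<open>The Hilbert basis theorem for algebras of functions\<close>

text \<open>For \<open>S\<close> contained in the algebra \<open>P\<close> this is the ideal
  generated by \<open>S\<close>.\<close>

definition fun_span :: "('p \<Rightarrow> complex) set \<Rightarrow> ('p \<Rightarrow> complex) set \<Rightarrow> ('p \<Rightarrow> complex) set" where
  "fun_span P S = {f. \<exists>T c. finite T \<and> T \<subseteq> S \<and> (\<forall>g\<in>T. c g \<in> P) \<and> f = (\<lambda>x. \<Sum>g\<in>T. c g x * g x)}"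

text \<open>Generators are selected from an arbitrary given set, not merely found in the ideal it
  generates; this is the form that yields finite subcovers.\<close>

definition noetherian_algebra :: "('p \<Rightarrow> complex) set \<Rightarrow> bool" where
  "noetherian_algebra P \<longleftrightarrow> fun_algebra P \<and>
     (\<forall>S\<subseteq>P. \<exists>T. finite T \<and> T \<subseteq> S \<and> S \<subseteq> fun_span P T)"

lemma fun_span_mono: "S \<subseteq> S' \<Longrightarrow> fun_span P S \<subseteq> fun_span P S'"
  unfolding fun_span_def by blast

lemma fun_span_zero: "fun_algebra P \<Longrightarrow> (\<lambda>_. 0) \<in> fun_span P S"
  unfolding fun_span_def by (intro CollectI exI[of _ "{}"] exI[of _ "\<lambda>_. (\<lambda>_. 0)"]) auto

lemma fun_span_gen: "fun_algebra P \<Longrightarrow> f \<in> S \<Longrightarrow> c \<in> P \<Longrightarrow> (\<lambda>x. c x * f x) \<in> fun_span P S"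
  unfolding fun_span_def by (intro CollectI exI[of _ "{f}"] exI[of _ "\<lambda>_. c"]) auto

lemma fun_span_add:
  assumes "fun_algebra P" "f \<in> fun_span P S" "g \<in> fun_span P S"
  shows "(\<lambda>x. f x + g x) \<in> fun_span P S"
proof -
  obtain T c where T: "finite T" "T \<subseteq> S" "\<forall>h\<in>T. c h \<in> P" "f = (\<lambda>x. \<Sum>h\<in>T. c h x * h x)"
    using assms(2) unfolding fun_span_def by blast
  obtain U d where U: "finite U" "U \<subseteq> S" "\<forall>h\<in>U. d h \<in> P" "g = (\<lambda>x. \<Sum>h\<in>U. d h x * h x)"
    using assms(3) unfolding fun_span_def by blast
  define e where "e h x = (if h \<in> T then c h x else 0) + (if h \<in> U then d h x else 0)" for h x
  have "e h \<in> P" for h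
  proof -
    have "(\<lambda>x. if h \<in> T then c h x else 0) \<in> P" "(\<lambda>x. if h \<in> U then d h x else 0) \<in> P"
      using T U by (cases "h \<in> T"; cases "h \<in> U"; simp add: fa_const[OF assms(1)])+
    then show ?thesis unfolding e_def[abs_def] by (rule fa_add[OF assms(1)])
  qed
  moreover have "(\<lambda>x. f x + g x) = (\<lambda>x. \<Sum>h\<in>T \<union> U. e h x * h x)"
  proof
    fix x
    have "(\<Sum>h\<in>T \<union> U. e h x * h x) =
      (\<Sum>h\<in>T \<union> U. if h \<in> T then c h x * h x else 0) + (\<Sum>h\<in>T \<union> U. if h \<in> U then d h x * h x else 0)"
      unfolding sum.distrib[symmetric] by (intro sum.cong refl) (simp add: e_def algebra_simps)
    also have "(\<Sum>h\<in>T \<union> U. if h \<in> T then c h x * h x else 0) = f x"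
      unfolding T(4) using T U by (subst sum.inter_restrict[symmetric]) (auto intro!: sum.cong)
    also have "(\<Sum>h\<in>T \<union> U. if h \<in> U then d h x * h x else 0) = g x"
      unfolding U(4) using T U by (subst sum.inter_restrict[symmetric]) (auto intro!: sum.cong)
    finally show "f x + g x = (\<Sum>h\<in>T \<union> U. e h x * h x)" by simp
  qed
  ultimately show ?thesis
    unfolding fun_span_def using T U by (intro CollectI exI[of _ "T \<union> U"] exI[of _ e]) auto
qed

lemma fun_span_mult:
  assumes "fun_algebra P" "f \<in> fun_span P S" "a \<in> P"
  shows "(\<lambda>x. a x * f x) \<in> fun_span P S"
proof -
  obtain T c where T: "finite T" "T \<subseteq> S" "\<forall>h\<in>T. c h \<in> P" "f = (\<lambda>x. \<Sum>h\<in>T. c h x * h x)"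
    using assms(2) unfolding fun_span_def by blast
  have "(\<lambda>x. a x * f x) = (\<lambda>x. \<Sum>h\<in>T. (a x * c h x) * h x)"
    by (simp add: T(4) sum_distrib_left mult_ac)
  then show ?thesis
    unfolding fun_span_def using T fa_mult[OF assms(1,3)]
    by (intro CollectI exI[of _ T] exI[of _ "\<lambda>h x. a x * c h x"]) auto
qed

lemma fun_span_sum:
  assumes "fun_algebra P" "\<And>i. i \<in> I \<Longrightarrow> f i \<in> fun_span P S"
  shows "(\<lambda>x. \<Sum>i\<in>I. f i x) \<in> fun_span P S"
  using assms(2)
  by (induction I rule: infinite_finite_induct) (auto intro: fun_span_zero fun_span_add assms(1))

lemma fun_span_trans:
  assumes "fun_algebra P" "S \<subseteq> fun_span P T"
  shows "fun_span P S \<subseteq> fun_span P T"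
proof
  fix f assume "f \<in> fun_span P S"
  then obtain U c where U: "finite U" "U \<subseteq> S" "\<forall>h\<in>U. c h \<in> P" "f = (\<lambda>x. \<Sum>h\<in>U. c h x * h x)"
    unfolding fun_span_def by blast
  show "f \<in> fun_span P T" unfolding U(4)
    by (intro fun_span_sum[OF assms(1)] fun_span_mult[OF assms(1)]) (use U assms(2) in auto)
qed

lemma fun_span_finite_subset:
  assumes "fun_algebra P" "finite T" "T \<subseteq> fun_span P S"
  shows "\<exists>S'. finite S' \<and> S' \<subseteq> S \<and> T \<subseteq> fun_span P S'"
proof -
  have "\<exists>U. finite U \<and> U \<subseteq> S \<and> f \<in> fun_span P U" if "f \<in> T" for f
  proof -
    have "f \<in> fun_span P S" using assms(3) that by blast
    then obtain U c where U: "finite U" "U \<subseteq> S" "\<forall>g\<in>U. c g \<in> P" "f = (\<lambda>x. \<Sum>g\<in>U. c g x * g x)"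
      unfolding fun_span_def by blast
    have "f \<in> fun_span P U"
      unfolding fun_span_def by (rule CollectI, rule exI[of _ U], rule exI[of _ c]) (use U in simp)
    then show ?thesis using U(1,2) by blast
  qed
  then obtain U where U: "\<And>f. f \<in> T \<Longrightarrow> finite (U f) \<and> U f \<subseteq> S \<and> f \<in> fun_span P (U f)" by metis
  have "T \<subseteq> fun_span P (\<Union>f\<in>T. U f)"
  proof
    fix f assume "f \<in> T"
    then show "f \<in> fun_span P (\<Union>f\<in>T. U f)" using U[of f] fun_span_mono[of "U f" "\<Union>f\<in>T. U f" P] by blast
  qed
  then show ?thesis using U assms(2) by (intro exI[of _ "\<Union>f\<in>T. U f"]) auto
qed

lemma noetherian_constants: "noetherian_algebra (range (\<lambda>c _. c))"
proof -
  let ?P = "range (\<lambda>(c::complex) (_::'a). c)"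
  have P: "fun_algebra ?P" by (intro fun_algebraI) auto
  have "\<exists>T. finite T \<and> T \<subseteq> S \<and> S \<subseteq> fun_span ?P T" if "S \<subseteq> ?P" for S
  proof (cases "S \<subseteq> {\<lambda>_. 0}")
    case True
    then show ?thesis using fun_span_zero[OF P, of "{}"] by (intro exI[of _ "{}"]) auto
  next
    case False
    then obtain f where f: "f \<in> S" "f \<noteq> (\<lambda>_. 0)" by blast
    then have "f \<in> ?P" using that by blast
    then obtain c where "f = (\<lambda>_. c)" by blast
    with f have c: "c \<noteq> 0" "(\<lambda>_. c) \<in> S" by auto
    have "S \<subseteq> fun_span ?P {\<lambda>_. c}"
    proof
      fix f assume "f \<in> S"
      then have "f \<in> ?P" using that by blast
      then obtain d where "f = (\<lambda>_. d)" by blast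
      then have "f = (\<lambda>x. (\<lambda>_. d / c) x * (\<lambda>_. c) x)" using c by auto
      then show "f \<in> fun_span ?P {\<lambda>_. c}"
        using fun_span_gen[OF P, of "\<lambda>_. c" "{\<lambda>_. c}" "\<lambda>_. d / c"] by auto
    qed
    then show ?thesis using c by (intro exI[of _ "{\<lambda>_. c}"]) auto
  qed
  then show ?thesis using P by (simp add: noetherian_algebra_def)
qed

text \<open>
  The function \<open>g\<close> need not be transcendental over the algebra, so these representations are not unique;
  Hilbert's argument applies to the leading coefficients of representations of minimal formal degree.
\<close>
definition poly_rep :: "('p \<Rightarrow> complex) \<Rightarrow> (nat \<Rightarrow> 'p \<Rightarrow> complex) \<Rightarrow> nat \<Rightarrow> 'p \<Rightarrow> complex" where
  "poly_rep g a d x = (\<Sum>k\<le>d. a k x * g x ^ k)"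

lemma alg_gen_insert_rep:
  assumes P: "fun_algebra P" and f: "f \<in> alg_gen (insert g P)"
  shows "\<exists>a d. (\<forall>k. a k \<in> P) \<and> f = poly_rep g a d"
proof -
  \<comment> \<open>The degree bound is uniform in \<open>x\<close>, so that a single length
    \<open>d\<close> works at all points, wherever the actual degree may drop.\<close>
  define Q where "Q = {f. \<exists>p. coeffs_in P p \<and> (\<exists>d. \<forall>x. degree (p x) \<le> d) \<and> f = (\<lambda>x. poly (p x) (g x))}"
  have "alg_gen (insert g P) \<subseteq> Q"
  proof (rule alg_gen_least)
    show "fun_algebra Q"
    proof (intro fun_algebraI)
      fix c show "(\<lambda>_. c) \<in> Q" unfolding Q_def
        by (intro CollectI exI[of _ "\<lambda>_. [:c:]"]) (auto intro: coeffs_in_const[OF P])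
    next
      fix f h assume "f \<in> Q" "h \<in> Q"
      then obtain p q d e where *: "coeffs_in P p" "\<And>x. degree (p x) \<le> d" "f = (\<lambda>x. poly (p x) (g x))"
         "coeffs_in P q" "\<And>x. degree (q x) \<le> e" "h = (\<lambda>x. poly (q x) (g x))"
        unfolding Q_def by blast
      have "degree (p x + q x) \<le> max d e" for x
        using degree_add_le[of "p x" "max d e" "q x"] *(2)[of x] *(5)[of x] by simp
      moreover have "coeffs_in P (\<lambda>x. p x + q x)" using * by (intro coeffs_in_add[OF P])
      moreover have "(\<lambda>x. f x + h x) = (\<lambda>x. poly (p x + q x) (g x))" using * by auto
      ultimately show "(\<lambda>x. f x + h x) \<in> Q" unfolding Q_def by blast
      have "degree (p x * q x) \<le> d + e" for x
        using degree_mult_le[of "p x" "q x"] *(2)[of x] *(5)[of x] by linarith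
      moreover have "coeffs_in P (\<lambda>x. p x * q x)" using * by (intro coeffs_in_mult[OF P])
      moreover have "(\<lambda>x. f x * h x) = (\<lambda>x. poly (p x * q x) (g x))" using * by auto
      ultimately show "(\<lambda>x. f x * h x) \<in> Q" unfolding Q_def by blast
    qed
    show "insert g P \<subseteq> Q"
    proof
      fix f assume "f \<in> insert g P"
      then consider "f = g" | "f \<in> P" by auto
      then show "f \<in> Q"
      proof cases
        case 1
        then show ?thesis unfolding Q_def
          by (intro CollectI exI[of _ "\<lambda>_. [:0,1:]"]) (auto intro: coeffs_in_const[OF P])
      next
        case 2
        have "coeffs_in P (\<lambda>x. pCons (f x) 0)"
          by (rule coeffs_in_pCons[OF P 2 coeffs_in_const[OF P]])
        moreover have "degree (pCons (f x) 0) \<le> 0" for x by simp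
        moreover have "f = (\<lambda>x. poly (pCons (f x) 0) (g x))" by auto
        ultimately show ?thesis unfolding Q_def by blast
      qed
    qed
  qed
  then obtain p d where p: "coeffs_in P p" "\<And>x. degree (p x) \<le> d" "f = (\<lambda>x. poly (p x) (g x))"
    using f unfolding Q_def by blast
  have "poly (p x) (g x) = (\<Sum>k\<le>d. Polynomial.coeff (p x) k * g x ^ k)" for x
  proof -
    have "(\<Sum>k\<le>degree (p x). Polynomial.coeff (p x) k * g x ^ k) = (\<Sum>k\<le>d. Polynomial.coeff (p x) k * g x ^ k)"
      by (rule sum.mono_neutral_left) (use p(2)[of x] in \<open>auto simp: coeff_eq_0\<close>)
    then show ?thesis by (simp add: poly_altdef)
  qed
  then have "f = poly_rep g (\<lambda>k x. Polynomial.coeff (p x) k) d"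
    unfolding p(3) poly_rep_def by auto
  moreover have "\<forall>k. (\<lambda>x. Polynomial.coeff (p x) k) \<in> P" using p(1) by (simp add: coeffs_in_def)
  ultimately show ?thesis by (intro exI conjI)
qed

text \<open>Each new element of \<open>I\<close> is taken outside the span of the earlier ones with
  least formal degree. Once a leading coefficient is a combination of earlier ones, subtracting the
  shifted combination lowers the formal degree without entering the span.\<close>

lemma noetherian_insert:
  assumes N: "noetherian_algebra P"
  shows "noetherian_algebra (alg_gen (insert g P))"
proof -
  let ?Q = "alg_gen (insert g P)"
  have P: "fun_algebra P" using N by (simp add: noetherian_algebra_def)
  note Q = fun_algebra_alg_gen[of "insert g P"]
  have PQ: "P \<subseteq> ?Q" by (auto intro: alg_gen.gen)
  have gQ: "g \<in> ?Q" by (auto intro: alg_gen.gen)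
  have "\<exists>T. finite T \<and> T \<subseteq> S \<and> S \<subseteq> fun_span ?Q T" if S: "S \<subseteq> ?Q" for S
  proof (rule ccontr)
    assume none: "\<not> ?thesis"
    define I where "I = fun_span ?Q S"
    have SI: "S \<subseteq> I"
    proof
      fix f assume "f \<in> S"
      then show "f \<in> I" using fun_span_gen[OF Q, of f S "\<lambda>_. 1"] fa_const[OF Q, of 1] by (simp add: I_def)
    qed
    have IQ: "I \<subseteq> ?Q"
      unfolding I_def fun_span_def using S by (auto intro!: fa_sum[OF Q] fa_mult[OF Q])
    have nfg: "\<not> I \<subseteq> fun_span ?Q T" if T: "finite T" "T \<subseteq> I" for T
    proof
      assume *: "I \<subseteq> fun_span ?Q T"
      obtain S' where "finite S'" "S' \<subseteq> S" "T \<subseteq> fun_span ?Q S'"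
        using fun_span_finite_subset[OF Q T(1), of S] T(2) unfolding I_def by blast
      moreover from this have "S \<subseteq> fun_span ?Q S'" using fun_span_trans[OF Q, of T S'] * SI by blast
      ultimately show False using none by blast
    qed
    define R where "R f a d \<longleftrightarrow> f \<in> I \<and> (\<forall>k. a k \<in> P) \<and> f = poly_rep g a d" for f a d
    have step: "\<exists>h. (\<exists>a. R (fst h) a (snd h) \<and> fst h \<notin> fun_span ?Q T) \<and>
        (\<forall>f a d. R f a d \<longrightarrow> f \<notin> fun_span ?Q T \<longrightarrow> snd h \<le> d)" if T: "finite T" "T \<subseteq> I" for T
    proof -
      define D where "D d \<longleftrightarrow> (\<exists>f a. R f a d \<and> f \<notin> fun_span ?Q T)" for d
      obtain f where f: "f \<in> I" "f \<notin> fun_span ?Q T" using nfg[OF T] by blast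
      obtain a d where ad: "\<forall>k. a k \<in> P" "f = poly_rep g a d"
        using alg_gen_insert_rep[OF P, of f g] IQ f(1) by blast
      have "D d" unfolding D_def R_def using f ad by blast
      then have "D (Least D)" "\<And>d'. D d' \<Longrightarrow> Least D \<le> d'" by (auto intro: LeastI Least_le)
      then obtain f' a' where "R f' a' (Least D)" "f' \<notin> fun_span ?Q T"
        "\<And>f a d. R f a d \<Longrightarrow> f \<notin> fun_span ?Q T \<Longrightarrow> Least D \<le> d"
        unfolding D_def by blast
      then show ?thesis by (intro exI[of _ "(f', Least D)"]) auto
    qed
    then obtain H where H: "\<And>T. finite T \<Longrightarrow> T \<subseteq> I \<Longrightarrow>
        (\<exists>a. R (fst (H T)) a (snd (H T)) \<and> fst (H T) \<notin> fun_span ?Q T) \<and>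
        (\<forall>f a d. R f a d \<longrightarrow> f \<notin> fun_span ?Q T \<longrightarrow> snd (H T) \<le> d)" by metis
    define TT where "TT = rec_nat {} (\<lambda>_ T. insert (fst (H T)) T)"
    have TT: "TT 0 = {}" "\<And>i. TT (Suc i) = insert (fst (H (TT i))) (TT i)" by (auto simp: TT_def)
    have TI: "finite (TT i) \<and> TT i \<subseteq> I" for i
      by (induction i) (use H in \<open>auto simp: TT R_def\<close>)
    define f where "f i = fst (H (TT i))" for i
    define d where "d i = snd (H (TT i))" for i
    have TTmono: "i \<le> j \<Longrightarrow> TT i \<subseteq> TT j" for i j
      by (rule lift_Suc_mono_le[of TT]) (auto simp: TT)
    have "\<forall>i. \<exists>a. R (f i) a (d i)" using H TI by (metis f_def d_def)
    then obtain a where a: "\<And>i. R (f i) (a i) (d i)" by metis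
    have fn: "f i \<notin> fun_span ?Q (TT i)" for i using H TI by (metis f_def)
    have dmin: "d i \<le> e" if "R h b e" "h \<notin> fun_span ?Q (TT i)" for i h b e
      using H TI that by (metis d_def)
    have dmono: "d i \<le> d j" if "i \<le> j" for i j
      using dmin[OF a, of j i] fn[of j] fun_span_mono[OF TTmono[OF that]] by blast
    define l where "l i = a i (d i)" for i
    have lP: "l i \<in> P" for i using a by (auto simp: l_def R_def)
    obtain L where L: "finite L" "L \<subseteq> range l" "range l \<subseteq> fun_span P L"
      using N lP unfolding noetherian_algebra_def by (metis image_subsetI)
    obtain J where J: "finite J" "L = l ` J" using L finite_subset_image[of L l UNIV] by auto
    \<comment> \<open>Any index past \<open>J\<close> would do; inserting 0 makes \<open>Max\<close>
      meaningful when \<open>J\<close> is empty.\<close>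
    define n where "n = Suc (Max (insert 0 J))"
    have Jn: "j < n" if "j \<in> J" for j
      using J that by (simp add: n_def less_Suc_eq_le)
    have "l n \<in> fun_span P (l ` J)" using L J by auto
    then obtain T c where T: "finite T" "T \<subseteq> l ` J" "\<forall>h\<in>T. c h \<in> P" "l n = (\<lambda>x. \<Sum>h\<in>T. c h x * h x)"
      unfolding fun_span_def by blast
    \<comment> \<open>Different indices may have the same leading coefficient, so one index is kept
      for each coefficient that occurs.\<close>
    obtain K where K: "K \<subseteq> J" "inj_on l K" "T = l ` K"
      using T(2) by (meson subset_image_inj)
    have ln: "l n x = (\<Sum>j\<in>K. c (l j) x * l j x)" for x
      unfolding T(4) K(3) using K(2) by (simp add: sum.reindex)
    have Kn: "j < n" if "j \<in> K" for j using K Jn that by auto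
    \<comment> \<open>The power of \<open>g\<close> raises the formal degree of \<open>f j\<close>
      from \<open>d j\<close> to \<open>d n\<close>. As \<open>d\<close> is monotone the subtraction
      is exact, and the coefficients of \<open>s\<close> and \<open>f n\<close> in degree
      \<open>d n\<close> agree.\<close>
    define s where "s x = (\<Sum>j\<in>K. c (l j) x * g x ^ (d n - d j) * f j x)" for x
    have cP: "c (l j) \<in> P" if "j \<in> K" for j using T K that by auto
    have fT: "f j \<in> TT n" if "j \<in> K" for j
      using TTmono[of "Suc j" n] Kn[OF that] by (auto simp: TT f_def)
    have sspan: "s \<in> fun_span ?Q (TT n)" unfolding s_def[abs_def]
      using cP fT gQ PQ
      by (intro fun_span_sum[OF Q] fun_span_gen[OF Q] fa_mult[OF Q] fa_power[OF Q]) auto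
    define h where "h x = f n x + (\<lambda>_. -1) x * s x" for x
    have spanI: "fun_span ?Q (TT n) \<subseteq> I"
      using fun_span_trans[OF Q, of "TT n" S] TI unfolding I_def by blast
    have "f n \<in> fun_span ?Q S" using a[of n] unfolding R_def I_def by blast
    moreover have "s \<in> fun_span ?Q S" using sspan spanI unfolding I_def by blast
    ultimately have hI: "h \<in> I"
      unfolding h_def[abs_def] I_def by (rule fun_span_add[OF Q _ fun_span_mult[OF Q _ fa_const[OF Q]]])
    have hn: "h \<notin> fun_span ?Q (TT n)"
    proof
      assume "h \<in> fun_span ?Q (TT n)"
      then have "(\<lambda>x. h x + s x) \<in> fun_span ?Q (TT n)" by (rule fun_span_add[OF Q _ sspan])
      moreover have "(\<lambda>x. h x + s x) = f n" by (auto simp: h_def)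
      ultimately show False using fn by simp
    qed
    define b where "b k x = a n k x - (\<Sum>j\<in>K. if k \<ge> d n - d j then c (l j) x * a j (k - (d n - d j)) x else 0)" for k x
    have bP: "b k \<in> P" for k
    proof -
      have "(\<lambda>x. if k \<ge> d n - d j then c (l j) x * a j (k - (d n - d j)) x else 0) \<in> P" if "j \<in> K" for j
        using cP[OF that] a[of j] by (cases "k \<ge> d n - d j") (simp_all add: R_def fa_const[OF P] fa_mult[OF P])
      moreover have "a n k \<in> P" using a[of n] by (simp add: R_def)
      ultimately show ?thesis unfolding b_def[abs_def] by (intro fa_diff[OF P] fa_sum[OF P]) auto
    qed
    have hrep: "h x = (\<Sum>k\<le>d n. b k x * g x ^ k)" for x
    proof -
      have "c (l j) x * g x ^ (d n - d j) * f j x =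
         (\<Sum>k\<le>d n. (if k \<ge> d n - d j then c (l j) x * a j (k - (d n - d j)) x else 0) * g x ^ k)" if "j \<in> K" for j
      proof -
        define e where "e = d n - d j"
        have de: "d n = d j + e" using dmono[of j n] Kn[OF that] by (simp add: e_def)
        have "f j x = (\<Sum>k\<le>d j. a j k x * g x ^ k)" using a[of j] by (simp add: R_def poly_rep_def)
        then have "c (l j) x * g x ^ e * f j x = (\<Sum>k\<le>d j. c (l j) x * a j k x * g x ^ (k + e))"
          by (simp add: sum_distrib_left power_add mult_ac)
        also have "\<dots> = (\<Sum>k\<in>{0 + e..d j + e}. c (l j) x * a j (k - e) x * g x ^ k)"
          unfolding sum.shift_bounds_cl_nat_ivl by (simp add: atMost_atLeast0)
        also have "\<dots> = (\<Sum>k\<le>d n. (if k \<ge> e then c (l j) x * a j (k - e) x else 0) * g x ^ k)"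
          by (rule sum.mono_neutral_cong_left) (auto simp: de)
        finally show ?thesis unfolding e_def .
      qed
      then have "s x = (\<Sum>j\<in>K. \<Sum>k\<le>d n. (if k \<ge> d n - d j then c (l j) x * a j (k - (d n - d j)) x else 0) * g x ^ k)"
        unfolding s_def by (intro sum.cong refl) simp
      also have "\<dots> = (\<Sum>k\<le>d n. (\<Sum>j\<in>K. if k \<ge> d n - d j then c (l j) x * a j (k - (d n - d j)) x else 0) * g x ^ k)"
        by (subst sum.swap) (simp only: sum_distrib_right)
      finally have "s x = \<dots>" .
      moreover have "f n x = (\<Sum>k\<le>d n. a n k x * g x ^ k)" using a[of n] by (simp add: R_def poly_rep_def)
      ultimately show ?thesis
        by (simp add: h_def b_def left_diff_distrib sum_subtractf)
    qed
    have btop: "b (d n) x = 0" for x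
    proof -
      have "(\<Sum>j\<in>K. if d n \<ge> d n - d j then c (l j) x * a j (d n - (d n - d j)) x else 0) = (\<Sum>j\<in>K. c (l j) x * l j x)"
        by (intro sum.cong refl) (use dmono Kn in \<open>auto simp: l_def less_imp_le\<close>)
      then show ?thesis using ln[of x] by (simp add: b_def l_def)
    qed
    show False
    proof (cases "d n")
      case 0
      then have "h = (\<lambda>_. 0)" using hrep btop by auto
      then show False using hn fun_span_zero[OF Q] by auto
    next
      case (Suc e)
      have "h = poly_rep g b e"
      proof
        fix x show "h x = poly_rep g b e x" using hrep[of x] btop[of x] by (simp add: Suc poly_rep_def)
      qed
      then have "R h b e" using hI bP by (simp add: R_def)
      from dmin[OF this hn] show False by (simp add: Suc)
    qed
  qed
  then show ?thesis using Q by (simp add: noetherian_algebra_def)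
qed

lemma noetherian_finitely_generated:
  assumes "finite G"
  shows "noetherian_algebra (alg_gen G)"
  using assms
proof (induction G)
  case empty
  have "alg_gen {} = range (\<lambda>c (_::'a). c)"
  proof
    show "alg_gen {} \<subseteq> range (\<lambda>c (_::'a). c)" by (intro alg_gen_least fun_algebraI) auto
    show "range (\<lambda>c (_::'a). c) \<subseteq> alg_gen {}" by (auto intro: alg_gen.const)
  qed
  then show ?case using noetherian_constants by metis
next
  case (insert g G)
  have "alg_gen (insert g (alg_gen G)) = alg_gen (insert g G)"
  proof
    have "alg_gen G \<subseteq> alg_gen (insert g G)"
      by (intro alg_gen_least fun_algebra_alg_gen) (auto intro: alg_gen.gen)
    then show "alg_gen (insert g (alg_gen G)) \<subseteq> alg_gen (insert g G)"
      by (intro alg_gen_least fun_algebra_alg_gen) (auto intro: alg_gen.gen)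
    show "alg_gen (insert g G) \<subseteq> alg_gen (insert g (alg_gen G))"
      by (intro alg_gen_least fun_algebra_alg_gen) (auto intro: alg_gen.gen)
  qed
  then show ?case using noetherian_insert[OF insert.IH, of g] by simp
qed

text \<open>Quasi-compactness of a union of nonvanishing loci: where all of \<open>T\<close>
  vanishes, everything it generates vanishes too.\<close>

lemma noetherian_finite_subcover:
  assumes "noetherian_algebra P" "S \<subseteq> P"
  shows "\<exists>T. finite T \<and> T \<subseteq> S \<and> (\<forall>x. (\<exists>f\<in>S. f x \<noteq> 0) \<longrightarrow> (\<exists>f\<in>T. f x \<noteq> 0))"
proof -
  obtain T where T: "finite T" "T \<subseteq> S" "S \<subseteq> fun_span P T"
    using assms unfolding noetherian_algebra_def by blast
  have "\<exists>f\<in>T. f x \<noteq> 0" if "f \<in> S" "f x \<noteq> 0" for f x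
  proof (rule ccontr)
    assume *: "\<not> ?thesis"
    have "f \<in> fun_span P T" using T(3) that(1) by blast
    then obtain U c where U: "finite U" "U \<subseteq> T" "\<forall>h\<in>U. c h \<in> P" "f = (\<lambda>x. \<Sum>h\<in>U. c h x * h x)"
      unfolding fun_span_def by blast
    have "f x = 0" unfolding U(4) by (rule sum.neutral) (use U * in auto)
    then show False using that by simp
  qed
  then show ?thesis using T by blast
qed

section \<open>Monomials and leading exponents\<close>

definition monomial_fun :: "nat \<Rightarrow> (nat \<Rightarrow> nat) \<Rightarrow> (nat \<Rightarrow> complex) \<Rightarrow> complex" where
  "monomial_fun m e s = (\<Prod>i=1..m. s i ^ e i)"

text \<open>Each exponent is bounded separately, not the total degree: under products the bounds
  add, and the box has exactly \<open>(K + 1) ^ m\<close> elements, which suits the later dimension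
  count. Vanishing off \<open>{1..m}\<close> makes exponents determined by the entries that
  matter.\<close>

definition exponent_box :: "nat \<Rightarrow> nat \<Rightarrow> (nat \<Rightarrow> nat) set" where
  "exponent_box m K = {e. (\<forall>i\<in>{1..m}. e i \<le> K) \<and> (\<forall>i. i \<notin> {1..m} \<longrightarrow> e i = 0)}"

definition poly_box :: "nat \<Rightarrow> nat \<Rightarrow> ((nat \<Rightarrow> complex) \<Rightarrow> complex) set" where
  "poly_box m K = {p. \<exists>c. p = (\<lambda>s. \<Sum>e\<in>exponent_box m K. c e * monomial_fun m e s)}"

lemma exponent_box_card: "finite (exponent_box m K)" "card (exponent_box m K) \<le> (K + 1) ^ m"
proof -
  let ?F = "PiE {1..m} (\<lambda>_. {..K})"
  have "exponent_box m K \<subseteq> (\<lambda>f i. if i \<in> {1..m} then f i else 0) ` ?F"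
  proof
    fix e assume e: "e \<in> exponent_box m K"
    then have "e = (\<lambda>i. if i \<in> {1..m} then restrict e {1..m} i else 0)"
      by (auto simp: exponent_box_def)
    moreover have "restrict e {1..m} \<in> ?F" using e by (auto simp: exponent_box_def)
    ultimately show "e \<in> (\<lambda>f i. if i \<in> {1..m} then f i else 0) ` ?F" by blast
  qed
  moreover have "finite ?F" by (intro finite_PiE) auto
  moreover have "card ?F = (K + 1) ^ m" by (simp add: card_PiE)
  ultimately show "finite (exponent_box m K)" "card (exponent_box m K) \<le> (K + 1) ^ m"
    by (auto intro: finite_surj order_trans[OF surj_card_le])
qed

lemma monomial_in_box: "e \<in> exponent_box m K \<Longrightarrow> (\<lambda>s. c * monomial_fun m e s) \<in> poly_box m K"
proof -
  assume e: "e \<in> exponent_box m K"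
  have "(\<lambda>s. c * monomial_fun m e s) =
    (\<lambda>s. \<Sum>e'\<in>exponent_box m K. (if e' = e then c else 0) * monomial_fun m e' s)"
    using e exponent_box_card(1)[of m K] by (simp add: if_distrib[of "\<lambda>z. z * _"] cong: if_cong)
  then show ?thesis unfolding poly_box_def by (intro CollectI exI)
qed

lemma poly_box_add:
  assumes "p \<in> poly_box m K" "q \<in> poly_box m K"
  shows "(\<lambda>s. p s + q s) \<in> poly_box m K"
proof -
  obtain c where c: "p = (\<lambda>s. \<Sum>e\<in>exponent_box m K. c e * monomial_fun m e s)"
    using assms(1) unfolding poly_box_def by blast
  obtain d where d: "q = (\<lambda>s. \<Sum>e\<in>exponent_box m K. d e * monomial_fun m e s)"
    using assms(2) unfolding poly_box_def by blast
  have "(\<lambda>s. p s + q s) = (\<lambda>s. \<Sum>e\<in>exponent_box m K. (c e + d e) * monomial_fun m e s)"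
    by (simp add: c d sum.distrib distrib_right)
  then show ?thesis unfolding poly_box_def by (intro CollectI exI)
qed

lemma poly_box_zero: "(\<lambda>s. 0) \<in> poly_box m K"
  unfolding poly_box_def by (intro CollectI exI[of _ "\<lambda>_. 0"]) simp

lemma poly_box_sum: "(\<And>i. i \<in> I \<Longrightarrow> f i \<in> poly_box m K) \<Longrightarrow> (\<lambda>s. \<Sum>i\<in>I. f i s) \<in> poly_box m K"
  by (induction I rule: infinite_finite_induct) (auto intro: poly_box_zero poly_box_add)

lemma exponent_box_mono: "K \<le> L \<Longrightarrow> exponent_box m K \<subseteq> exponent_box m L"
  by (auto simp: exponent_box_def intro: order_trans)

lemma poly_box_mono: assumes "K \<le> L" "p \<in> poly_box m K" shows "p \<in> poly_box m L"
proof -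
  obtain c where c: "p = (\<lambda>s. \<Sum>e\<in>exponent_box m K. c e * monomial_fun m e s)"
    using assms(2) unfolding poly_box_def by blast
  show ?thesis unfolding c
    by (intro poly_box_sum monomial_in_box) (use exponent_box_mono[OF assms(1)] in auto)
qed

lemma poly_box_mult:
  assumes "p \<in> poly_box m K" "q \<in> poly_box m L"
  shows "(\<lambda>s. p s * q s) \<in> poly_box m (K + L)"
proof -
  obtain c where c: "p = (\<lambda>s. \<Sum>e\<in>exponent_box m K. c e * monomial_fun m e s)"
    using assms(1) unfolding poly_box_def by blast
  obtain d where d: "q = (\<lambda>s. \<Sum>e\<in>exponent_box m L. d e * monomial_fun m e s)"
    using assms(2) unfolding poly_box_def by blast
  have mm: "monomial_fun m e s * monomial_fun m e' s = monomial_fun m (\<lambda>i. e i + e' i) s" for e e' s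
    by (simp add: monomial_fun_def power_add prod.distrib)
  have "(\<lambda>s. p s * q s) = (\<lambda>s. \<Sum>e\<in>exponent_box m K. \<Sum>e'\<in>exponent_box m L.
       (c e * d e') * monomial_fun m (\<lambda>i. e i + e' i) s)"
    unfolding c d sum_product mm[symmetric] by (simp add: mult_ac)
  also have "\<dots> \<in> poly_box m (K + L)"
    by (intro poly_box_sum monomial_in_box) (auto simp: exponent_box_def add_mono)
  finally show ?thesis .
qed

lemma poly_box_const: "(\<lambda>s. c) \<in> poly_box m K"
  using monomial_in_box[of "\<lambda>_. 0" m K c] by (simp add: exponent_box_def monomial_fun_def)

lemma poly_box_prod:
  "finite I \<Longrightarrow> (\<And>i. i \<in> I \<Longrightarrow> f i \<in> poly_box m (K i)) \<Longrightarrow> (\<lambda>s. \<Prod>i\<in>I. f i s) \<in> poly_box m (\<Sum>i\<in>I. K i)"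
  by (induction I rule: finite_induct) (auto intro: poly_box_const poly_box_mult)

lemma poly_box_power: "f \<in> poly_box m K \<Longrightarrow> (\<lambda>s. f s ^ k) \<in> poly_box m (k * K)"
  by (induction k) (auto intro: poly_box_const poly_box_mult)

lemma poly_functions_box: "p \<in> poly_functions m \<Longrightarrow> \<exists>K. p \<in> poly_box m K"
proof (induction rule: poly_functions.induct)
  case (const c)
  show ?case using poly_box_const by blast
next
  case (coord i)
  have "(\<lambda>s. s i) = (\<lambda>s. 1 * monomial_fun m (\<lambda>j. if j = i then 1 else 0) s)"
  proof
    fix s :: "nat \<Rightarrow> complex"
    have "(\<Prod>j=1..m. s j ^ (if j = i then 1 else 0)) = (\<Prod>j=1..m. if j = i then s j else 1)"
      by (intro prod.cong) auto
    then show "s i = 1 * monomial_fun m (\<lambda>j. if j = i then 1 else 0) s"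
      using coord by (simp add: monomial_fun_def)
  qed
  moreover have "(\<lambda>j. if j = i then 1 else 0) \<in> exponent_box m 1" using coord by (auto simp: exponent_box_def)
  ultimately show ?case using monomial_in_box by metis
next
  case (add f g)
  then obtain K L where "f \<in> poly_box m K" "g \<in> poly_box m L" by blast
  then have "f \<in> poly_box m (max K L)" "g \<in> poly_box m (max K L)" using poly_box_mono by (meson max.cobounded1 max.cobounded2)+
  then show ?case using poly_box_add by blast
next
  case (mult f g)
  then show ?case using poly_box_mult by blast
qed

section \<open>Asymptotics of rational functions on spirals\<close>

text \<open>\<open>enumerate\<close> counts from 0, so the coordinates \<open>1, ..., m\<close>
  carry the primes 3, 5, 7 and so on; any distinct primes would do.\<close>

definition log_prime :: "nat \<Rightarrow> real" where
  "log_prime i = ln (real (enumerate {p. prime p} i))"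

definition weight :: "nat \<Rightarrow> (nat \<Rightarrow> int) \<Rightarrow> real" where
  "weight m v = (\<Sum>i=1..m. of_int (v i) * log_prime i)"

definition pairing :: "nat \<Rightarrow> (nat \<Rightarrow> int) \<Rightarrow> (nat \<Rightarrow> int) \<Rightarrow> int" where
  "pairing m u v = (\<Sum>i=1..m. u i * v i)"

definition spiral :: "(nat \<Rightarrow> int) \<Rightarrow> real \<Rightarrow> real \<Rightarrow> nat \<Rightarrow> complex" where
  "spiral u r t i = exp (- (of_real (r * log_prime i) + \<i> * of_real (t * of_int (u i))))"

text \<open>The value on the spiral of the Laurent monomial with exponent \<open>v\<close>. Its
  modulus is governed by \<open>weight m v\<close> and its phase by \<open>pairing m u v\<close>; it
  is constant in \<open>t\<close> exactly when the pairing vanishes.\<close>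

definition spiral_char :: "nat \<Rightarrow> (nat \<Rightarrow> int) \<Rightarrow> (nat \<Rightarrow> int) \<Rightarrow> real \<Rightarrow> real \<Rightarrow> complex" where
  "spiral_char m u v r t = exp (- (of_real (r * weight m v) + \<i> * of_real (t * of_int (pairing m u v))))"

text \<open>Limits along this filter are limits for large \<open>r\<close>, uniform in all real
  \<open>t\<close>.\<close>

definition strip :: "(real \<times> real) filter" where
  "strip = at_top \<times>\<^sub>F principal UNIV"

lemma eventually_strip: "eventually P strip \<longleftrightarrow> (\<exists>r0. \<forall>r\<ge>r0. \<forall>t. P (r, t))"
proof
  assume "eventually P strip"
  then obtain P1 P2 where "eventually P1 at_top" "eventually P2 (principal UNIV)" "\<And>x y. P1 x \<Longrightarrow> P2 y \<Longrightarrow> P (x, y)"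
    unfolding strip_def eventually_prod_filter by blast
  then show "\<exists>r0. \<forall>r\<ge>r0. \<forall>t. P (r, t)" unfolding eventually_at_top_linorder eventually_principal by blast
next
  assume "\<exists>r0. \<forall>r\<ge>r0. \<forall>t. P (r, t)"
  then obtain r0 where "\<And>r t. r \<ge> r0 \<Longrightarrow> P (r, t)" by blast
  then show "eventually P strip"
    unfolding strip_def eventually_prod_filter
    by (intro exI[of _ "\<lambda>r. r \<ge> r0"] exI[of _ "\<lambda>_. True"]) (auto simp: eventually_ge_at_top eventually_principal)
qed

lemma strip_nontrivial: "strip \<noteq> bot"
proof -
  have "\<not> eventually (\<lambda>_. False) strip" unfolding eventually_strip by auto
  then show ?thesis by (simp add: trivial_limit_def)
qed

lemma prime_enumerate: "prime (enumerate {p::nat. prime p} i)"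
  using enumerate_in_set[OF primes_infinite, of i] by simp

lemma inj_prime_enumerate: "inj (enumerate {p::nat. prime p})"
  by (rule strict_mono_imp_inj_on, rule strict_mono_enumerate, rule primes_infinite)

text \<open>Exponentiating a vanishing weight and moving negative exponents to the other side
  equates two products of prime powers; unique factorization forces the exponents to agree.\<close>

lemma weight_eq_0:
  assumes "weight m v = 0" "i \<in> {1..m}"
  shows "v i = 0"
proof -
  let ?p = "enumerate {p::nat. prime p}"
  have pos: "real (?p j) > 0" for j using prime_gt_0_nat[OF prime_enumerate] by simp
  have *: "real (\<Prod>j=1..m. ?p j ^ f j) = exp (\<Sum>j=1..m. real (f j) * log_prime j)" for f
    using pos by (simp add: exp_sum exp_of_nat_mult log_prime_def)
  have mult: "multiplicity (?p i) (\<Prod>j=1..m. ?p j ^ f j) = f i" for f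
  proof -
    have inj: "inj_on ?p {1..m}" using inj_prime_enumerate by (auto intro: inj_on_subset)
    have "(\<Prod>j=1..m. ?p j ^ f j) = (\<Prod>q\<in>?p ` {1..m}. q ^ f (inv_into UNIV ?p q))"
      by (subst prod.reindex[OF inj]) (simp add: inv_f_f[OF inj_prime_enumerate])
    also have "multiplicity (?p i) \<dots> = f (inv_into UNIV ?p (?p i))"
      using assms(2) by (subst multiplicity_prod_prime_powers) (auto simp: prime_enumerate)
    finally show ?thesis by (simp add: inv_f_f[OF inj_prime_enumerate])
  qed
  have "(\<Sum>j=1..m. real (nat (v j)) * log_prime j) - (\<Sum>j=1..m. real (nat (- v j)) * log_prime j) = weight m v"
    unfolding weight_def sum_subtractf[symmetric] left_diff_distrib[symmetric]
    by (intro sum.cong refl) (auto simp: of_nat_nat)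
  then have "real (\<Prod>j=1..m. ?p j ^ nat (v j)) = real (\<Prod>j=1..m. ?p j ^ nat (- v j))"
    unfolding * using assms(1) by simp
  then have "(\<Prod>j=1..m. ?p j ^ nat (v j)) = (\<Prod>j=1..m. ?p j ^ nat (- v j))" by linarith
  then have "nat (v i) = nat (- v i)" using mult by metis
  then show ?thesis by simp
qed

lemma spiral_char_add: "spiral_char m u (\<lambda>i. v i + w i) r t = spiral_char m u v r t * spiral_char m u w r t"
  by (simp add: spiral_char_def weight_def pairing_def sum.distrib distrib_left distrib_right exp_add[symmetric] algebra_simps)

lemma spiral_char_uminus: "spiral_char m u (\<lambda>i. - v i) r t = inverse (spiral_char m u v r t)"
  unfolding spiral_char_def exp_minus[symmetric]
  by (simp add: weight_def pairing_def sum_negf)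

lemma spiral_char_nz [simp]: "spiral_char m u v r t \<noteq> 0"
  by (simp add: spiral_char_def)

lemma monomial_spiral: "monomial_fun m e (spiral u r t) = spiral_char m u (\<lambda>i. int (e i)) r t"
proof -
  have "spiral u r t i ^ e i = exp (- (of_real (r * (real (e i) * log_prime i)) + \<i> * of_real (t * of_int (u i * int (e i)))))" for i
    unfolding spiral_def exp_of_nat_mult[symmetric] by (simp add: algebra_simps)
  then have "monomial_fun m e (spiral u r t) =
     exp (\<Sum>i=1..m. - (of_real (r * (real (e i) * log_prime i)) + \<i> * of_real (t * of_int (u i * int (e i)))))"
    by (simp add: monomial_fun_def exp_sum)
  also have "(\<Sum>i=1..m. - (of_real (r * (real (e i) * log_prime i)) + \<i> * of_real (t * of_int (u i * int (e i)))))
     = - (of_real (r * weight m (\<lambda>i. int (e i))) + \<i> * of_real (t * of_int (pairing m u (\<lambda>i. int (e i)))))"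
    unfolding weight_def pairing_def sum_negf sum.distrib sum_distrib_left of_real_sum of_int_sum
    by (simp add: sum_distrib_left)
  finally show ?thesis by (simp add: spiral_char_def)
qed

lemma spiral_char_tendsto_0:
  assumes "weight m v > 0"
  shows "((\<lambda>(r, t). spiral_char m u v r t) \<longlongrightarrow> 0) strip"
proof -
  have "filterlim (\<lambda>x. - (fst x * weight m v)) at_bot strip"
    unfolding filterlim_uminus_at_top[symmetric] strip_def
    by (rule filterlim_at_top_mult_tendsto_pos[OF tendsto_const assms filterlim_fst])
  then have "((\<lambda>x. exp (- (fst x * weight m v))) \<longlongrightarrow> 0) strip"
    by (rule filterlim_compose[OF exp_at_bot])
  moreover have "norm (spiral_char m u v (fst x) (snd x)) = exp (- (fst x * weight m v))" for x
    by (simp add: spiral_char_def norm_exp_eq_Re)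
  ultimately have "((\<lambda>x. norm (spiral_char m u v (fst x) (snd x))) \<longlongrightarrow> 0) strip" by simp
  then show ?thesis unfolding tendsto_norm_zero_iff by (simp add: split_beta')
qed

text \<open>The constant \<open>C\<close> and the exponent \<open>v\<close> are fixed before the
  direction \<open>u\<close>, so they belong to \<open>f\<close> and not to a particular spiral.
  Exponents are integers rather than naturals because fractions are included.\<close>

definition leading :: "nat \<Rightarrow> ((nat \<Rightarrow> complex) \<Rightarrow> complex) \<Rightarrow> (nat \<Rightarrow> int) \<Rightarrow> bool" where
  "leading m f v \<longleftrightarrow>
     (\<exists>C. C \<noteq> 0 \<and> (\<forall>u. ((\<lambda>(r, t). f (spiral u r t) / spiral_char m u v r t) \<longlongrightarrow> C) strip))"

lemma leading_mult:
  assumes "leading m f v" "leading m g w"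
  shows "leading m (\<lambda>s. f s * g s) (\<lambda>i. v i + w i)"
proof -
  obtain C where C: "C \<noteq> 0" "\<And>u. ((\<lambda>(r, t). f (spiral u r t) / spiral_char m u v r t) \<longlongrightarrow> C) strip"
    using assms(1) unfolding leading_def by blast
  obtain D where D: "D \<noteq> 0" "\<And>u. ((\<lambda>(r, t). g (spiral u r t) / spiral_char m u w r t) \<longlongrightarrow> D) strip"
    using assms(2) unfolding leading_def by blast
  show ?thesis unfolding leading_def
  proof (intro exI[of _ "C * D"] conjI allI)
    show "C * D \<noteq> 0" using C D by simp
    fix u
    show "((\<lambda>(r, t). f (spiral u r t) * g (spiral u r t) / spiral_char m u (\<lambda>i. v i + w i) r t) \<longlongrightarrow> C * D) strip"
      using tendsto_mult[OF C(2)[of u] D(2)[of u]] by (simp add: split_beta' spiral_char_add)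
  qed
qed

lemma leading_cong:
  assumes "leading m f v" "\<And>u. eventually (\<lambda>(r, t). f (spiral u r t) = g (spiral u r t)) strip"
  shows "leading m g v"
proof -
  obtain C where C: "C \<noteq> 0" "\<And>u. ((\<lambda>(r, t). f (spiral u r t) / spiral_char m u v r t) \<longlongrightarrow> C) strip"
    using assms(1) unfolding leading_def by blast
  have "((\<lambda>(r, t). g (spiral u r t) / spiral_char m u v r t) \<longlongrightarrow> C) strip" for u
    by (rule Lim_transform_eventually[OF C(2)[of u]]) (use assms(2)[of u] in \<open>eventually_elim, auto\<close>)
  then show ?thesis unfolding leading_def using C(1) by blast
qed

lemma leading_inverse:
  assumes "leading m f v"
  shows "leading m (\<lambda>s. inverse (f s)) (\<lambda>i. - v i)"
proof -
  obtain C where C: "C \<noteq> 0" "\<And>u. ((\<lambda>(r, t). f (spiral u r t) / spiral_char m u v r t) \<longlongrightarrow> C) strip"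
    using assms(1) unfolding leading_def by blast
  show ?thesis unfolding leading_def
  proof (intro exI[of _ "inverse C"] conjI allI)
    show "inverse C \<noteq> 0" using C by simp
    fix u
    show "((\<lambda>(r, t). inverse (f (spiral u r t)) / spiral_char m u (\<lambda>i. - v i) r t) \<longlongrightarrow> inverse C) strip"
      using tendsto_inverse[OF C(2)[of u] C(1)] by (simp add: split_beta' spiral_char_uminus field_simps)
  qed
qed

lemma leading_const: "c \<noteq> 0 \<Longrightarrow> leading m (\<lambda>_. c) (\<lambda>_. 0)"
  unfolding leading_def
  by (intro exI[of _ c]) (auto simp: spiral_char_def weight_def pairing_def split_beta')

lemma leading_power: "leading m f v \<Longrightarrow> leading m (\<lambda>s. f s ^ k) (\<lambda>i. int k * v i)"
proof (induction k)
  case 0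
  then show ?case using leading_const[of 1 m] by simp
next
  case (Suc k)
  then show ?case using leading_mult[OF Suc.prems Suc.IH[OF Suc.prems]] by (simp add: algebra_simps)
qed

lemma leading_prod:
  "finite I \<Longrightarrow> (\<And>j. j \<in> I \<Longrightarrow> leading m (f j) (v j)) \<Longrightarrow> leading m (\<lambda>s. \<Prod>j\<in>I. f j s) (\<lambda>i. \<Sum>j\<in>I. v j i)"
proof (induction I rule: finite_induct)
  case empty
  then show ?case using leading_const[of 1 m] by simp
next
  case (insert j I)
  then show ?case using leading_mult[of m "f j" "v j" "\<lambda>s. \<Prod>j\<in>I. f j s" "\<lambda>i. \<Sum>j\<in>I. v j i"] by simp
qed

lemma leading_nonzero: "leading m f v \<Longrightarrow> eventually (\<lambda>(r, t). f (spiral u r t) \<noteq> 0) strip"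
proof -
  assume "leading m f v"
  then obtain C where C: "C \<noteq> 0" "((\<lambda>(r, t). f (spiral u r t) / spiral_char m u v r t) \<longlongrightarrow> C) strip"
    unfolding leading_def by blast
  have "eventually (\<lambda>x. (case x of (r, t) \<Rightarrow> f (spiral u r t) / spiral_char m u v r t) \<noteq> 0) strip"
    by (rule tendsto_imp_eventually_ne[OF C(2,1)])
  then show ?thesis by eventually_elim auto
qed

text \<open>On spirals the term of least weight decays most slowly. As the weights are pairwise
  different it dominates all others and nothing can cancel it.\<close>

lemma leading_sum:
  assumes E: "finite E" "E \<noteq> {}"
    and f: "\<And>e. e \<in> E \<Longrightarrow> leading m (f e) (v e)"
    and d: "\<And>e e'. e \<in> E \<Longrightarrow> e' \<in> E \<Longrightarrow> weight m (v e) = weight m (v e') \<Longrightarrow> e = e'"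
  shows "\<exists>e\<in>E. leading m (\<lambda>s. \<Sum>e\<in>E. f e s) (v e)"
proof -
  obtain e0 where e0: "e0 \<in> E" "\<And>e. e \<in> E \<Longrightarrow> weight m (v e0) \<le> weight m (v e)"
    using arg_min_if_finite[OF E, of "\<lambda>e. weight m (v e)"] by (metis leI)
  have lt: "weight m (v e0) < weight m (v e)" if "e \<in> E - {e0}" for e
    using e0 d that by (metis DiffE insertI1 order_le_imp_less_or_eq)
  obtain C where C: "\<And>e. e \<in> E \<Longrightarrow> C e \<noteq> 0"
     "\<And>e u. e \<in> E \<Longrightarrow> ((\<lambda>(r, t). f e (spiral u r t) / spiral_char m u (v e) r t) \<longlongrightarrow> C e) strip"
    using f unfolding leading_def by metis
  have "leading m (\<lambda>s. \<Sum>e\<in>E. f e s) (v e0)"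
    unfolding leading_def
  proof (intro exI[of _ "C e0"] conjI allI)
    show "C e0 \<noteq> 0" using C e0 by auto
    fix u
    have "((\<lambda>(r, t). f e (spiral u r t) / spiral_char m u (v e0) r t) \<longlongrightarrow> 0) strip" if e: "e \<in> E - {e0}" for e
    proof -
      have "weight m (\<lambda>i. v e i + - v e0 i) = weight m (v e) - weight m (v e0)"
        unfolding weight_def sum_subtractf[symmetric] by (simp add: left_diff_distrib)
      then have "((\<lambda>(r, t). spiral_char m u (\<lambda>i. v e i + - v e0 i) r t) \<longlongrightarrow> 0) strip"
        using lt[OF e] by (intro spiral_char_tendsto_0) simp
      from tendsto_mult[OF C(2)[of e u] this] e
      have "((\<lambda>x. (case x of (r, t) \<Rightarrow> f e (spiral u r t) / spiral_char m u (v e) r t) *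
         (case x of (r, t) \<Rightarrow> spiral_char m u (\<lambda>i. v e i + - v e0 i) r t)) \<longlongrightarrow> 0) strip" by simp
      moreover have "(case x of (r, t) \<Rightarrow> f e (spiral u r t) / spiral_char m u (v e) r t) *
         (case x of (r, t) \<Rightarrow> spiral_char m u (\<lambda>i. v e i + - v e0 i) r t) =
         (case x of (r, t) \<Rightarrow> f e (spiral u r t) / spiral_char m u (v e0) r t)" for x
        unfolding spiral_char_add spiral_char_uminus by (cases x) (simp add: divide_inverse)
      ultimately show ?thesis by simp
    qed
    then have "((\<lambda>x. (case x of (r, t) \<Rightarrow> f e0 (spiral u r t) / spiral_char m u (v e0) r t) +
       (\<Sum>e\<in>E - {e0}. (case x of (r, t) \<Rightarrow> f e (spiral u r t) / spiral_char m u (v e0) r t))) \<longlongrightarrow> C e0 + (\<Sum>e\<in>E - {e0}. 0)) strip"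
      by (intro tendsto_add tendsto_sum C(2) e0)
    moreover have "(case x of (r, t) \<Rightarrow> f e0 (spiral u r t) / spiral_char m u (v e0) r t) +
       (\<Sum>e\<in>E - {e0}. (case x of (r, t) \<Rightarrow> f e (spiral u r t) / spiral_char m u (v e0) r t)) =
       (case x of (r, t) \<Rightarrow> (\<Sum>e\<in>E. f e (spiral u r t)) / spiral_char m u (v e0) r t)" for x
      using E(1) e0(1) by (cases x) (simp add: sum.remove[of E e0] sum_divide_distrib add_divide_distrib)
    ultimately show "((\<lambda>(r, t). (\<Sum>e\<in>E. f e (spiral u r t)) / spiral_char m u (v e0) r t) \<longlongrightarrow> C e0) strip"
      by simp
  qed
  then show ?thesis using e0(1) by blast
qed

lemma weight_inj_box:
  assumes "e \<in> exponent_box m K" "e' \<in> exponent_box m K"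
    "weight m (\<lambda>i. int (e i)) = weight m (\<lambda>i. int (e' i))"
  shows "e = e'"
proof
  fix i
  have "weight m (\<lambda>i. int (e i) - int (e' i)) = 0"
    using assms(3) unfolding weight_def by (simp add: left_diff_distrib sum_subtractf)
  from weight_eq_0[OF this, of i] show "e i = e' i"
    using assms(1,2) by (cases "i \<in> {1..m}") (auto simp: exponent_box_def)
qed

lemma leading_monomial: "leading m (monomial_fun m e) (\<lambda>i. int (e i))"
  unfolding leading_def by (intro exI[of _ 1]) (simp add: monomial_spiral split_beta')

lemma poly_leading:
  assumes "p \<in> poly_functions m" "p s \<noteq> 0"
  shows "\<exists>v. leading m p v"
proof -
  obtain K c where c: "p = (\<lambda>s. \<Sum>e\<in>exponent_box m K. c e * monomial_fun m e s)"
    using poly_functions_box[OF assms(1)] unfolding poly_box_def by blast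
  define E where "E = {e \<in> exponent_box m K. c e \<noteq> 0}"
  have fin: "finite E" using exponent_box_card(1) by (simp add: E_def)
  have p: "p = (\<lambda>s. \<Sum>e\<in>E. c e * monomial_fun m e s)"
    unfolding c E_def by (intro ext sum.mono_neutral_right exponent_box_card) auto
  have "E \<noteq> {}" using assms(2) unfolding p by auto
  moreover have "leading m (\<lambda>s. c e * monomial_fun m e s) (\<lambda>i. int (e i))" if "e \<in> E" for e
    using leading_mult[OF leading_const leading_monomial, of "c e" m e] that by (simp add: E_def)
  ultimately have "\<exists>e\<in>E. leading m (\<lambda>s. \<Sum>e\<in>E. c e * monomial_fun m e s) (\<lambda>i. int (e i))"
    using fin weight_inj_box by (intro leading_sum) (auto simp: E_def)
  then show ?thesis unfolding p by blast
qed

lemma poly_nonzero_eventually: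
  "p \<in> poly_functions m \<Longrightarrow> p s \<noteq> 0 \<Longrightarrow> eventually (\<lambda>(r, t). p (spiral u r t) \<noteq> 0) strip"
  using poly_leading leading_nonzero by metis

text \<open>Polynomial functions form a domain: on one and the same spiral both factors are
  eventually nonzero.\<close>

lemma poly_mult_nonzero:
  assumes "p \<in> poly_functions m" "p s \<noteq> 0" "q \<in> poly_functions m" "q s' \<noteq> 0"
  shows "\<exists>z. p z * q z \<noteq> 0"
proof -
  have "eventually (\<lambda>(r, t). p (spiral (\<lambda>_. 0) r t) \<noteq> 0 \<and> q (spiral (\<lambda>_. 0) r t) \<noteq> 0) strip"
    using poly_nonzero_eventually[OF assms(1,2)] poly_nonzero_eventually[OF assms(3,4)]
    by eventually_elim auto
  then obtain x where "case x of (r, t) \<Rightarrow> p (spiral (\<lambda>_. 0) r t) \<noteq> 0 \<and> q (spiral (\<lambda>_. 0) r t) \<noteq> 0"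
    using eventually_happens'[OF strip_nontrivial] by blast
  then show ?thesis by (auto split: prod.splits)
qed

section \<open>Rational functions of the parameters\<close>

definition rational_fun :: "nat \<Rightarrow> ((nat \<Rightarrow> complex) \<Rightarrow> complex) \<Rightarrow> bool" where
  "rational_fun m f \<longleftrightarrow> (\<exists>p\<in>poly_functions m. \<exists>q\<in>poly_functions m. (\<exists>s. q s \<noteq> 0) \<and>
      (\<forall>s. q s \<noteq> 0 \<longrightarrow> f s = p s / q s))"

lemma rational_funI:
  "p \<in> poly_functions m \<Longrightarrow> q \<in> poly_functions m \<Longrightarrow> q s \<noteq> 0 \<Longrightarrow> (\<And>s. q s \<noteq> 0 \<Longrightarrow> f s = p s / q s) \<Longrightarrow> rational_fun m f"
  unfolding rational_fun_def by blast

lemma rational_fun_poly: "p \<in> poly_functions m \<Longrightarrow> rational_fun m p"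
  by (rule rational_funI[of p m "\<lambda>_. 1"]) (auto intro: poly_functions.const)

lemma fun_algebra_rational: "fun_algebra {f. rational_fun m f}"
proof (rule fun_algebraI)
  show "(\<lambda>_. c) \<in> {f. rational_fun m f}" for c
    by (simp add: rational_fun_poly poly_functions.const)
next
  fix f g assume "f \<in> {f. rational_fun m f}" "g \<in> {f. rational_fun m f}"
  then obtain p q p' q' s s' where *: "p \<in> poly_functions m" "q \<in> poly_functions m" "q s \<noteq> 0"
    "\<And>s. q s \<noteq> 0 \<Longrightarrow> f s = p s / q s"
    "p' \<in> poly_functions m" "q' \<in> poly_functions m" "q' s' \<noteq> 0"
    "\<And>s. q' s \<noteq> 0 \<Longrightarrow> g s = p' s / q' s"
    unfolding rational_fun_def by blast
  obtain z where z: "q z * q' z \<noteq> 0" using poly_mult_nonzero[OF *(2,3) *(6,7)] by blast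
  have "rational_fun m (\<lambda>s. f s + g s)"
    by (rule rational_funI[of "\<lambda>s. p s * q' s + p' s * q s" m "\<lambda>s. q s * q' s", OF _ _ z])
       (use * in \<open>auto intro!: poly_functions.add poly_functions.mult simp: field_simps\<close>)
  moreover have "rational_fun m (\<lambda>s. f s * g s)"
    by (rule rational_funI[of "\<lambda>s. p s * p' s" m "\<lambda>s. q s * q' s", OF _ _ z])
       (use * in \<open>auto intro!: poly_functions.mult\<close>)
  ultimately show "(\<lambda>s. f s + g s) \<in> {f. rational_fun m f}" "(\<lambda>s. f s * g s) \<in> {f. rational_fun m f}" by auto
qed

text \<open>The exponent is the leading exponent of the numerator minus that of the denominator; the
  first alternative is the case of a zero numerator.\<close>

lemma rational_leading:
  assumes "rational_fun m f"
  shows "(\<exists>q\<in>poly_functions m. (\<exists>s. q s \<noteq> 0) \<and> (\<forall>s. q s \<noteq> 0 \<longrightarrow> f s = 0)) \<or> (\<exists>v. leading m f v)"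
proof -
  obtain p q s where *: "p \<in> poly_functions m" "q \<in> poly_functions m" "q s \<noteq> 0"
    "\<And>s. q s \<noteq> 0 \<Longrightarrow> f s = p s / q s"
    using assms unfolding rational_fun_def by blast
  show ?thesis
  proof (cases "\<exists>s. p s \<noteq> 0")
    case True
    then obtain v where v: "leading m p v" using poly_leading[OF *(1)] by blast
    obtain w where w: "leading m q w" using poly_leading[OF *(2,3)] by blast
    have "leading m f (\<lambda>i. v i + - w i)"
    proof (rule leading_cong[OF leading_mult[OF v leading_inverse[OF w]]])
      fix u
      show "eventually (\<lambda>(r, t). p (spiral u r t) * inverse (q (spiral u r t)) = f (spiral u r t)) strip"
        using leading_nonzero[OF w, of u] by eventually_elim (auto simp: *(4) field_simps)
    qed
    then show ?thesis by blast
  next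
    case False
    then show ?thesis using * by (intro disjI1 bexI[of _ q]) auto
  qed
qed

lemma rational_eventually:
  assumes "rational_fun m f"
  shows "eventually (\<lambda>(r, t). f (spiral u r t) = 0) strip \<or> (\<exists>v. leading m f v)"
proof -
  { fix q s assume q: "q \<in> poly_functions m" "q s \<noteq> 0" "\<forall>s. q s \<noteq> 0 \<longrightarrow> f s = 0"
    have "eventually (\<lambda>(r, t). f (spiral u r t) = 0) strip"
      using poly_nonzero_eventually[OF q(1,2), of u] by eventually_elim (use q(3) in auto) }
  then show ?thesis using rational_leading[OF assms] by blast
qed

lemma continuous_poly_spiral:
  "p \<in> poly_functions m \<Longrightarrow> continuous_on A (\<lambda>t. p (spiral u r t))"
  by (induction rule: poly_functions.induct) (auto simp: spiral_def intro!: continuous_intros)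

lemma rational_continuous:
  assumes "rational_fun m f"
  shows "\<exists>r0. \<forall>r\<ge>r0. continuous_on UNIV (\<lambda>t. f (spiral u r t))"
proof -
  obtain p q s where *: "p \<in> poly_functions m" "q \<in> poly_functions m" "q s \<noteq> 0"
    "\<And>s. q s \<noteq> 0 \<Longrightarrow> f s = p s / q s"
    using assms unfolding rational_fun_def by blast
  obtain r0 where r0: "\<And>r t. r \<ge> r0 \<Longrightarrow> q (spiral u r t) \<noteq> 0"
    using poly_nonzero_eventually[OF *(2,3), of u] unfolding eventually_strip by auto
  have "continuous_on UNIV (\<lambda>t. f (spiral u r t))" if "r \<ge> r0" for r
    using r0[OF that] *(4) continuous_poly_spiral[OF *(1)] continuous_poly_spiral[OF *(2)]
    by (simp add: continuous_on_divide)
  then show ?thesis by blast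
qed

section \<open>Roots of a continuous family of polynomials\<close>

text \<open>Interpolation at \<open>N + 1\<close> separated points, made quantitative: splitting off
  the linear factor of the last point leaves a quotient of lower degree that is small at the other
  points, since dividing by a difference of points costs at most a factor \<open>1 / d\<close>. The
  constant depends on \<open>N\<close> and \<open>d\<close> only.\<close>

lemma coeff_bound_interpolation:
  assumes "d > 0"
  shows "\<exists>K\<ge>0. \<forall>(p::complex poly) \<mu> \<eta>. degree p \<le> N \<longrightarrow> (\<forall>j\<le>N. norm (\<mu> j) \<le> 2) \<longrightarrow>
     (\<forall>i j. i < j \<longrightarrow> j \<le> N \<longrightarrow> norm (\<mu> i - \<mu> j) \<ge> d) \<longrightarrow> (\<forall>j\<le>N. norm (poly p (\<mu> j)) \<le> \<eta>) \<longrightarrow>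
     (\<forall>k. norm (Polynomial.coeff p k) \<le> K * \<eta>)"
proof (induction N)
  case 0
  have "norm (Polynomial.coeff p k) \<le> 1 * \<eta>"
    if "degree p \<le> 0" "\<forall>j\<le>0. norm (poly p (\<mu> j)) \<le> \<eta>" for p :: "complex poly" and \<mu> :: "nat \<Rightarrow> complex" and \<eta> k
  proof -
    obtain a where a: "p = [:a:]" using \<open>degree p \<le> 0\<close> degree_eq_zeroE by (metis le_zero_eq)
    have "norm a \<le> \<eta>" using that by (simp add: a)
    moreover from this have "0 \<le> \<eta>" using norm_ge_zero[of a] by linarith
    ultimately show ?thesis by (cases k) (simp_all add: a)
  qed
  then show ?case by (intro exI[of _ 1] conjI allI impI) (simp, blast)
next
  case (Suc N)
  then obtain K where K: "K \<ge> 0" and IH: "\<And>(p::complex poly) \<mu> \<eta> k. degree p \<le> N \<Longrightarrow> (\<forall>j\<le>N. norm (\<mu> j) \<le> 2) \<Longrightarrow>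
     (\<forall>i j. i < j \<longrightarrow> j \<le> N \<longrightarrow> norm (\<mu> i - \<mu> j) \<ge> d) \<Longrightarrow> (\<forall>j\<le>N. norm (poly p (\<mu> j)) \<le> \<eta>) \<Longrightarrow>
     norm (Polynomial.coeff p k) \<le> K * \<eta>" by blast
  \<comment> \<open>A coefficient of \<open>p\<close> is one coefficient of the quotient, minus
    \<open>c\<close> times another, plus possibly the remainder. As \<open>norm c \<le> 2\<close>,
    the quotient contributes three times \<open>K * (2 * \<eta> / d)\<close> and the remainder
    \<open>\<eta>\<close>.\<close>
  let ?K = "3 * K * 2 / d + 1"
  have "norm (Polynomial.coeff p k) \<le> ?K * \<eta>"
    if p: "degree p \<le> Suc N" and m2: "\<forall>j\<le>Suc N. norm (\<mu> j) \<le> 2"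
      and md: "\<forall>i j. i < j \<longrightarrow> j \<le> Suc N \<longrightarrow> norm (\<mu> i - \<mu> j) \<ge> d"
      and pe: "\<forall>j\<le>Suc N. norm (poly p (\<mu> j)) \<le> \<eta>" for p :: "complex poly" and \<mu> :: "nat \<Rightarrow> complex" and \<eta> k
  proof -
    define c where "c = \<mu> (Suc N)"
    define v where "v = synthetic_div p c"
    have pv: "p = [:- c, 1:] * v + [:poly p c:]" using synthetic_div_correct'[of c p] by (simp add: v_def)
    have dv: "degree v \<le> N" using p by (simp add: v_def degree_synthetic_div)
    have pc: "norm (poly p c) \<le> \<eta>" using pe by (simp add: c_def)
    then have e0: "\<eta> \<ge> 0" using norm_ge_zero[of "poly p c"] by linarith
    have "norm (poly v (\<mu> j)) \<le> 2 * \<eta> / d" if j: "j \<le> N" for j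
    proof -
      have "poly p (\<mu> j) = (\<mu> j - c) * poly v (\<mu> j) + poly p c"
        by (subst pv) (simp add: algebra_simps)
      then have "norm (\<mu> j - c) * norm (poly v (\<mu> j)) = norm (poly p (\<mu> j) - poly p c)"
        by (simp add: norm_mult[symmetric])
      also have "\<dots> \<le> 2 * \<eta>" using norm_triangle_ineq4[of "poly p (\<mu> j)" "poly p c"] pe[rule_format, of j] pc j
        by simp
      finally have "norm (\<mu> j - c) * norm (poly v (\<mu> j)) \<le> 2 * \<eta>" .
      moreover have "d * norm (poly v (\<mu> j)) \<le> norm (\<mu> j - c) * norm (poly v (\<mu> j))"
        using md j by (intro mult_right_mono) (auto simp: c_def)
      ultimately have "d * norm (poly v (\<mu> j)) \<le> 2 * \<eta>" by linarith
      then show ?thesis using assms by (simp add: field_simps)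
    qed
    then have vk: "norm (Polynomial.coeff v k) \<le> K * (2 * \<eta> / d)" for k
      using IH[OF dv, of \<mu> "2 * \<eta> / d" k] m2 md by simp
    have "Polynomial.coeff p k = (if k = 0 then 0 else Polynomial.coeff v (k - 1)) - c * Polynomial.coeff v k + (if k = 0 then poly p c else 0)"
    proof -
      have "Polynomial.coeff p k = Polynomial.coeff ([:- c, 1:] * v + [:poly p c:]) k" using pv by simp
      then show ?thesis by (cases k) simp_all
    qed
    moreover have "norm (a - c * b + z) \<le> norm a + norm c * norm b + norm z" for a b z
      using norm_triangle_ineq[of "a - c * b" z] norm_triangle_ineq4[of a "c * b"] by (simp add: norm_mult)
    ultimately have "norm (Polynomial.coeff p k) \<le> norm (if k = 0 then 0 else Polynomial.coeff v (k - 1)) + norm c * norm (Polynomial.coeff v k)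
        + norm (if k = 0 then poly p c else 0)"
      by (simp only:)
    also have "\<dots> \<le> K * (2 * \<eta> / d) + 2 * (K * (2 * \<eta> / d)) + \<eta>"
    proof (intro add_mono mult_mono)
      have "0 \<le> K * (2 * \<eta> / d)" using K e0 assms by simp
      then show "norm (if k = 0 then 0 else Polynomial.coeff v (k - 1)) \<le> K * (2 * \<eta> / d)" using vk by simp
    qed (use vk m2 pc e0 in \<open>auto simp: c_def\<close>)
    also have "\<dots> = ?K * \<eta>" by (simp add: field_simps)
    finally show ?thesis .
  qed
  moreover have "?K \<ge> 0" using K assms by simp
  ultimately show ?case by (intro exI[of _ ?K] conjI allI impI)
qed

text \<open>When the coefficients below \<open>k0\<close> vanish, a nonzero root satisfies the
  equation divided by \<open>g ^ k0\<close>. A small root would force the coefficient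
  \<open>c k0\<close> to be small, but that one is bounded below on the compact interval.\<close>

lemma nonzero_roots_separated:
  fixes c :: "nat \<Rightarrow> real \<Rightarrow> complex"
  assumes k0: "k0 \<le> N" and z: "\<And>k t. k < k0 \<Longrightarrow> t \<in> {0..L} \<Longrightarrow> c k t = 0"
    and nz: "\<And>t. t \<in> {0..L} \<Longrightarrow> c k0 t \<noteq> 0"
    and cont: "\<And>k. k \<le> N \<Longrightarrow> continuous_on {0..L} (c k)" and L: "L \<ge> 0"
  shows "\<exists>d>0. \<forall>t\<in>{0..L}. \<forall>g. (\<Sum>k\<le>N. c k t * g ^ k) = 0 \<longrightarrow> g \<noteq> 0 \<longrightarrow> norm g \<ge> d"
proof -
  have "\<exists>t0\<in>{0..L}. \<forall>t\<in>{0..L}. norm (c k0 t0) \<le> norm (c k0 t)"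
    using L by (intro continuous_attains_inf continuous_on_norm cont k0) auto
  then obtain t0 where t0: "t0 \<in> {0..L}" "\<And>t. t \<in> {0..L} \<Longrightarrow> norm (c k0 t0) \<le> norm (c k0 t)" by blast
  have "\<exists>M. \<forall>t\<in>{0..L}. norm (c k t) \<le> M" if "k \<le> N" for k
    using compact_imp_bounded[OF compact_continuous_image[OF cont[OF that]]] by (auto simp: bounded_iff)
  then obtain M where M: "\<And>k t. k \<le> N \<Longrightarrow> t \<in> {0..L} \<Longrightarrow> norm (c k t) \<le> M k" by metis
  define S where "S = (\<Sum>k\<le>N. M k)"
  have M0: "M k \<ge> 0" if "k \<le> N" for k using M[OF that t0(1)] norm_ge_zero order_trans by blast
  have S0: "S \<ge> 0" unfolding S_def by (intro sum_nonneg) (use M0 in auto)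
  define a where "a = norm (c k0 t0)"
  have a: "a > 0" using nz t0(1) by (simp add: a_def)
  \<comment> \<open>If \<open>norm g < 1\<close>, the reduced equation bounds the coefficient
    \<open>c k0\<close> by \<open>S * norm g\<close>; the added 1 keeps the denominator
    positive.\<close>
  have "norm g \<ge> min 1 (a / (S + 1))"
    if t: "t \<in> {0..L}" and e: "(\<Sum>k\<le>N. c k t * g ^ k) = 0" and g: "g \<noteq> 0" for t g
  proof (cases "norm g \<ge> 1")
    case False
    have "(\<Sum>k\<le>N. c k t * g ^ k) = (\<Sum>k\<in>{k0..N}. c k t * g ^ k)"
      using z[OF _ t] by (intro sum.mono_neutral_right) auto
    also have "\<dots> = (\<Sum>k\<in>{k0..N}. g ^ k0 * (c k t * g ^ (k - k0)))"
      by (intro sum.cong refl) (auto simp: mult_ac power_add[symmetric])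
    also have "\<dots> = g ^ k0 * (\<Sum>k\<in>{k0..N}. c k t * g ^ (k - k0))" by (simp add: sum_distrib_left)
    finally have "(\<Sum>k\<in>{k0..N}. c k t * g ^ (k - k0)) = 0" using e g by simp
    then have "c k0 t + (\<Sum>k\<in>{Suc k0..N}. c k t * g ^ (k - k0)) = 0"
      using k0 by (simp add: sum.atLeast_Suc_atMost)
    then have "norm (c k0 t) = norm (\<Sum>k\<in>{Suc k0..N}. c k t * g ^ (k - k0))"
      by (metis add_eq_0_iff norm_minus_cancel)
    also have "\<dots> \<le> (\<Sum>k\<in>{Suc k0..N}. M k * norm g)"
    proof (rule sum_norm_le)
      fix k assume k: "k \<in> {Suc k0..N}"
      then have "norm g ^ (k - k0) \<le> norm g ^ 1" using False by (intro power_decreasing) auto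
      then show "norm (c k t * g ^ (k - k0)) \<le> M k * norm g"
        unfolding norm_mult norm_power using M[of k t] M0[of k] k t by (intro mult_mono) auto
    qed
    also have "\<dots> \<le> S * norm g" unfolding S_def sum_distrib_right[symmetric]
      by (intro mult_right_mono sum_mono2) (use M0 in auto)
    finally have "a \<le> S * norm g" using t0(2)[OF t] by (simp add: a_def)
    then have "a \<le> (S + 1) * norm g" by (simp add: distrib_right add_increasing2)
    then have "a / (S + 1) \<le> norm g" using S0 by (simp add: field_simps)
    then show ?thesis by simp
  qed auto
  moreover have "min 1 (a / (S + 1)) > 0" using a S0 by simp
  ultimately show ?thesis by blast
qed

text \<open>The continuous function \<open>norm (g t)\<close> omits the open gap between 0 and
  \<open>d\<close>, in particular the value \<open>d / 2\<close>.\<close>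

lemma zero_dichotomy:
  fixes g :: "real \<Rightarrow> complex"
  assumes "continuous_on {0..L} g" "d > 0" "\<And>t. t \<in> {0..L} \<Longrightarrow> g t = 0 \<or> norm (g t) \<ge> d"
    "t0 \<in> {0..L}" "g t0 = 0" "t \<in> {0..L}"
  shows "g t = 0"
proof (rule ccontr)
  assume "g t \<noteq> 0"
  then have d: "norm (g t) \<ge> d" using assms(3,6) by blast
  have "connected ((\<lambda>t. norm (g t)) ` {0..L})"
    by (intro connected_continuous_image continuous_on_norm assms) simp
  moreover have "norm (g t0) \<in> (\<lambda>t. norm (g t)) ` {0..L}" "norm (g t) \<in> (\<lambda>t. norm (g t)) ` {0..L}"
    using assms by auto
  ultimately have "d / 2 \<in> (\<lambda>t. norm (g t)) ` {0..L}"
    by (rule connectedD_interval) (use assms(2,5) d in auto)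
  then obtain t' where "t' \<in> {0..L}" "norm (g t') = d / 2" by auto
  then show False using assms(2) assms(3)[of t'] by auto
qed

section \<open>Continuity and continuation of roots\<close>

lemma monic_val_poly:
  "\<exists>P::complex poly. degree P = D \<and> lead_coeff P = 1 \<and> (\<forall>y. poly P y = monic_val D p x y)"
proof -
  define Q where "Q = (\<Sum>k<D. Polynomial.monom (p k x) k)"
  have Q: "Polynomial.coeff Q k = (if k < D then p k x else 0)" for k
    by (simp add: Q_def coeff_sum)
  define P where "P = Polynomial.monom 1 D + Q"
  have cP: "Polynomial.coeff P k = (if k = D then 1 else 0) + (if k < D then p k x else 0)" for k
    by (simp add: P_def Q)
  have "degree P \<le> D" by (rule degree_le) (simp add: cP)
  moreover have "degree P \<ge> D" by (rule le_degree) (simp add: cP)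
  ultimately have "degree P = D" by simp
  moreover have "poly P y = monic_val D p x y" for y
    by (simp add: P_def Q_def poly_sum poly_monom monic_val_def)
  ultimately show ?thesis using cP by (intro exI[of _ P]) auto
qed

text \<open>The modulus of a monic polynomial is the product of the distances to its
  \<open>D\<close> roots; if all were at least \<open>e\<close>, it would be at least
  \<open>e ^ D\<close>.\<close>

lemma monic_val_root_near:
  assumes D: "D \<ge> 1" and e: "e > 0" and s: "norm (monic_val D p x y) < e ^ D"
  shows "\<exists>y'. monic_val D p x y' = 0 \<and> norm (y' - y) < e"
proof -
  obtain P :: "complex poly" where P: "degree P = D" "lead_coeff P = 1" "\<And>y. poly P y = monic_val D p x y"
    using monic_val_poly[of D p x] by blast
  obtain as where as: "Polynomial.smult (lead_coeff P) (\<Prod>a\<leftarrow>as. [:- a, 1:]) = P" "length as = degree P"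
    using fundamental_theorem_algebra_factorized by blast
  have Py: "poly P z = (\<Prod>a\<leftarrow>as. z - a)" for z
  proof -
    have "poly (\<Prod>a\<leftarrow>as. [:- a, 1:]) z = (\<Prod>a\<leftarrow>as. z - a)" by (induction as) (auto simp: algebra_simps)
    then show ?thesis using as(1) P(2) by simp
  qed
  have "\<exists>a\<in>set as. norm (a - y) < e"
  proof (rule ccontr)
    assume "\<not> ?thesis"
    then have far: "\<And>a. a \<in> set as \<Longrightarrow> norm (y - a) \<ge> e" by (auto simp: norm_minus_commute not_less)
    have "norm (\<Prod>a\<leftarrow>bs. y - a) \<ge> e ^ length bs" if "set bs \<subseteq> set as" for bs
      using that
    proof (induction bs)
      case (Cons b bs)
      then have "e * e ^ length bs \<le> norm (y - b) * norm (\<Prod>a\<leftarrow>bs. y - a)"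
        using e far by (intro mult_mono) auto
      then show ?case by (simp add: norm_mult)
    qed simp
    from this[of as] show False using s P as Py by auto
  qed
  then obtain a where a: "a \<in> set as" "norm (a - y) < e" by blast
  have "poly P a = 0" unfolding Py using a(1) by (auto simp: prod_list_zero_iff)
  then show ?thesis using a(2) P(3) by auto
qed

text \<open>Cauchy's bound: for \<open>norm y > 1\<close> every lower power is dominated by
  \<open>norm y ^ (D - 1)\<close>, by which the equation is then divided.\<close>

lemma monic_val_root_bound:
  assumes "monic_val D p x y = 0" "\<And>k. k < D \<Longrightarrow> norm (p k x) \<le> M k"
  shows "norm y \<le> 1 + (\<Sum>k<D. M k)"
proof (cases "norm y \<le> 1")
  case True
  have "0 \<le> M k" if "k < D" for k using assms(2)[OF that] norm_ge_zero order_trans by blast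
  then have "0 \<le> (\<Sum>k<D. M k)" by (intro sum_nonneg) auto
  then show ?thesis using True by simp
next
  case False
  then have y1: "norm y > 1" by simp
  have D: "D \<noteq> 0" using assms(1) by (auto simp: monic_val_def intro!: gr0I)
  then obtain D' where D': "D = Suc D'" by (cases D) auto
  have "y ^ D = - (\<Sum>k<D. p k x * y ^ k)" using assms(1) by (simp add: monic_val_def eq_neg_iff_add_eq_0)
  then have "norm y ^ D = norm (\<Sum>k<D. p k x * y ^ k)" by (metis norm_minus_cancel norm_power)
  also have "\<dots> \<le> (\<Sum>k<D. M k * norm y ^ D')"
  proof (rule sum_norm_le)
    fix k assume k: "k \<in> {..<D}"
    then have "norm y ^ k \<le> norm y ^ D'" using y1 by (intro power_increasing) (auto simp: D')
    moreover have "0 \<le> M k" using assms(2)[of k] k norm_ge_zero[of "p k x"] by (simp add: order_trans[of 0 "norm (p k x)"])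
    ultimately show "norm (p k x * y ^ k) \<le> M k * norm y ^ D'"
      unfolding norm_mult norm_power using assms(2)[of k] k by (intro mult_mono) auto
  qed
  also have "\<dots> = (\<Sum>k<D. M k) * norm y ^ D'" by (simp add: sum_distrib_right)
  finally have "norm y * norm y ^ D' \<le> (\<Sum>k<D. M k) * norm y ^ D'" by (simp add: D')
  moreover have "norm y ^ D' > 0" using y1 by (intro zero_less_power) linarith
  ultimately have "norm y \<le> (\<Sum>k<D. M k)" by (rule mult_right_le_imp_le)
  then show ?thesis by simp
qed

text \<open>All roots lie in one disc of radius \<open>B\<close>, so a root at \<open>t\<close>
  nearly satisfies the equation at a close \<open>t'\<close>, and some root there is near it. No
  root is singled out yet.\<close>

lemma monic_roots_uniformly_continuous:
  fixes p :: "nat \<Rightarrow> real \<Rightarrow> complex"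
  assumes D: "D \<ge> 1" and cont: "\<forall>k<D. continuous_on {0..L} (p k)" and e: "e > 0"
  shows "\<exists>h>0. \<forall>t\<in>{0..L}. \<forall>t'\<in>{0..L}. \<bar>t' - t\<bar> < h \<longrightarrow>
     (\<forall>y. monic_val D p t y = 0 \<longrightarrow> (\<exists>y'. monic_val D p t' y' = 0 \<and> norm (y' - y) < e))"
proof -
  have "\<exists>M. \<forall>t\<in>{0..L}. norm (p k t) \<le> M" if "k < D" for k
    using compact_imp_bounded[OF compact_continuous_image[OF cont[rule_format, OF that]]] by (auto simp: bounded_iff)
  then obtain M where M: "\<And>k t. k < D \<Longrightarrow> t \<in> {0..L} \<Longrightarrow> norm (p k t) \<le> M k" by metis
  define B where "B = 1 + \<bar>\<Sum>k<D. M k\<bar>"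
  have B1: "B \<ge> 1" by (simp add: B_def)
  \<comment> \<open>With this choice the change of the polynomial on the disc, at most
    \<open>\<epsilon> * (real D * B ^ D)\<close>, stays below \<open>e ^ D\<close>.\<close>
  define \<epsilon> where "\<epsilon> = e ^ D / (real D * B ^ D + 1)"
  have den: "real D * B ^ D + 1 > 0" using B1 by (simp add: add_nonneg_pos)
  have \<epsilon>: "\<epsilon> > 0" using e den by (simp add: \<epsilon>_def)
  have "\<exists>h>0. \<forall>t\<in>{0..L}. \<forall>t'\<in>{0..L}. \<bar>t' - t\<bar> < h \<longrightarrow> norm (p k t' - p k t) < \<epsilon>" if "k < D" for k
    using compact_uniformly_continuous[OF cont[rule_format, OF that]] \<epsilon>
    unfolding uniformly_continuous_on_def by (auto simp: dist_real_def dist_norm)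
  then obtain h where h: "\<And>k. k < D \<Longrightarrow> h k > 0"
    "\<And>k t t'. k < D \<Longrightarrow> t \<in> {0..L} \<Longrightarrow> t' \<in> {0..L} \<Longrightarrow> \<bar>t' - t\<bar> < h k \<Longrightarrow> norm (p k t' - p k t) < \<epsilon>" by metis
  define H where "H = Min (h ` {..<D})"
  have Hpos: "H > 0" unfolding H_def using D h(1) by (subst Min_gr_iff) (auto simp: lessThan_empty_iff)
  have H: "H \<le> h k" if "k < D" for k unfolding H_def using that by (intro Min_le) auto
  have "\<exists>y'. monic_val D p t' y' = 0 \<and> norm (y' - y) < e"
    if t: "t \<in> {0..L}" "t' \<in> {0..L}" "\<bar>t' - t\<bar> < H" and y: "monic_val D p t y = 0" for t t' y
  proof (rule monic_val_root_near[OF D e])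
    have yB: "norm y \<le> B" using monic_val_root_bound[OF y, of M] M t by (fastforce simp: B_def)
    have "monic_val D p t' y = monic_val D p t' y - monic_val D p t y" using y by simp
    also have "\<dots> = (\<Sum>k<D. (p k t' - p k t) * y ^ k)"
      by (simp add: monic_val_def left_diff_distrib sum_subtractf)
    finally have "norm (monic_val D p t' y) = norm (\<Sum>k<D. (p k t' - p k t) * y ^ k)" by simp
    also have "\<dots> \<le> (\<Sum>k<D. \<epsilon> * B ^ D)"
    proof (rule sum_norm_le)
      fix k assume k: "k \<in> {..<D}"
      have "norm y ^ k \<le> B ^ k" using yB by (intro power_mono) auto
      also have "\<dots> \<le> B ^ D" using B1 k by (intro power_increasing) auto
      finally have "norm y ^ k \<le> B ^ D" .
      moreover have "norm (p k t' - p k t) \<le> \<epsilon>" using h(2)[of k t t'] H[of k] t k by force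
      ultimately show "norm ((p k t' - p k t) * y ^ k) \<le> \<epsilon> * B ^ D"
        unfolding norm_mult norm_power using \<epsilon> by (intro mult_mono) auto
    qed
    also have "\<dots> = \<epsilon> * (real D * B ^ D)" by simp
    also have "\<dots> < \<epsilon> * (real D * B ^ D + 1)" using \<epsilon> by simp
    also have "\<dots> = e ^ D" using den by (simp add: \<epsilon>_def)
    finally show "norm (monic_val D p t' y) < e ^ D" .
  qed
  then show ?thesis using Hpos by blast
qed

text \<open>Distinct roots over the same \<open>t\<close> are at distance at least \<open>d\<close>,
  so over a step shorter than \<open>h\<close> exactly one root lies within \<open>d / 4\<close> of
  the starting root, and this selection is continuous. Multiple roots are allowed, as only distinct
  numbers are compared.\<close>

lemma monic_root_lift:
  fixes p :: "nat \<Rightarrow> real \<Rightarrow> complex"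
  assumes D: "D \<ge> 1" and cont: "\<forall>k<D. continuous_on {0..L} (p k)" and L: "L > 0" and d: "d > 0"
    and sep: "\<And>t y y'. t \<in> {0..L} \<Longrightarrow> monic_val D p t y = 0 \<Longrightarrow> monic_val D p t y' = 0 \<Longrightarrow> norm (y - y') < d \<Longrightarrow> y = y'"
    and y0: "monic_val D p 0 y0 = 0"
  shows "\<exists>Y. continuous_on {0..L} Y \<and> Y 0 = y0 \<and> (\<forall>t\<in>{0..L}. monic_val D p t (Y t) = 0)"
proof -
  have "d / 4 > 0" using d by simp
  from monic_roots_uniformly_continuous[of D L p "d / 4", OF D cont this]
  obtain h where h0: "h > 0" and h1: "\<forall>t\<in>{0..L}. \<forall>t'\<in>{0..L}. \<bar>t' - t\<bar> < h \<longrightarrow>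
     (\<forall>y. monic_val D p t y = 0 \<longrightarrow> (\<exists>y'. monic_val D p t' y' = 0 \<and> norm (y' - y) < d / 4))"
    by (elim exE conjE)
  note h = h0 h1[rule_format]
  obtain M :: nat where M: "L / h < real M" using reals_Archimedean2[of "L / h"] by (elim exE)
  have "0 < L / h" by (rule divide_pos_pos[OF L h0])
  then have "0 < real M" using M by linarith
  then have Mpos: "M > 0" by simp
  define \<tau> where "\<tau> = L / real M"
  have \<tau>: "\<tau> > 0" "\<tau> < h" using M L h(1) Mpos by (auto simp: \<tau>_def field_simps)
  have \<tau>L: "real j * \<tau> \<le> L" if "j \<le> M" for j
    using that L Mpos by (simp add: \<tau>_def field_simps)
  have "\<exists>Y. continuous_on {0..real j * \<tau>} Y \<and> Y 0 = y0 \<and> (\<forall>t\<in>{0..real j * \<tau>}. monic_val D p t (Y t) = 0)" if "j \<le> M" for j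
    using that
  proof (induction j)
    case 0
    show ?case using y0 by (intro exI[of _ "\<lambda>_. y0"]) auto
  next
    case (Suc j)
    define a where "a = real j * \<tau>"
    define b where "b = real (Suc j) * \<tau>"
    have ab: "b = a + \<tau>" "0 \<le> a" "b \<le> L" "a \<le> b" using \<tau> \<tau>L[OF Suc.prems] by (auto simp: a_def b_def algebra_simps)
    obtain Y where Y: "continuous_on {0..a} Y" "Y 0 = y0" "\<And>t. t \<in> {0..a} \<Longrightarrow> monic_val D p t (Y t) = 0"
      using Suc a_def by auto
    have Ya: "monic_val D p a (Y a) = 0" using Y(3) ab by simp
    have "\<exists>y'. monic_val D p t y' = 0 \<and> norm (y' - Y a) < d / 4" if "t \<in> {a..b}" for t
      using h(2)[of a t "Y a"] that ab \<tau> Ya by simp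
    then obtain Z where Z: "\<And>t. t \<in> {a..b} \<Longrightarrow> monic_val D p t (Z t) = 0" "\<And>t. t \<in> {a..b} \<Longrightarrow> norm (Z t - Y a) < d / 4"
      by metis
    have Za: "Z a = Y a" using sep[of a "Z a" "Y a"] Z[of a] Ya ab d by force
    have "continuous_on {a..b} Z"
      unfolding continuous_on_iff
    proof (intro ballI allI impI)
      fix t and e :: real assume t: "t \<in> {a..b}" and e: "e > 0"
      have "min e (d / 4) > 0" using e d by simp
      from monic_roots_uniformly_continuous[of D L p "min e (d / 4)", OF D cont this]
      obtain h' where h'0: "h' > 0" and h'1: "\<forall>t\<in>{0..L}. \<forall>t'\<in>{0..L}. \<bar>t' - t\<bar> < h' \<longrightarrow>
         (\<forall>y. monic_val D p t y = 0 \<longrightarrow> (\<exists>y'. monic_val D p t' y' = 0 \<and> norm (y' - y) < min e (d / 4)))"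
        by (elim exE conjE)
      note h' = h'0 h'1[rule_format]
      have "dist (Z t') (Z t) < e" if t': "t' \<in> {a..b}" "dist t' t < h'" for t'
      proof -
        obtain z where z: "monic_val D p t' z = 0" "norm (z - Z t) < min e (d / 4)"
          using h'(2)[of t t' "Z t"] t t' Z(1)[OF t] ab by (auto simp: dist_real_def)
        \<comment> \<open>Three errors below \<open>d / 4\<close>, one from the continuity of the
          root set and two from the selection \<open>Z\<close>, add up to less than
          \<open>d\<close>; so the nearby root is the selected one.\<close>
        have "norm (z - Z t') \<le> norm (z - Z t) + norm (Z t - Y a) + norm (Z t' - Y a)"
          using norm_triangle_ineq[of "z - Z t" "Z t - Y a"] norm_triangle_ineq4[of "(z - Z t) + (Z t - Y a)" "Z t' - Y a"]
          by simp
        also have "\<dots> < d" using z(2) Z(2)[OF t] Z(2)[OF t'(1)] d by simp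
        finally have "z = Z t'" using sep[of t' z "Z t'"] z(1) Z(1)[OF t'(1)] t' ab by auto
        then show ?thesis using z(2) by (simp add: dist_norm)
      qed
      then show "\<exists>h>0. \<forall>t'\<in>{a..b}. dist t' t < h \<longrightarrow> dist (Z t') (Z t) < e" using h'(1) by blast
    qed
    then have "continuous_on ({0..a} \<union> {a..b}) (\<lambda>t. if t \<le> a then Y t else Z t)"
      using Y(1) Za by (intro continuous_on_cases) auto
    moreover have "{0..a} \<union> {a..b} = {0..b}" using ab by auto
    ultimately show ?case
      using Y Z ab unfolding b_def[symmetric]
      by (intro exI[of _ "\<lambda>t. if t \<le> a then Y t else Z t"]) auto
  qed
  from this[of M] show ?thesis using Mpos by (simp add: \<tau>_def)
qed

text \<open>
  If the coefficients are nearly constant in \<open>t\<close>, in the relative sense, then so is a nonvanishing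
  continuous root \<open>g\<close>: otherwise \<open>g t / g 0\<close> would take \<open>N + 1\<close> well separated values, all of which
  nearly annihilate the same normalised polynomial of degree \<open>N\<close>.
\<close>
lemma nearly_constant_root:
  "\<exists>\<epsilon>>0. \<forall>c w g L. L \<ge> 0 \<longrightarrow> continuous_on {0..L} g \<longrightarrow> (\<forall>t\<in>{0..L}. g t \<noteq> 0) \<longrightarrow>
     (\<forall>t\<in>{0..L}. \<forall>k\<le>N. norm (c k t - w k) \<le> \<epsilon> * norm (w k)) \<longrightarrow> w N \<noteq> 0 \<longrightarrow>
     (\<forall>t\<in>{0..L}. (\<Sum>k\<le>N. c k t * g t ^ k) = 0) \<longrightarrow>
     (\<forall>t\<in>{0..L}. norm (g t / g (0::real) - (1::complex)) < 1)"
proof -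
  \<comment> \<open>The radii \<open>j * d\<close> with \<open>j \<le> N\<close> stay below 1, so if
    \<open>g t / g 0\<close> reaches distance 1 from its initial value 1, its distance passes
    through all of them.\<close>
  define d where "d = 1 / (real N + 1)"
  have d: "d > 0" by (simp add: d_def)
  obtain K where K: "K \<ge> 0" and KB: "\<And>(p::complex poly) \<mu> \<eta> k. degree p \<le> N \<Longrightarrow> (\<forall>j\<le>N. norm (\<mu> j) \<le> 2) \<Longrightarrow>
     (\<forall>i j. i < j \<longrightarrow> j \<le> N \<longrightarrow> norm (\<mu> i - \<mu> j) \<ge> d) \<Longrightarrow> (\<forall>j\<le>N. norm (poly p (\<mu> j)) \<le> \<eta>) \<Longrightarrow>
     norm (Polynomial.coeff p k) \<le> K * \<eta>"
    using coeff_bound_interpolation[OF d, of N] by blast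
  \<comment> \<open>Makes \<open>\<epsilon> * (K * (real (Suc N) * 2 ^ N)) < 1\<close>, so that the
    interpolation bound contradicts the size of the largest coefficient.\<close>
  define \<epsilon> where "\<epsilon> = 1 / (K * (real (Suc N) * 2 ^ N) + 1)"
  have den: "K * (real (Suc N) * 2 ^ N) + 1 > 0" using K by (simp add: add_nonneg_pos)
  have \<epsilon>: "\<epsilon> > 0" using den by (simp add: \<epsilon>_def)
  have "norm (g t / g 0 - 1) < 1"
    if L: "L \<ge> 0" and g: "continuous_on {0..L} g" "\<forall>t\<in>{0..L}. g t \<noteq> 0"
      and cw: "\<forall>t\<in>{0..L}. \<forall>k\<le>N. norm (c k t - w k) \<le> \<epsilon> * norm (w k)" and w: "w N \<noteq> 0"
      and root: "\<forall>t\<in>{0..L}. (\<Sum>k\<le>N. c k t * g t ^ k) = 0" and t: "t \<in> {0..L}"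
    for c :: "nat \<Rightarrow> real \<Rightarrow> complex" and w :: "nat \<Rightarrow> complex" and g L t
  proof (rule ccontr)
    assume "\<not> ?thesis"
    then have far: "norm (g t / g 0 - 1) \<ge> 1" by simp
    define f where "f t = norm (g t / g 0 - 1)" for t
    have g0: "g 0 \<noteq> 0" using g(2) L by simp
    have "connected (f ` {0..L})"
      unfolding f_def using g0 by (intro connected_continuous_image continuous_intros g) auto
    moreover have "f 0 \<in> f ` {0..L}" "f t \<in> f ` {0..L}" using L t by auto
    ultimately have iv: "x \<in> f ` {0..L}" if "f 0 \<le> x" "x \<le> f t" for x
      using that by (rule connectedD_interval)
    have f0t: "f 0 = 0" "f t \<ge> 1" using g0 far by (auto simp: f_def)
    have iv1: "x \<in> f ` {0..L}" if "0 \<le> x" "x \<le> 1" for x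
      by (rule iv) (use that f0t in linarith)+
    have "\<exists>s\<in>{0..L}. f s = real j * d" if "j \<le> N" for j
      using iv1[of "real j * d"] that d by (auto simp: d_def)
    then obtain s where s: "\<And>j. j \<le> N \<Longrightarrow> s j \<in> {0..L}" "\<And>j. j \<le> N \<Longrightarrow> f (s j) = real j * d" by metis
    define \<mu> where "\<mu> j = g (s j) / g 0" for j
    have mf: "norm (\<mu> j - 1) = real j * d" if "j \<le> N" for j using s(2)[OF that] by (simp add: \<mu>_def f_def)
    have m2: "\<forall>j\<le>N. norm (\<mu> j) \<le> 2"
    proof (intro allI impI)
      fix j assume j: "j \<le> N"
      have "real j * d \<le> 1" using j by (simp add: d_def)
      then show "norm (\<mu> j) \<le> 2" using mf[OF j] norm_triangle_ineq2[of "\<mu> j" 1] by simp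
    qed
    have md: "\<forall>i j. i < j \<longrightarrow> j \<le> N \<longrightarrow> norm (\<mu> i - \<mu> j) \<ge> d"
    proof (intro allI impI)
      fix i j assume ij: "i < j" "j \<le> N"
      have "real j * d - real i * d = norm (\<mu> j - 1) - norm (\<mu> i - 1)" using mf ij by simp
      also have "\<dots> \<le> norm (\<mu> j - \<mu> i)" using norm_triangle_ineq2[of "\<mu> j - 1" "\<mu> i - 1"] by simp
      finally have "(real j - real i) * d \<le> norm (\<mu> i - \<mu> j)" by (simp add: left_diff_distrib norm_minus_commute)
      moreover have "1 * d \<le> (real j - real i) * d" using ij d by (intro mult_right_mono) auto
      ultimately show "d \<le> norm (\<mu> i - \<mu> j)" by simp
    qed
    \<comment> \<open>Writing \<open>g t\<close> as \<open>g 0\<close> times a ratio multiplies the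
      coefficient of degree \<open>k\<close> by \<open>g 0 ^ k\<close>. The closeness of
      \<open>c\<close> to \<open>w\<close> is relative, hence unaffected, so that
      \<open>\<epsilon>\<close> can depend on \<open>N\<close> alone.\<close>
    define W where "W k = w k * g 0 ^ k" for k
    define P where "P = (\<Sum>k\<le>N. Polynomial.monom (W k) k)"
    have cP: "Polynomial.coeff P k = (if k \<le> N then W k else 0)" for k by (simp add: P_def coeff_sum)
    have dP: "degree P \<le> N" by (rule degree_le) (simp add: cP)
    define m where "m = Max ((\<lambda>k. norm (W k)) ` {..N})"
    have mW: "norm (W k) \<le> m" if "k \<le> N" for k unfolding m_def using that by (intro Max_ge) auto
    have "m \<in> (\<lambda>k. norm (W k)) ` {..N}" unfolding m_def by (intro Max_in) auto
    then obtain k1 where k1: "k1 \<le> N" "m = norm (W k1)" by auto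
    have m0: "m > 0" using mW[of N] w g0 by (simp add: W_def less_le_trans[of 0 "norm (w N * g 0 ^ N)"])
    have "norm (poly P (\<mu> j)) \<le> \<epsilon> * m * (real (Suc N) * 2 ^ N)" if j: "j \<le> N" for j
    proof -
      have gs: "g (s j) = g 0 * \<mu> j" using g0 by (simp add: \<mu>_def)
      have "poly P (\<mu> j) = (\<Sum>k\<le>N. w k * g (s j) ^ k)"
        by (simp add: P_def poly_sum poly_monom W_def gs power_mult_distrib mult_ac)
      also have "\<dots> = - (\<Sum>k\<le>N. (c k (s j) - w k) * g (s j) ^ k)"
        using root s(1)[OF j] by (simp add: left_diff_distrib sum_subtractf)
      finally have "norm (poly P (\<mu> j)) = norm (\<Sum>k\<le>N. (c k (s j) - w k) * g (s j) ^ k)" by simp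
      also have "\<dots> \<le> (\<Sum>k\<le>N. \<epsilon> * m * 2 ^ N)"
      proof (rule sum_norm_le)
        fix k assume k: "k \<in> {..N}"
        have "norm ((c k (s j) - w k) * g (s j) ^ k) \<le> (\<epsilon> * norm (w k)) * (norm (g 0) ^ k * norm (\<mu> j) ^ k)"
          unfolding norm_mult norm_power gs power_mult_distrib
          using cw s(1)[OF j] k \<epsilon> by (intro mult_right_mono) auto
        also have "\<dots> = \<epsilon> * norm (W k) * norm (\<mu> j) ^ k" by (simp add: W_def norm_mult norm_power mult_ac)
        also have "\<dots> \<le> \<epsilon> * m * 2 ^ N"
        proof (intro mult_mono)
          have "norm (\<mu> j) ^ k \<le> 2 ^ k" using m2 j by (intro power_mono) auto
          also have "\<dots> \<le> (2::real) ^ N" using k by (intro power_increasing) auto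
          finally show "norm (\<mu> j) ^ k \<le> 2 ^ N" .
        qed (use mW k \<epsilon> m0 in auto)
        finally show "norm ((c k (s j) - w k) * g (s j) ^ k) \<le> \<epsilon> * m * 2 ^ N" .
      qed
      also have "\<dots> = \<epsilon> * m * (real (Suc N) * 2 ^ N)" by simp
      finally show ?thesis .
    qed
    then have "norm (Polynomial.coeff P k1) \<le> K * (\<epsilon> * m * (real (Suc N) * 2 ^ N))"
      using KB[OF dP m2 md] by blast
    then have "m \<le> m * (\<epsilon> * (K * (real (Suc N) * 2 ^ N)))" using k1 by (simp add: cP mult_ac)
    then have "1 \<le> \<epsilon> * (K * (real (Suc N) * 2 ^ N))" using m0 by simp
    moreover have "\<epsilon> * (K * (real (Suc N) * 2 ^ N)) < \<epsilon> * (K * (real (Suc N) * 2 ^ N) + 1)" using \<epsilon> by simp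
    moreover have "\<dots> = 1" using den by (simp add: \<epsilon>_def)
    ultimately show False by simp
  qed
  then show ?thesis using \<epsilon> by (intro exI[of _ \<epsilon>]) blast
qed

section \<open>Integral vectors of deficient rank\<close>

text \<open>Elimination of the last coordinate without division, so that all vectors stay integral.
  The set \<open>V\<close> may be infinite.\<close>

lemma rank_dichotomy:
  fixes V :: "(nat \<Rightarrow> int) set"
  shows "(\<exists>v. (\<forall>j<m. v j \<in> V) \<and>
            (\<forall>c. (\<forall>i\<in>{1..m}. (\<Sum>j<m. c j * v j i) = (0::int)) \<longrightarrow> (\<forall>j<m. c j = 0))) \<or>
         (\<exists>u. (\<exists>i\<in>{1..m}. u i \<noteq> 0) \<and> (\<forall>v\<in>V. pairing m u v = 0))"
proof (induction m arbitrary: V)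
  case 0
  show ?case by simp
next
  case (Suc m)
  show ?case
  proof (cases "\<forall>v\<in>V. v (Suc m) = 0")
    case True
    define u :: "nat \<Rightarrow> int" where "u i = (if i = Suc m then 1 else 0)" for i
    have "pairing (Suc m) u v = 0" if "v \<in> V" for v
      unfolding pairing_def by (rule sum.neutral) (use True that in \<open>auto simp: u_def\<close>)
    moreover have "\<exists>i\<in>{1..Suc m}. u i \<noteq> 0" by (intro bexI[of _ "Suc m"]) (auto simp: u_def)
    ultimately show ?thesis by (intro disjI2 exI[of _ u]) blast
  next
    case False
    then obtain w where w: "w \<in> V" "w (Suc m) \<noteq> 0" by blast
    define a where "a = w (Suc m)"
    \<comment> \<open>The combination of \<open>v\<close> with the pivot \<open>w\<close> whose last
      entry is zero.\<close>
    define red where "red v i = a * v i - v (Suc m) * w i" for v :: "nat \<Rightarrow> int" and i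
    consider v' where "\<forall>j<m. v' j \<in> red ` V"
        "\<forall>c. (\<forall>i\<in>{1..m}. (\<Sum>j<m. c j * v' j i) = (0::int)) \<longrightarrow> (\<forall>j<m. c j = 0)"
      | u where "\<exists>i\<in>{1..m}. u i \<noteq> 0" "\<forall>v\<in>red ` V. pairing m u v = 0"
      using Suc.IH[of "red ` V"] by blast
    then show ?thesis
    proof cases
      case 1
      have "\<forall>j. \<exists>x. j < m \<longrightarrow> x \<in> V \<and> v' j = red x" using 1(1) by blast
      then obtain v where v: "\<And>j. j < m \<Longrightarrow> v j \<in> V" "\<And>j. j < m \<Longrightarrow> v' j = red (v j)" by metis
      define v2 where "v2 j = (if j < m then v j else w)" for j
      have "\<forall>j<Suc m. c j = 0" if c: "\<forall>i\<in>{1..Suc m}. (\<Sum>j<Suc m. c j * v2 j i) = 0" for c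
      proof -
        have s: "(\<Sum>j<m. c j * v j i) = - c m * w i" if "i \<in> {1..Suc m}" for i
          using c[rule_format, OF that] by (simp add: v2_def)
        have "(\<Sum>j<m. c j * v' j i) = 0" if i: "i \<in> {1..m}" for i
        proof -
          have "(\<Sum>j<m. c j * v' j i) = (\<Sum>j<m. a * (c j * v j i) - w i * (c j * v j (Suc m)))"
            by (intro sum.cong refl) (simp add: v(2) red_def algebra_simps)
          also have "\<dots> = a * (\<Sum>j<m. c j * v j i) - w i * (\<Sum>j<m. c j * v j (Suc m))"
            by (simp add: sum_subtractf sum_distrib_left)
          also have "\<dots> = 0" using s[of i] s[of "Suc m"] i by (simp add: a_def)
          finally show ?thesis .
        qed
        then have z: "\<forall>j<m. c j = 0" using 1(2) by blast
        then have "c m * w (Suc m) = 0" using s[of "Suc m"] by simp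
        then show ?thesis using z w(2) by (simp add: less_Suc_eq)
      qed
      moreover have "\<forall>j<Suc m. v2 j \<in> V" using v w by (simp add: v2_def)
      ultimately show ?thesis by (intro disjI1 exI[of _ v2]) blast
    next
      case 2
      \<comment> \<open>The last entry makes \<open>u'\<close> orthogonal to \<open>w\<close>, and
        the factor \<open>a\<close> clears the denominator: pairing \<open>u'\<close> with
        \<open>v\<close> is the same as pairing \<open>u\<close> with \<open>red v\<close>.\<close>
      define u' where "u' i = (if i = Suc m then - (\<Sum>i=1..m. u i * w i) else a * u i)" for i
      have e: "pairing (Suc m) u' v = (\<Sum>i=1..m. a * u i * v i) - (\<Sum>i=1..m. u i * w i) * v (Suc m)" for v
        unfolding pairing_def by (simp add: u'_def)
      have "pairing (Suc m) u' v = 0" if "v \<in> V" for v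
      proof -
        have "pairing m u (red v) = (\<Sum>i=1..m. a * u i * v i) - (\<Sum>i=1..m. u i * w i) * v (Suc m)"
          unfolding pairing_def red_def sum_distrib_right sum_subtractf[symmetric]
          by (intro sum.cong refl) (simp add: algebra_simps)
        then show ?thesis using 2(2) that e by simp
      qed
      moreover obtain i where "i \<in> {1..m}" "u i \<noteq> 0" using 2(1) by blast
      then have "\<exists>i\<in>{1..Suc m}. u' i \<noteq> 0"
        using w(2) by (intro bexI[of _ i]) (auto simp: u'_def a_def)
      ultimately show ?thesis by (intro disjI2 exI[of _ u']) blast
    qed
  qed
qed

text \<open>Halving a vector with only even entries keeps it orthogonal and lowers the sum of
  absolute values. An odd entry is what makes the half turn change a sign.\<close>

lemma odd_orthogonal_vector:
  assumes "\<exists>i\<in>{1..m}. u i \<noteq> 0" "\<forall>v\<in>V. pairing m u v = 0"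
  shows "\<exists>u. (\<exists>i\<in>{1..m}. odd (u i)) \<and> (\<forall>v\<in>V. pairing m u v = 0)"
  using assms
proof (induction "\<Sum>i=1..m. nat \<bar>u i\<bar>" arbitrary: u rule: less_induct)
  case less
  show ?case
  proof (cases "\<exists>i\<in>{1..m}. odd (u i)")
    case False
    define u' where "u' i = u i div 2" for i
    have u: "u i = 2 * u' i" if "i \<in> {1..m}" for i using False that by (auto simp: u'_def)
    obtain i where i: "i \<in> {1..m}" "u i \<noteq> 0" using less.prems(1) by blast
    have "(\<Sum>i=1..m. nat \<bar>u' i\<bar>) < (\<Sum>i=1..m. nat \<bar>u i\<bar>)"
    proof (rule sum_strict_mono_ex1)
      show "\<forall>i\<in>{1..m}. nat \<bar>u' i\<bar> \<le> nat \<bar>u i\<bar>" by (auto simp: u)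
      show "\<exists>i\<in>{1..m}. nat \<bar>u' i\<bar> < nat \<bar>u i\<bar>" using i u[OF i(1)] by (intro bexI[of _ i]) auto
    qed simp
    moreover have "\<exists>i\<in>{1..m}. u' i \<noteq> 0" using i u by auto
    moreover have "\<forall>v\<in>V. pairing m u' v = 0"
    proof
      fix v assume "v \<in> V"
      have "pairing m u v = 2 * pairing m u' v" unfolding pairing_def sum_distrib_left by (intro sum.cong) (auto simp: u)
      then show "pairing m u' v = 0" using less.prems(2) \<open>v \<in> V\<close> by simp
    qed
    ultimately show ?thesis by (rule less.hyps)
  qed (use less.prems in blast)
qed

section \<open>Triviality of the monodromy along orthogonal directions\<close>

definition flip :: "(nat \<Rightarrow> int) \<Rightarrow> (nat \<Rightarrow> complex) \<Rightarrow> nat \<Rightarrow> complex" where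
  "flip u s i = (if odd (u i) then - s i else s i)"

lemma spiral_add_pi: "spiral u r (t + pi) = flip u (spiral u r t)"
proof
  fix i
  have "spiral u r (t + pi) i = spiral u r t i * exp (- (\<i> * of_real (pi * of_int (u i))))"
    by (simp add: spiral_def exp_add[symmetric] algebra_simps)
  also have "exp (- (\<i> * of_real (pi * of_int (u i)))) = (if odd (u i) then - 1 else 1)"
  proof (cases "odd (u i)")
    case True
    then obtain k where k: "u i = 2 * k + 1" by (rule oddE)
    have "exp (- (\<i> * of_real (pi * of_int (u i)))) = cis (2 * pi * of_int (- k) + (- pi))"
      by (simp add: cis_conv_exp k algebra_simps)
    also have "\<dots> = cis (2 * pi * of_int (- k)) * cis (- pi)" by (rule cis_mult[symmetric])
    also have "cis (2 * pi * of_int (- k)) = 1" by (rule cis_multiple_2pi) simp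
    also have "cis (- pi) = - 1" by (simp add: complex_eq_iff)
    finally show ?thesis using True by simp
  next
    case False
    then obtain k where k: "u i = 2 * k" by (auto elim: evenE)
    have "exp (- (\<i> * of_real (pi * of_int (u i)))) = cis (2 * pi * of_int (- k))"
      by (simp add: cis_conv_exp k algebra_simps)
    also have "\<dots> = 1" by (rule cis_multiple_2pi) simp
    finally show ?thesis using False by simp
  qed
  finally show "spiral u r (t + pi) i = flip u (spiral u r t) i" by (simp add: flip_def)
qed

lemma eventually_strip_at_top: "eventually P strip \<longleftrightarrow> eventually (\<lambda>r. \<forall>t. P (r, t)) at_top"
  unfolding eventually_strip eventually_at_top_linorder by blast

text \<open>For large \<open>r\<close> every coefficient is either identically zero or nowhere zero
  on the spiral. A lowest coefficient of the second kind exists, since the leading coefficient 1 is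
  one of them, and it keeps nonzero roots away from zero. The gap may depend on
  \<open>r\<close>.\<close>

lemma integral_separated:
  assumes q: "\<forall>k<N. rational_fun m (q k)" and L: "L \<ge> 0"
  shows "eventually (\<lambda>r. \<exists>d>0. \<forall>t\<in>{0..L}. \<forall>g. monic_val N q (spiral u r t) g = 0 \<longrightarrow> g \<noteq> 0 \<longrightarrow> norm g \<ge> d) at_top"
proof -
  define c where "c k s = (if k = N then 1 else q k s)" for k s
  have c_rat: "rational_fun m (c k)" if "k \<le> N" for k
    using q that rational_fun_poly[OF poly_functions.const[of 1 m]]
    by (cases "k = N") (auto simp: c_def[abs_def])
  have mc: "monic_val N q s g = (\<Sum>k\<le>N. c k s * g ^ k)" for s g
    by (simp add: monic_val_def c_def lessThan_Suc_atMost[symmetric] add.commute)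
  define Z where "Z k \<longleftrightarrow> eventually (\<lambda>(r, t). c k (spiral u r t) = 0) strip" for k
  have "\<not> Z N" unfolding Z_def c_def eventually_strip by auto
  define k0 where "k0 = (LEAST k. \<not> Z k)"
  have k0: "\<not> Z k0" "k0 \<le> N" "\<And>k. k < k0 \<Longrightarrow> Z k"
    unfolding k0_def using LeastI[of "\<lambda>k. \<not> Z k" N] Least_le[of "\<lambda>k. \<not> Z k" N] \<open>\<not> Z N\<close>
    by (auto dest: not_less_Least)
  have "\<exists>v. leading m (c k0) v" using rational_eventually[OF c_rat[OF k0(2)], of u] k0(1) by (simp add: Z_def)
  then have nz: "eventually (\<lambda>r. \<forall>t. c k0 (spiral u r t) \<noteq> 0) at_top"
    using leading_nonzero[of m "c k0" _ u] unfolding eventually_strip_at_top by auto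
  have "\<forall>k\<in>{..<k0}. eventually (\<lambda>r. \<forall>t. c k (spiral u r t) = 0) at_top"
    using k0(3) unfolding Z_def eventually_strip_at_top by auto
  then have z: "eventually (\<lambda>r. \<forall>k\<in>{..<k0}. \<forall>t. c k (spiral u r t) = 0) at_top"
    by (intro eventually_ball_finite) auto
  have "\<forall>k\<in>{..N}. eventually (\<lambda>r. continuous_on UNIV (\<lambda>t. c k (spiral u r t))) at_top"
    using rational_continuous[OF c_rat] unfolding eventually_at_top_linorder by auto
  then have ct: "eventually (\<lambda>r. \<forall>k\<in>{..N}. continuous_on UNIV (\<lambda>t. c k (spiral u r t))) at_top"
    by (intro eventually_ball_finite) auto
  from nz z ct show ?thesis
  proof eventually_elim
    case (elim r)
    have "\<exists>d>0. \<forall>t\<in>{0..L}. \<forall>g. (\<Sum>k\<le>N. c k (spiral u r t) * g ^ k) = 0 \<longrightarrow> g \<noteq> 0 \<longrightarrow> norm g \<ge> d"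
    proof (rule nonzero_roots_separated[OF k0(2) _ _ _ L])
      fix k assume "k \<le> N"
      then have "continuous_on UNIV (\<lambda>t. c k (spiral u r t))" using elim(3) by simp
      then show "continuous_on {0..L} (\<lambda>t. c k (spiral u r t))" by (rule continuous_on_subset) simp
    qed (use elim in auto)
    then show ?case by (simp add: mc)
  qed
qed

text \<open>Orthogonality removes the phase of the leading monomial, so for large \<open>r\<close>
  each coefficient differs from a number independent of \<open>t\<close> by a small relative error.
  The admissible error depends only on \<open>N\<close>, so it is fixed before
  \<open>r\<close>.\<close>

lemma orthogonal_nearly_constant:
  assumes q: "\<forall>k<N. rational_fun m (q k)" and u: "\<forall>k<N. \<forall>v. leading m (q k) v \<longrightarrow> pairing m u v = 0" and L: "L \<ge> 0"
  shows "eventually (\<lambda>r. \<forall>g. continuous_on {0..L} g \<longrightarrow> (\<forall>t\<in>{0..L}. g t \<noteq> 0) \<longrightarrow>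
     (\<forall>t\<in>{0..L}. monic_val N q (spiral u r t) (g t) = 0) \<longrightarrow> (\<forall>t\<in>{0..L}. norm (g t / g 0 - 1) < 1)) at_top"
proof -
  define c where "c k s = (if k = N then 1 else q k s)" for k s
  have mc: "monic_val N q s g = (\<Sum>k\<le>N. c k s * g ^ k)" for s g
    by (simp add: monic_val_def c_def lessThan_Suc_atMost[symmetric] add.commute)
  from nearly_constant_root[of N] obtain \<epsilon> where \<epsilon>0: "\<epsilon> > 0" and \<epsilon>1: "\<forall>c w g L. L \<ge> 0 \<longrightarrow> continuous_on {0..L} g \<longrightarrow> (\<forall>t\<in>{0..L}. g t \<noteq> 0) \<longrightarrow>
     (\<forall>t\<in>{0..L}. \<forall>k\<le>N. norm (c k t - w k) \<le> \<epsilon> * norm (w k)) \<longrightarrow> w N \<noteq> 0 \<longrightarrow>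
     (\<forall>t\<in>{0..L}. (\<Sum>k\<le>N. c k t * g t ^ k) = 0) \<longrightarrow>
     (\<forall>t\<in>{0..L}. norm (g t / g (0::real) - (1::complex)) < 1)"
    by (elim exE conjE)
  have "\<exists>w. (k = N \<longrightarrow> w = (\<lambda>_. 1)) \<and> eventually (\<lambda>r. \<forall>t. norm (c k (spiral u r t) - w r) \<le> \<epsilon> * norm (w r)) at_top"
    if k: "k \<le> N" for k
  proof (cases "k = N")
    case True
    then show ?thesis using \<epsilon>0 by (intro exI[of _ "\<lambda>_. 1"]) (simp add: c_def)
  next
    case False
    then have kN: "k < N" using k by simp
    have ck: "c k = q k" using False by (auto simp: c_def)
    consider "eventually (\<lambda>(r, t). q k (spiral u r t) = 0) strip" | v where "leading m (q k) v"
      using rational_eventually[of m "q k" u] q kN by blast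
    then show ?thesis
    proof cases
      case 1
      then have "eventually (\<lambda>r. \<forall>t. q k (spiral u r t) = 0) at_top" unfolding eventually_strip_at_top by simp
      then have "eventually (\<lambda>r. \<forall>t. norm (c k (spiral u r t) - 0) \<le> \<epsilon> * norm (0::complex)) at_top"
        by eventually_elim (simp add: ck)
      then show ?thesis using False by (intro exI[of _ "\<lambda>_. 0"]) simp
    next
      case 2
      have p0: "pairing m u v = 0" using u kN 2 by blast
      obtain C where C: "C \<noteq> 0" "((\<lambda>(r, t). q k (spiral u r t) / spiral_char m u v r t) \<longlongrightarrow> C) strip"
        using 2 unfolding leading_def by blast
      have "\<epsilon> * norm C > 0" using C \<epsilon>0 by simp
      from tendstoD[OF C(2) this]
      have "eventually (\<lambda>r. \<forall>t. dist (q k (spiral u r t) / spiral_char m u v r t) C < \<epsilon> * norm C) at_top"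
        unfolding eventually_strip_at_top by simp
      then have "eventually (\<lambda>r. \<forall>t. norm (c k (spiral u r t) - C * spiral_char m u v r 0) \<le> \<epsilon> * norm (C * spiral_char m u v r 0)) at_top"
      proof eventually_elim
        case (elim r)
        show ?case
        proof
          fix t
          let ?x = "spiral_char m u v r 0"
          have x: "spiral_char m u v r t = ?x" by (simp add: spiral_char_def p0)
          have "q k (spiral u r t) - C * ?x = (q k (spiral u r t) / ?x - C) * ?x" by (simp add: field_simps)
          then have "norm (c k (spiral u r t) - C * ?x) = dist (q k (spiral u r t) / ?x) C * norm ?x"
            unfolding ck dist_norm by (simp add: norm_mult)
          also have "\<dots> \<le> \<epsilon> * norm C * norm ?x"
            using elim[rule_format, of t] unfolding x by (intro mult_right_mono) auto
          finally show "norm (c k (spiral u r t) - C * ?x) \<le> \<epsilon> * norm (C * ?x)" by (simp add: norm_mult)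
        qed
      qed
      then show ?thesis using False by (intro exI[of _ "\<lambda>r. C * spiral_char m u v r 0"]) simp
    qed
  qed
  note ex = this
  define w where "w k = (SOME w. (k = N \<longrightarrow> w = (\<lambda>_. 1)) \<and> eventually (\<lambda>r. \<forall>t. norm (c k (spiral u r t) - w r) \<le> \<epsilon> * norm (w r)) at_top)" for k
  have w: "(k = N \<longrightarrow> w k = (\<lambda>_. 1)) \<and> eventually (\<lambda>r. \<forall>t. norm (c k (spiral u r t) - w k r) \<le> \<epsilon> * norm (w k r)) at_top"
    if "k \<le> N" for k
    unfolding w_def by (rule someI_ex[OF ex[OF that]])
  have "\<forall>k\<in>{..N}. eventually (\<lambda>r. \<forall>t. norm (c k (spiral u r t) - w k r) \<le> \<epsilon> * norm (w k r)) at_top" using w by auto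
  then have "eventually (\<lambda>r. \<forall>k\<in>{..N}. \<forall>t. norm (c k (spiral u r t) - w k r) \<le> \<epsilon> * norm (w k r)) at_top"
    by (intro eventually_ball_finite) auto
  then show ?thesis
  proof eventually_elim
    case (elim r)
    have wN: "w N r \<noteq> 0" using w[of N] by simp
    have el: "\<forall>t\<in>{0..L}. \<forall>k\<le>N. norm (c k (spiral u r t) - w k r) \<le> \<epsilon> * norm (w k r)" using elim by simp
    show ?case
    proof (intro allI impI ballI)
      fix g t assume g: "continuous_on {0..L} g" "\<forall>t\<in>{0..L}. g t \<noteq> 0"
        "\<forall>t\<in>{0..L}. monic_val N q (spiral u r t) (g t) = 0" and t: "t \<in> {0..L}"
      show "norm (g t / g 0 - 1) < 1"
        by (rule \<epsilon>1[rule_format, where c = "\<lambda>k t. c k (spiral u r t)" and w = "\<lambda>k. w k r" and g = g and L = L])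
          (use L g t el wN in \<open>simp_all add: mc\<close>)
    qed
  qed
qed

text \<open>Polynomials in the parameters \<open>s\<close> and one further number \<open>y\<close>;
  the numerators and denominators of \<open>R\<close> pull back to such functions.\<close>

definition poly_functions_line :: "nat \<Rightarrow> ((nat \<Rightarrow> complex) \<times> complex \<Rightarrow> complex) set" where
  "poly_functions_line m = alg_gen (insert snd {\<lambda>x. f (fst x) | f. f \<in> poly_functions m})"

lemma fun_algebra_poly_functions_line: "fun_algebra (poly_functions_line m)"
  unfolding poly_functions_line_def by (rule fun_algebra_alg_gen)

lemma poly_functions_line_rep:
  assumes "G \<in> poly_functions_line m"
  shows "\<exists>L a. (\<forall>k. a k \<in> poly_functions m) \<and> (\<forall>s y. G (s, y) = (\<Sum>k<L. a k s * y ^ k))"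
proof -
  let ?P = "{\<lambda>x. f (fst x) | f. f \<in> poly_functions m} :: ((nat \<Rightarrow> complex) \<times> complex \<Rightarrow> complex) set"
  have P: "fun_algebra ?P"
  proof (rule fun_algebraI)
    fix c show "(\<lambda>_. c) \<in> ?P" by (intro CollectI exI[of _ "\<lambda>_. c"]) (simp add: poly_functions.const)
  next
    fix f g assume "f \<in> ?P" "g \<in> ?P"
    then obtain f' g' where *: "f = (\<lambda>x. f' (fst x))" "g = (\<lambda>x. g' (fst x))" "f' \<in> poly_functions m" "g' \<in> poly_functions m"
      by blast
    show "(\<lambda>x. f x + g x) \<in> ?P"
      by (intro CollectI exI[of _ "\<lambda>x. f' x + g' x"]) (simp add: * poly_functions.add)
    show "(\<lambda>x. f x * g x) \<in> ?P"
      by (intro CollectI exI[of _ "\<lambda>x. f' x * g' x"]) (simp add: * poly_functions.mult)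
  qed
  obtain a d where a: "\<forall>k. a k \<in> ?P" and G: "G = poly_rep snd a d"
    using alg_gen_insert_rep[OF P] assms unfolding poly_functions_line_def by blast
  have "\<forall>k. \<exists>b. b \<in> poly_functions m \<and> a k = (\<lambda>x. b (fst x))" using a by blast
  then obtain b where b: "\<And>k. b k \<in> poly_functions m" "\<And>k. a k = (\<lambda>x. b k (fst x))" by metis
  have "G (s, y) = (\<Sum>k<Suc d. b k s * y ^ k)" for s y
    unfolding G poly_rep_def b(2) lessThan_Suc_atMost by simp
  then show ?thesis using b(1) by (intro exI[of _ "Suc d"] exI[of _ b]) blast
qed

lemma monic_roots_card:
  shows "finite {y. monic_val D p x y = 0}" "D \<ge> 1 \<Longrightarrow> card {y. monic_val D p x y = 0} \<le> D"
proof -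
  obtain P :: "complex poly" where P: "degree P = D" "lead_coeff P = 1" "\<And>y. poly P y = monic_val D p x y"
    using monic_val_poly[of D p x] by blast
  have "P \<noteq> 0" using P(2) by auto
  then show "finite {y. monic_val D p x y = 0}" "card {y. monic_val D p x y = 0} \<le> D"
    using poly_roots_finite[of P] card_poly_roots_bound[of P] P by auto
qed

text \<open>Here \<open>p\<close> is the equation of the values of the covering, \<open>K\<close> a
  finite stock of fractions, and \<open>Z\<close> the roots as functions of the parameters. At the
  starting point a value \<open>y0\<close> and a fraction expressing \<open>z\<close> through it are
  chosen; the value and the relation are both continued along a half turn.\<close>

lemma monodromy_trivial:
  assumes F: "fun_algebra F" "\<forall>f\<in>F. rational_fun m f"
    and inv: "\<forall>f\<in>F. \<forall>s. f (flip u s) = f s"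
    and u: "\<forall>f\<in>F. \<forall>v. leading m f v \<longrightarrow> pairing m u v = 0"
    and D: "D \<ge> 1" and p: "\<forall>k<D. p k \<in> F"
    and K: "finite K" "\<forall>(A, B)\<in>K. A \<in> poly_functions_line m \<and> B \<in> poly_functions_line m"
    and Kinv: "\<forall>(A, B)\<in>K. \<forall>s y. A (flip u s, y) = A (s, y) \<and> B (flip u s, y) = B (s, y)"
    and Z: "finite Z" "Z \<subseteq> poly_functions m"
    and H: "H \<in> poly_functions m" "H s0 \<noteq> 0"
    and ind: "\<And>s z. H s \<noteq> 0 \<Longrightarrow> z \<in> Z \<Longrightarrow>
       \<exists>y. monic_val D p s y = 0 \<and> (\<exists>(A, B)\<in>K. B (s, y) \<noteq> 0 \<and> z s * B (s, y) = A (s, y))"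
  shows "eventually (\<lambda>r. \<forall>z\<in>Z. z (flip u (spiral u r 0)) = z (spiral u r 0)) at_top"
proof -
  \<comment> \<open>Pigeonhole on at most \<open>D\<close> roots uses the values of \<open>Y\<close>
    at \<open>0, pi, ..., D * pi\<close>; one more half turn lets \<open>g\<close> be defined up to
    \<open>D * pi\<close>.\<close>
  define L where "L = pi * (real D + 1)"
  have L: "L > 0" "pi * real D \<ge> 0" by (auto simp: L_def intro!: mult_pos_pos)
  obtain N q where N: "N \<ge> 1" and q: "\<forall>k<N. q k \<in> F"
    and diff: "\<forall>x y z. monic_val D p x y = 0 \<longrightarrow> monic_val D p x z = 0 \<longrightarrow> monic_val N q x (y - z) = 0"
    using difference_monic[OF F(1) p D] by (elim exE conjE)
  have qr: "\<forall>k<N. rational_fun m (q k)" using q F(2) by blast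
  have pr: "\<forall>k<D. rational_fun m (p k)" using p F(2) by blast
  have qu: "\<forall>k<N. \<forall>v. leading m (q k) v \<longrightarrow> pairing m u v = 0" using q u by blast
  \<comment> \<open>Besides the denominators these are the relations \<open>z * B - A\<close>. At
    roots their values are integral over rational functions, so on a spiral they vanish or keep a
    distance from zero, and a relation that holds at the start persists along a continuous
    root.\<close>
  define GG where "GG = (\<lambda>(A, B). B) ` K \<union> (\<lambda>((A, B), z). \<lambda>x. z (fst x) * B x - A x) ` (K \<times> Z)"
  have GG: "finite GG" "GG \<subseteq> poly_functions_line m"
  proof -
    show "finite GG" unfolding GG_def using K(1) Z(1) by blast
    show "GG \<subseteq> poly_functions_line m"
    proof
      fix G assume "G \<in> GG"
      then consider A B where "(A, B) \<in> K" "G = B" | A B z where "(A, B) \<in> K" "z \<in> Z" "G = (\<lambda>x. z (fst x) * B x - A x)"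
        unfolding GG_def by auto
      then show "G \<in> poly_functions_line m"
      proof cases
        case 1
        then show ?thesis using K(2) by blast
      next
        case 2
        have "(\<lambda>x. z (fst x)) \<in> poly_functions_line m"
          unfolding poly_functions_line_def using 2(2) Z(2) by (intro alg_gen.gen insertI2 CollectI exI[of _ z]) auto
        then show ?thesis unfolding 2(3)
          using fa_diff[OF fun_algebra_poly_functions_line fa_mult[OF fun_algebra_poly_functions_line]] K(2) 2(1) by blast
      qed
    qed
  qed
  have Gsep: "eventually (\<lambda>r. \<exists>d>0. \<forall>t\<in>{0..L}. \<forall>y. monic_val D p (spiral u r t) y = 0 \<longrightarrow>
      G (spiral u r t, y) = 0 \<or> norm (G (spiral u r t, y)) \<ge> d) at_top" if G: "G \<in> GG" for G
  proof -
    obtain l a where a: "\<forall>k. a k \<in> poly_functions m" "\<forall>s y. G (s, y) = (\<Sum>k<l. a k s * y ^ k)"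
      using poly_functions_line_rep[of G m] GG(2) G by blast
    have p': "\<forall>k<D. p k \<in> {f. rational_fun m f}" using pr by simp
    have a': "\<forall>k<l. a k \<in> {f. rational_fun m f}" using a(1) rational_fun_poly by blast
    from combination_monic[OF fun_algebra_rational p' D a']
    obtain q' where q': "\<forall>k<D. q' k \<in> {f. rational_fun m f}"
      and q'': "\<forall>x y. monic_val D p x y = 0 \<longrightarrow> monic_val D q' x (\<Sum>k<l. a k x * y ^ k) = 0"
      by (elim exE conjE)
    have "\<forall>k<D. rational_fun m (q' k)" using q' by simp
    from integral_separated[OF this, of L u] L(1)
    have "eventually (\<lambda>r. \<exists>d>0. \<forall>t\<in>{0..L}. \<forall>g. monic_val D q' (spiral u r t) g = 0 \<longrightarrow> g \<noteq> 0 \<longrightarrow> norm g \<ge> d) at_top" by simp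
    then show ?thesis
    proof eventually_elim
      case (elim r)
      then obtain d where d: "d > 0" "\<forall>t\<in>{0..L}. \<forall>g. monic_val D q' (spiral u r t) g = 0 \<longrightarrow> g \<noteq> 0 \<longrightarrow> norm g \<ge> d"
        by blast
      have "G (spiral u r t, y) = 0 \<or> norm (G (spiral u r t, y)) \<ge> d"
        if "t \<in> {0..L}" "monic_val D p (spiral u r t) y = 0" for t y
        using d(2)[rule_format, OF that(1), of "G (spiral u r t, y)"] q''[rule_format, OF that(2)] a(2) by auto
      then show ?case using d(1) by blast
    qed
  qed
  then have e3: "eventually (\<lambda>r. \<forall>G\<in>GG. \<exists>d>0. \<forall>t\<in>{0..L}. \<forall>y. monic_val D p (spiral u r t) y = 0 \<longrightarrow>
      G (spiral u r t, y) = 0 \<or> norm (G (spiral u r t, y)) \<ge> d) at_top"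
    using GG(1) by (intro eventually_ball_finite) auto
  have "\<forall>k\<in>{..<D}. eventually (\<lambda>r. continuous_on UNIV (\<lambda>t. p k (spiral u r t))) at_top"
    using rational_continuous pr unfolding eventually_at_top_linorder by auto
  then have e1: "eventually (\<lambda>r. \<forall>k\<in>{..<D}. continuous_on UNIV (\<lambda>t. p k (spiral u r t))) at_top"
    by (intro eventually_ball_finite) auto
  have e2: "eventually (\<lambda>r. \<exists>d>0. \<forall>t\<in>{0..L}. \<forall>g. monic_val N q (spiral u r t) g = 0 \<longrightarrow> g \<noteq> 0 \<longrightarrow> norm g \<ge> d) at_top"
    by (rule integral_separated[OF qr]) (use L in simp)
  note e4 = orthogonal_nearly_constant[OF qr qu L(2)]
  have e5: "eventually (\<lambda>r. H (spiral u r 0) \<noteq> 0) at_top"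
    using poly_nonzero_eventually[OF H, of u] unfolding eventually_strip_at_top by (rule eventually_mono) simp
  from e1 e2 e3 e4 e5 show ?thesis
  proof eventually_elim
    case (elim r)
    define P where "P k t = p k (spiral u r t)" for k t
    have mP: "monic_val D P t y = monic_val D p (spiral u r t) y" for t y by (simp add: monic_val_def P_def)
    obtain d where d: "d > 0" "\<And>t g. t \<in> {0..L} \<Longrightarrow> monic_val N q (spiral u r t) g = 0 \<Longrightarrow> g \<noteq> 0 \<Longrightarrow> norm g \<ge> d"
      using elim(2) by blast
    \<comment> \<open>The coefficients are invariant under the sign changes, so the set of roots has
      period \<open>pi\<close> although a single root need not.\<close>
    have per: "monic_val D P (t + pi) y = monic_val D P t y" for t y
    proof -
      have "P k (t + pi) = P k t" if "k < D" for k
        unfolding P_def spiral_add_pi using inv p that by simp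
      then show ?thesis by (simp add: monic_val_def)
    qed
    have dP: "monic_val N q (spiral u r t) (y - z) = 0" if "monic_val D P t y = 0" "monic_val D P t z = 0" for t y z
      using diff that unfolding mP by blast
    have sep: "y = y'" if "t \<in> {0..L}" "monic_val D P t y = 0" "monic_val D P t y' = 0" "norm (y - y') < d" for t y y'
      using d(2)[OF that(1) dP[OF that(2,3)]] that(4) by auto
    have cP: "\<forall>k<D. continuous_on {0..L} (P k)"
      using elim(1) unfolding P_def[abs_def] by (auto intro: continuous_on_subset)
    show ?case
    proof
      fix z assume z: "z \<in> Z"
      obtain y0 A B where y0: "monic_val D p (spiral u r 0) y0 = 0" and AB: "(A, B) \<in> K"
        "B (spiral u r 0, y0) \<noteq> 0" "z (spiral u r 0) * B (spiral u r 0, y0) = A (spiral u r 0, y0)"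
        using ind[OF elim(5) z] by blast
      have "monic_val D P 0 y0 = 0" using y0 by (simp add: mP)
      then have "\<exists>Y. continuous_on {0..L} Y \<and> Y 0 = y0 \<and> (\<forall>t\<in>{0..L}. monic_val D P t (Y t) = 0)"
        by (intro monic_root_lift[OF D cP L(1) d(1)]) (rule sep)
      then obtain Y where Y: "continuous_on {0..L} Y" "Y 0 = y0" "\<forall>t\<in>{0..L}. monic_val D P t (Y t) = 0" by blast
      define g where "g t = Y (t + pi) - Y t" for t
      have in1: "t \<in> {0..L}" "t + pi \<in> {0..L}" if "t \<in> {0..pi * real D}" for t
      proof -
        have "pi * real D + pi = L" by (simp add: L_def algebra_simps)
        then show "t \<in> {0..L}" "t + pi \<in> {0..L}" using that pi_gt_zero by (simp_all, linarith)
      qed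
      have "continuous_on {0..pi * real D} (\<lambda>t. Y (t + pi))"
        by (rule continuous_on_compose2[OF Y(1)]) (intro continuous_intros, use in1(2) in blast)
      moreover have "continuous_on {0..pi * real D} Y"
        by (rule continuous_on_subset[OF Y(1)]) (use in1(1) in blast)
      ultimately have cg: "continuous_on {0..pi * real D} g"
        unfolding g_def by (intro continuous_on_diff)
      have rg: "\<forall>t\<in>{0..pi * real D}. monic_val N q (spiral u r t) (g t) = 0"
      proof
        fix t assume t: "t \<in> {0..pi * real D}"
        have "monic_val D P (t + pi) (Y (t + pi)) = 0" "monic_val D P t (Y t) = 0" using Y(3) in1[OF t] by blast+
        then show "monic_val N q (spiral u r t) (g t) = 0" unfolding g_def per by (rule dP)
      qed
      have "g 0 = 0"
      proof (rule ccontr)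
        assume g0: "g 0 \<noteq> 0"
        \<comment> \<open>The difference \<open>g\<close> satisfies an integral equation too, so by
          the gap at zero it vanishes everywhere or nowhere.\<close>
        have gnz: "g t \<noteq> 0" if t: "t \<in> {0..pi * real D}" for t
        proof
          assume "g t = 0"
          have "g x = 0 \<or> norm (g x) \<ge> d" if "x \<in> {0..pi * real D}" for x
            using d(2)[OF in1(1)[OF that] rg[rule_format, OF that]] by blast
          from zero_dichotomy[OF cg d(1) this t \<open>g t = 0\<close>, of 0] have "g 0 = 0" using L(2) by simp
          then show False using g0 by simp
        qed
        have close: "\<forall>t\<in>{0..pi * real D}. norm (g t / g 0 - 1) < 1"
          using elim(4) cg gnz rg by blast
        have roots: "monic_val D P 0 (Y (real j * pi)) = 0" if "j \<le> D" for j
        proof -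
          have "monic_val D P (real j * pi) y = monic_val D P 0 y" for y
          proof (induction j)
            case (Suc j)
            then show ?case using per[of "real j * pi" y] by (simp add: algebra_simps)
          qed simp
          moreover have "real j * pi \<in> {0..L}" using that by (auto simp: L_def mult.commute[of pi] intro!: mult_right_mono)
          ultimately show ?thesis using Y(3) by metis
        qed
        have "\<not> inj_on (\<lambda>j. Y (real j * pi)) {..D}"
        proof
          assume "inj_on (\<lambda>j. Y (real j * pi)) {..D}"
          then have "card ((\<lambda>j. Y (real j * pi)) ` {..D}) = Suc D" by (simp add: card_image)
          moreover have "card ((\<lambda>j. Y (real j * pi)) ` {..D}) \<le> card {y. monic_val D P 0 y = 0}"
            by (intro card_mono monic_roots_card) (use roots in auto)
          ultimately show False using monic_roots_card(2)[OF D, of P 0] by linarith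
        qed
        then obtain i j where ij: "i < j" "j \<le> D" "Y (real i * pi) = Y (real j * pi)"
          unfolding inj_on_def by (metis atMost_iff linorder_neqE_nat)
        \<comment> \<open>The increments between two coinciding values telescope to zero, while each
          of them divided by \<open>g 0\<close> lies in the open unit disc about 1 and so has
          positive real part.\<close>
        have "(\<Sum>k\<in>{i..<j}. g (real k * pi)) = (\<Sum>k\<in>{i..<j}. Y (real (Suc k) * pi) - Y (real k * pi))"
          by (intro sum.cong refl) (simp add: g_def algebra_simps)
        also have "\<dots> = Y (real j * pi) - Y (real i * pi)"
          using ij by (subst sum_Suc_diff') auto
        finally have "(\<Sum>k\<in>{i..<j}. g (real k * pi)) = 0" using ij by simp
        then have "(\<Sum>k\<in>{i..<j}. g (real k * pi) / g 0) = 0" unfolding sum_divide_distrib[symmetric] by simp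
        then have "Re (\<Sum>k\<in>{i..<j}. g (real k * pi) / g 0) = 0" by simp
        moreover have "Re (\<Sum>k\<in>{i..<j}. g (real k * pi) / g 0) > 0"
          unfolding Re_sum
        proof (rule sum_pos)
          fix k assume k: "k \<in> {i..<j}"
          have "real k * pi \<in> {0..pi * real D}" using k ij by (auto simp: mult.commute[of pi] intro!: mult_right_mono)
          then have "norm (g (real k * pi) / g 0 - 1) < 1" using close by blast
          then show "Re (g (real k * pi) / g 0) > 0"
            using abs_Re_le_cmod[of "g (real k * pi) / g 0 - 1"] by simp
        qed (use ij in auto)
        ultimately show False by simp
      qed
      then have Ypi: "Y pi = y0" by (simp add: g_def Y(2))
      have piL: "pi \<in> {0..L}" "0 \<in> {0..L}" using in1[of 0] L(2) by auto
      have Gdich: "G (spiral u r pi, Y pi) = 0 \<longleftrightarrow> G (spiral u r 0, Y 0) = 0" if G: "G \<in> GG" for G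
      proof -
        obtain l a where a: "\<forall>k. a k \<in> poly_functions m" "\<forall>s y. G (s, y) = (\<Sum>k<l. a k s * y ^ k)"
          using poly_functions_line_rep[of G m] GG(2) G by blast
        obtain d' where d': "d' > 0" "\<And>t y. t \<in> {0..L} \<Longrightarrow> monic_val D p (spiral u r t) y = 0 \<Longrightarrow>
            G (spiral u r t, y) = 0 \<or> norm (G (spiral u r t, y)) \<ge> d'"
          using elim(3) G by blast
        have cG: "continuous_on {0..L} (\<lambda>t. G (spiral u r t, Y t))"
          unfolding a(2)[rule_format] by (intro continuous_intros continuous_poly_spiral[of _ m] a(1)[rule_format] Y(1))
        have sG: "G (spiral u r t, Y t) = 0 \<or> norm (G (spiral u r t, Y t)) \<ge> d'" if "t \<in> {0..L}" for t
          using d'(2)[OF that] Y(3) that unfolding mP by blast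
        show ?thesis using zero_dichotomy[OF cG d'(1) sG] piL by blast
      qed
      have spi: "spiral u r pi = flip u (spiral u r 0)" using spiral_add_pi[of u r 0] by simp
      have "(\<lambda>x. z (fst x) * B x - A x) \<in> GG" unfolding GG_def using AB(1) z by (intro UnI2 image_eqI[of _ _ "((A, B), z)"]) auto
      from Gdich[OF this] AB(3)
      have "z (flip u (spiral u r 0)) * B (flip u (spiral u r 0), y0) = A (flip u (spiral u r 0), y0)"
        by (simp add: Y(2) Ypi spi)
      \<comment> \<open>Since \<open>y0\<close> has come back, invariance under \<open>flip\<close>
        identifies \<open>A\<close> and \<open>B\<close> at the end with their values at the start,
        where \<open>B\<close> is nonzero.\<close>
      then have "z (flip u (spiral u r 0)) * B (spiral u r 0, y0) = z (spiral u r 0) * B (spiral u r 0, y0)"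
        using Kinv AB by auto
      then show "z (flip u (spiral u r 0)) = z (spiral u r 0)" using AB(2) by simp
    qed
  qed
qed

section \<open>Algebraic relations and Krull dimension\<close>

text \<open>Gaussian elimination, with unknowns indexed by \<open>A\<close> and equations by
  \<open>E\<close>.\<close>

lemma homogeneous_system_solvable:
  fixes M :: "'a \<Rightarrow> 'e \<Rightarrow> complex"
  assumes "finite E" "finite A" "card E < card A"
  shows "\<exists>a. (\<exists>x\<in>A. a x \<noteq> 0) \<and> (\<forall>e\<in>E. (\<Sum>x\<in>A. a x * M x e) = 0)"
  using assms
proof (induction E arbitrary: A M rule: finite_induct)
  case empty
  then obtain x where "x \<in> A" by fastforce
  then show ?case by (intro exI[of _ "\<lambda>_. 1"]) auto
next
  case (insert e E)
  show ?case
  proof (cases "\<forall>x\<in>A. M x e = 0")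
    case True
    have "card E < card A" using insert by simp
    from insert.IH[OF insert.prems(1) this, of M] obtain a where a: "\<exists>x\<in>A. a x \<noteq> 0" "\<forall>e\<in>E. (\<Sum>x\<in>A. a x * M x e) = 0"
      by (elim exE conjE)
    then show ?thesis using True by (intro exI[of _ a]) (auto intro!: sum.neutral)
  next
    case False
    then obtain x0 where x0: "x0 \<in> A" "M x0 e \<noteq> 0" by blast
    define M' where "M' x e' = M x e' - M x e / M x0 e * M x0 e'" for x e'
    have "finite (A - {x0})" "card E < card (A - {x0})" using insert x0 by auto
    from insert.IH[OF this, of M'] obtain a where a: "\<exists>x\<in>A - {x0}. a x \<noteq> 0" "\<forall>e\<in>E. (\<Sum>x\<in>A - {x0}. a x * M' x e) = 0"
      by (elim exE conjE)
    define b where "b = a(x0 := - (\<Sum>x\<in>A - {x0}. a x * M x e / M x0 e))"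
    have split: "(\<Sum>x\<in>A. b x * M x e') = (\<Sum>x\<in>A - {x0}. a x * M' x e')" for e'
    proof -
      have "(\<Sum>x\<in>A. b x * M x e') = b x0 * M x0 e' + (\<Sum>x\<in>A - {x0}. a x * M x e')"
        using insert.prems(1) x0(1) by (simp add: sum.remove[of A x0] b_def)
      also have "\<dots> = (\<Sum>x\<in>A - {x0}. a x * M' x e')"
        by (simp add: b_def M'_def sum_distrib_left sum_subtractf right_diff_distrib mult_ac)
      finally show ?thesis .
    qed
    have "(\<Sum>x\<in>A - {x0}. a x * M' x e) = 0" using x0 by (intro sum.neutral) (simp add: M'_def)
    then have "\<forall>e'\<in>insert e E. (\<Sum>x\<in>A. b x * M x e') = 0" using a(2) by (simp add: split)
    moreover have "\<exists>x\<in>A. b x \<noteq> 0" using a(1) by (auto simp: b_def)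
    ultimately show ?thesis by blast
  qed
qed

lemma exponent_box_card_eq: "card (exponent_box m K) = (K + 1) ^ m"
proof -
  let ?F = "PiE {1..m} (\<lambda>_. {..K})"
  have "inj_on (\<lambda>f i. if i \<in> {1..m} then f i else (0::nat)) ?F"
  proof (rule inj_onI)
    fix f g assume fg: "f \<in> ?F" "g \<in> ?F" "(\<lambda>i. if i \<in> {1..m} then f i else 0) = (\<lambda>i. if i \<in> {1..m} then g i else 0)"
    show "f = g"
    proof (rule PiE_ext[OF fg(1,2)])
      fix i assume "i \<in> {1..m}"
      then show "f i = g i" using fun_cong[OF fg(3), of i] by simp
    qed
  qed
  moreover have "(\<lambda>f i. if i \<in> {1..m} then f i else (0::nat)) ` ?F \<subseteq> exponent_box m K"
    by (auto simp: exponent_box_def PiE_iff)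
  ultimately have "card ?F \<le> card (exponent_box m K)" using exponent_box_card(1) by (rule card_inj_on_le)
  then show ?thesis using exponent_box_card(2)[of m K] by (simp add: card_PiE)
qed

text \<open>Dimension count: the \<open>m\<close> fractions and \<open>g\<close> have
  \<open>(K + 1) ^ (m + 1)\<close> monomials with exponents at most \<open>K\<close>, and after
  clearing denominators these lie in a space whose dimension grows only like
  \<open>K ^ m\<close>.\<close>

lemma algebraic_relation:
  assumes p: "\<forall>i\<in>{1..m}. p i \<in> poly_functions m" and q: "q \<in> poly_functions m" and g: "g \<in> poly_functions m"
  shows "\<exists>K a. (\<exists>k\<le>K. \<exists>e\<in>exponent_box m K. a k e \<noteq> 0) \<and>
    (\<forall>s. q s \<noteq> 0 \<longrightarrow> (\<Sum>k\<le>K. \<Sum>e\<in>exponent_box m K. a k e * g s ^ k * (\<Prod>i=1..m. (p i s / q s) ^ e i)) = 0)"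
proof -
  have "\<forall>i. \<exists>K. i \<in> {1..m} \<longrightarrow> p i \<in> poly_box m K" using p poly_functions_box by blast
  then obtain Kp where Kp: "\<And>i. i \<in> {1..m} \<Longrightarrow> p i \<in> poly_box m (Kp i)" by metis
  obtain Kq where Kq: "q \<in> poly_box m Kq" using poly_functions_box[OF q] by blast
  obtain Kg where Kg: "g \<in> poly_box m Kg" using poly_functions_box[OF g] by blast
  define d where "d = (\<Sum>i=1..m. Kp i) + Kq + Kg"
  have "Kp i \<le> d" if "i \<in> {1..m}" for i
    using member_le_sum[of i "{1..m}" Kp] that by (simp add: d_def)
  then have pd: "p i \<in> poly_box m d" if "i \<in> {1..m}" for i using Kp poly_box_mono that by blast
  have qd: "q \<in> poly_box m d" by (rule poly_box_mono[OF _ Kq]) (simp add: d_def)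
  have gd: "g \<in> poly_box m d" by (rule poly_box_mono[OF _ Kg]) (simp add: d_def)
  \<comment> \<open>In a cleared monomial, \<open>g\<close> and each of the \<open>m\<close>
    fractions raise the exponent of a parameter by at most \<open>K * d\<close>, hence by at most
    \<open>K * c\<close> together.\<close>
  define c where "c = d * (m + 1)"
  \<comment> \<open>Makes \<open>((c + 1) * (K + 1)) ^ m\<close> equal to
    \<open>K * (K + 1) ^ m\<close>, just below the number of unknowns.\<close>
  define K where "K = (c + 1) ^ m"
  define T where "T = (\<lambda>(k, e) s. g s ^ k * (\<Prod>i=1..m. p i s ^ e i * q s ^ (K - e i)))"
  define A where "A = {..K} \<times> exponent_box m K"
  have TB: "T x \<in> poly_box m (K * c)" if x: "x \<in> A" for x
  proof -
    obtain k e where ke: "x = (k, e)" "k \<le> K" "e \<in> exponent_box m K" using x by (auto simp: A_def)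
    have "(\<lambda>s. p i s ^ e i * q s ^ (K - e i)) \<in> poly_box m (K * d)" if i: "i \<in> {1..m}" for i
    proof -
      have "(\<lambda>s. p i s ^ e i * q s ^ (K - e i)) \<in> poly_box m (e i * d + (K - e i) * d)"
        by (intro poly_box_mult poly_box_power pd[OF i] qd)
      moreover have "e i * d + (K - e i) * d = K * d"
        using ke(3) i unfolding exponent_box_def distrib_right[symmetric] by simp
      ultimately show ?thesis by simp
    qed
    then have "(\<lambda>s. \<Prod>i=1..m. p i s ^ e i * q s ^ (K - e i)) \<in> poly_box m (\<Sum>i=1..m. K * d)"
      by (intro poly_box_prod) auto
    then have "T x \<in> poly_box m (k * d + (\<Sum>i=1..m. K * d))"
      unfolding ke(1) T_def prod.case by (intro poly_box_mult poly_box_power[OF gd])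
    moreover have "k * d + (\<Sum>i=1..m. K * d) \<le> K * c"
      using mult_right_mono[OF ke(2), of d] by (simp add: c_def algebra_simps)
    ultimately show ?thesis by (rule poly_box_mono[rotated])
  qed
  then have "\<forall>x. \<exists>M. x \<in> A \<longrightarrow> T x = (\<lambda>s. \<Sum>e\<in>exponent_box m (K * c). M e * monomial_fun m e s)"
    unfolding poly_box_def by blast
  from choice[OF this] obtain M where M: "\<forall>x. x \<in> A \<longrightarrow> T x = (\<lambda>s. \<Sum>e\<in>exponent_box m (K * c). M x e * monomial_fun m e s)"
    by (elim exE)
  have finA: "finite A" by (simp add: A_def exponent_box_card(1))
  have "card (exponent_box m (K * c)) \<le> (K * c + 1) ^ m" by (rule exponent_box_card(2))
  also have "\<dots> \<le> ((c + 1) * (K + 1)) ^ m" by (intro power_mono) auto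
  also have "\<dots> = K * (K + 1) ^ m" by (simp only: power_mult_distrib K_def[symmetric])
  also have "\<dots> < (K + 1) * (K + 1) ^ m" by simp
  also have "\<dots> = card A" by (simp add: A_def card_cartesian_product exponent_box_card_eq)
  finally have "card (exponent_box m (K * c)) < card A" .
  from homogeneous_system_solvable[OF exponent_box_card(1) finA this, of M]
  obtain a where a: "\<exists>x\<in>A. a x \<noteq> 0" "\<forall>e\<in>exponent_box m (K * c). (\<Sum>x\<in>A. a x * M x e) = 0"
    by (elim exE conjE)
  have zero: "(\<Sum>x\<in>A. a x * T x s) = 0" for s
  proof -
    have "(\<Sum>x\<in>A. a x * T x s) = (\<Sum>x\<in>A. \<Sum>e\<in>exponent_box m (K * c). a x * M x e * monomial_fun m e s)"
      by (intro sum.cong refl) (simp add: M sum_distrib_left mult.assoc)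
    also have "\<dots> = (\<Sum>e\<in>exponent_box m (K * c). (\<Sum>x\<in>A. a x * M x e) * monomial_fun m e s)"
      by (subst sum.swap) (simp add: sum_distrib_right)
    also have "\<dots> = 0" by (intro sum.neutral) (simp add: a(2))
    finally show ?thesis .
  qed
  have "(\<Sum>k\<le>K. \<Sum>e\<in>exponent_box m K. a (k, e) * g s ^ k * (\<Prod>i=1..m. (p i s / q s) ^ e i)) = 0" if s: "q s \<noteq> 0" for s
  proof -
    have "a (k, e) * g s ^ k * (\<Prod>i=1..m. (p i s / q s) ^ e i) = a (k, e) * T (k, e) s / (q s ^ K) ^ m"
      if e: "e \<in> exponent_box m K" for k e
    proof -
      have "(p i s / q s) ^ e i = p i s ^ e i * q s ^ (K - e i) / q s ^ K" if "i \<in> {1..m}" for i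
      proof -
        have "q s ^ K = q s ^ e i * q s ^ (K - e i)"
          using e that unfolding exponent_box_def power_add[symmetric] by simp
        then show ?thesis using s by (simp add: power_divide)
      qed
      then have "(\<Prod>i=1..m. (p i s / q s) ^ e i) = (\<Prod>i=1..m. p i s ^ e i * q s ^ (K - e i) / q s ^ K)"
        by (intro prod.cong refl)
      also have "\<dots> = (\<Prod>i=1..m. p i s ^ e i * q s ^ (K - e i)) / (q s ^ K) ^ m"
        by (simp add: prod_dividef)
      finally show ?thesis by (simp add: T_def)
    qed
    then have "(\<Sum>k\<le>K. \<Sum>e\<in>exponent_box m K. a (k, e) * g s ^ k * (\<Prod>i=1..m. (p i s / q s) ^ e i)) =
       (\<Sum>k\<le>K. \<Sum>e\<in>exponent_box m K. a (k, e) * T (k, e) s / (q s ^ K) ^ m)" by (intro sum.cong refl)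
    also have "\<dots> = (\<Sum>x\<in>A. a x * T x s) / (q s ^ K) ^ m"
      unfolding A_def sum.cartesian_product sum_divide_distrib by (intro sum.cong) auto
    finally show ?thesis by (simp add: zero)
  qed
  moreover have "\<exists>k\<le>K. \<exists>e\<in>exponent_box m K. a (k, e) \<noteq> 0" using a(1) by (auto simp: A_def)
  ultimately show ?thesis by (intro exI[of _ K] exI[of _ "\<lambda>k e. a (k, e)"]) simp
qed

text \<open>Linear independence of the exponents \<open>v\<close> gives different monomials in the
  \<open>f i\<close> different exponents, hence different weights, so that no cancellation occurs.
  In effect the \<open>f i\<close> are algebraically independent.\<close>

lemma independent_leading:
  assumes f: "\<forall>i\<in>{1..m}. leading m (f i) (v i)"
    and ind: "\<And>c :: nat \<Rightarrow> int. \<forall>i\<in>{1..m}. (\<Sum>j=1..m. c j * v j i) = 0 \<Longrightarrow> \<forall>j\<in>{1..m}. c j = 0"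
    and a: "e0 \<in> exponent_box m K" "a e0 \<noteq> 0"
  shows "\<exists>w. leading m (\<lambda>s. \<Sum>e\<in>exponent_box m K. a e * (\<Prod>i=1..m. f i s ^ e i)) w"
proof -
  define E where "E = {e \<in> exponent_box m K. a e \<noteq> 0}"
  define w where "w e i = (\<Sum>j=1..m. int (e j) * v j i)" for e :: "nat \<Rightarrow> nat" and i
  have fin: "finite E" "E \<noteq> {}" using a exponent_box_card(1)[of m K] by (auto simp: E_def)
  have "\<exists>e\<in>E. leading m (\<lambda>s. \<Sum>e\<in>E. a e * (\<Prod>i=1..m. f i s ^ e i)) (w e)"
  proof (rule leading_sum[OF fin])
    fix e assume e: "e \<in> E"
    have "leading m (\<lambda>s. \<Prod>j=1..m. f j s ^ e j) (\<lambda>i. \<Sum>j=1..m. int (e j) * v j i)"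
      by (intro leading_prod leading_power) (use f in auto)
    from leading_mult[OF leading_const this, of "a e"] e
    show "leading m (\<lambda>s. a e * (\<Prod>i=1..m. f i s ^ e i)) (w e)" by (simp add: E_def w_def[abs_def])
  next
    fix e e' assume e: "e \<in> E" "e' \<in> E" "weight m (w e) = weight m (w e')"
    have "weight m (\<lambda>i. w e i - w e' i) = 0"
      using e(3) unfolding weight_def by (simp add: left_diff_distrib sum_subtractf)
    then have "w e i - w e' i = 0" if "i \<in> {1..m}" for i using weight_eq_0[of m "\<lambda>i. w e i - w e' i"] that by blast
    then have "(\<Sum>j=1..m. (int (e j) - int (e' j)) * v j i) = 0" if "i \<in> {1..m}" for i
      using that by (simp add: w_def left_diff_distrib sum_subtractf)
    then have *: "\<forall>j\<in>{1..m}. int (e j) - int (e' j) = 0" using ind[of "\<lambda>j. int (e j) - int (e' j)"] by blast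
    show "e = e'"
    proof
      fix i show "e i = e' i"
        using * e(1,2) by (cases "i \<in> {1..m}") (auto simp: E_def exponent_box_def)
    qed
  qed
  moreover have "(\<lambda>s. \<Sum>e\<in>E. a e * (\<Prod>i=1..m. f i s ^ e i)) = (\<lambda>s. \<Sum>e\<in>exponent_box m K. a e * (\<Prod>i=1..m. f i s ^ e i))"
    unfolding E_def by (intro ext sum.mono_neutral_left exponent_box_card) auto
  ultimately show ?thesis by auto
qed

lemma poly_functions_compose:
  assumes "p \<in> poly_functions m" "fun_algebra P" "\<And>i. i \<in> {1..m} \<Longrightarrow> (\<lambda>x. c x i) \<in> P"
  shows "(\<lambda>x. p (c x)) \<in> P"
  using assms(1)
  by (induction) (auto intro: fa_const[OF assms(2)] fa_add[OF assms(2)] fa_mult[OF assms(2)] assms(3))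

text \<open>Turns an asymptotic statement into nonvanishing on a Zariski open set; the witness is
  the numerator times the denominator.\<close>

lemma rational_nonvanishing:
  assumes "rational_fun m f" "leading m f v"
  shows "\<exists>n\<in>poly_functions m. (\<exists>s. n s \<noteq> 0) \<and> (\<forall>s. n s \<noteq> 0 \<longrightarrow> f s \<noteq> 0)"
proof -
  obtain p q s where *: "p \<in> poly_functions m" "q \<in> poly_functions m" "q s \<noteq> 0"
    "\<And>s. q s \<noteq> 0 \<Longrightarrow> f s = p s / q s"
    using assms(1) unfolding rational_fun_def by blast
  have "eventually (\<lambda>(r, t). f (spiral (\<lambda>_. 0) r t) \<noteq> 0 \<and> q (spiral (\<lambda>_. 0) r t) \<noteq> 0) strip"
    using leading_nonzero[OF assms(2), of "\<lambda>_. 0"] poly_nonzero_eventually[OF *(2,3), of "\<lambda>_. 0"]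
    by eventually_elim auto
  from eventually_happens'[OF strip_nontrivial this]
  obtain z where "f z \<noteq> 0" "q z \<noteq> 0" by (auto split: prod.splits)
  then show ?thesis using *
    by (intro bexI[of _ "\<lambda>s. p s * q s"] poly_functions.mult) auto
qed

lemma common_denominator:
  assumes "\<forall>i\<in>{1..m}. rational_fun m (f i)"
  shows "\<exists>p q. (\<forall>i\<in>{1..m}. p i \<in> poly_functions m) \<and> q \<in> poly_functions m \<and> (\<exists>s. q s \<noteq> 0) \<and>
    (\<forall>s. q s \<noteq> 0 \<longrightarrow> (\<forall>i\<in>{1..m}. f i s = p i s / q s))"
proof -
  have "\<forall>i. \<exists>pq. i \<in> {1..m} \<longrightarrow> fst pq \<in> poly_functions m \<and> snd pq \<in> poly_functions m \<and> (\<exists>s. snd pq s \<noteq> 0) \<and>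
    (\<forall>s. snd pq s \<noteq> 0 \<longrightarrow> f i s = fst pq s / snd pq s)"
    using assms unfolding rational_fun_def by (metis fst_conv snd_conv)
  from choice[OF this] obtain pq where pq: "\<forall>i. i \<in> {1..m} \<longrightarrow> fst (pq i) \<in> poly_functions m \<and> snd (pq i) \<in> poly_functions m \<and>
    (\<exists>s. snd (pq i) s \<noteq> 0) \<and> (\<forall>s. snd (pq i) s \<noteq> 0 \<longrightarrow> f i s = fst (pq i) s / snd (pq i) s)"
    by (elim exE)
  define q where "q s = (\<Prod>i=1..m. snd (pq i) s)" for s
  define p where "p i s = fst (pq i) s * (\<Prod>j\<in>{1..m} - {i}. snd (pq j) s)" for i s
  have q: "q \<in> poly_functions m"
    unfolding q_def[abs_def] using pq by (intro fa_prod[OF fun_algebra_poly_functions]) auto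
  have p: "p i \<in> poly_functions m" if "i \<in> {1..m}" for i
    unfolding p_def[abs_def] using pq that
    by (intro fa_prod[OF fun_algebra_poly_functions] fa_mult[OF fun_algebra_poly_functions]) auto
  have "\<exists>s. (\<Prod>i\<in>I. snd (pq i) s) \<noteq> 0" if "I \<subseteq> {1..m}" for I
  proof -
    have "finite I" using that finite_subset by blast
    then show ?thesis using that
    proof (induction I rule: finite_induct)
      case (insert i I)
      then obtain s s' where *: "snd (pq i) s \<noteq> 0" "(\<Prod>i\<in>I. snd (pq i) s') \<noteq> 0" using pq by blast
      have "(\<lambda>s. \<Prod>i\<in>I. snd (pq i) s) \<in> poly_functions m"
        using insert.prems pq by (intro fa_prod[OF fun_algebra_poly_functions]) auto
      from poly_mult_nonzero[of "snd (pq i)" m s "\<lambda>s. \<Prod>i\<in>I. snd (pq i) s" s', OF _ *(1) this *(2)]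
      obtain z where "snd (pq i) z * (\<Prod>i\<in>I. snd (pq i) z) \<noteq> 0" using pq insert.prems by auto
      then show ?case using insert.hyps by (intro exI[of _ z]) simp
    qed simp
  qed
  from this[of "{1..m}"] have nz: "\<exists>s. q s \<noteq> 0" unfolding q_def by simp
  have "f i s = p i s / q s" if s: "q s \<noteq> 0" and i: "i \<in> {1..m}" for i s
  proof -
    have "q s = snd (pq i) s * (\<Prod>j\<in>{1..m} - {i}. snd (pq j) s)"
      unfolding q_def using i by (subst prod.remove[of _ i]) auto
    then show ?thesis using s pq i by (simp add: p_def)
  qed
  then show ?thesis using p q nz by (intro exI[of _ p] exI[of _ q]) auto
qed

lemma range_poly_finite_zeros:
  fixes f :: "complex \<Rightarrow> complex"
  assumes "f \<in> range poly" "f a \<noteq> 0"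
  shows "finite {x. f x = 0}"
proof -
  obtain P where "f = poly P" using assms(1) by blast
  moreover from this have "P \<noteq> 0" using assms(2) by auto
  ultimately show ?thesis using poly_roots_finite by auto
qed

text \<open>
  The chain of irreducible closed sets consists of the closures of the images of the affine subspaces
  obtained by fixing the first \<open>j\<close> coordinates at a generic point; a coordinate is algebraic over
  the given functions, so fixing it cuts down the closure of the image.
\<close>
lemma krull_dim_ge:
  fixes \<phi> :: "(nat \<Rightarrow> complex) \<Rightarrow> 'b" and T :: "'b topology"
  assumes H: "H \<in> poly_functions m" "H a0 \<noteq> 0"
    and top: "\<And>s. H s \<noteq> 0 \<Longrightarrow> \<phi> s \<in> V"
    and cont: "\<And>U s. openin T U \<Longrightarrow> H s \<noteq> 0 \<Longrightarrow> \<phi> s \<in> U \<Longrightarrow>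
       \<exists>h\<in>poly_functions m. h s \<noteq> 0 \<and> (\<forall>s'. h s' \<noteq> 0 \<longrightarrow> H s' \<noteq> 0 \<longrightarrow> \<phi> s' \<in> U)"
    and V: "V \<subseteq> topspace T"
    and F: "fun_algebra F" "\<And>g. g \<in> F \<Longrightarrow> openin T {y \<in> V. g y \<noteq> 0}" "\<And>g. g \<in> F \<Longrightarrow> rational_fun m (\<lambda>s. g (\<phi> s))"
    and G: "\<forall>i\<in>{1..m}. G i \<in> F" "\<forall>i\<in>{1..m}. leading m (\<lambda>s. G i (\<phi> s)) (v i)"
    and ind: "\<And>c :: nat \<Rightarrow> int. \<forall>i\<in>{1..m}. (\<Sum>j=1..m. c j * v j i) = 0 \<Longrightarrow> \<forall>j\<in>{1..m}. c j = 0"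
  shows "enat m \<le> krull_dim T"
proof -
  have "\<forall>i\<in>{1..m}. rational_fun m (\<lambda>s. G i (\<phi> s))" using F(3) G(1) by blast
  from common_denominator[OF this] obtain p q z0 where p: "\<forall>i\<in>{1..m}. p i \<in> poly_functions m"
    and q: "q \<in> poly_functions m" "q z0 \<noteq> 0" and pq: "\<forall>s. q s \<noteq> 0 \<longrightarrow> (\<forall>i\<in>{1..m}. G i (\<phi> s) = p i s / q s)"
    by (elim exE conjE)
  \<comment> \<open>The relation between coordinate \<open>j\<close> and the \<open>G i\<close> is
    read as a polynomial in \<open>s j\<close> with coefficients in \<open>F\<close>. Independence
    of the leading exponents keeps some coefficient from vanishing identically on the image.\<close>
  have rel: "\<exists>K P. (\<forall>k. P k \<in> F) \<and> (\<forall>s. q s \<noteq> 0 \<longrightarrow> (\<Sum>k\<le>K. P k (\<phi> s) * s j ^ k) = 0) \<and>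
      (\<exists>k\<le>K. \<exists>n\<in>poly_functions m. (\<exists>s. n s \<noteq> 0) \<and> (\<forall>s. n s \<noteq> 0 \<longrightarrow> P k (\<phi> s) \<noteq> 0))"
    if j: "j \<in> {1..m}" for j
  proof -
    from algebraic_relation[OF p q(1) poly_functions.coord[OF j]]
    obtain K a k0 e0 where ke: "k0 \<le> K" "e0 \<in> exponent_box m K" "a k0 e0 \<noteq> 0"
      and r: "\<forall>s. q s \<noteq> 0 \<longrightarrow> (\<Sum>k\<le>K. \<Sum>e\<in>exponent_box m K. a k e * s j ^ k * (\<Prod>i=1..m. (p i s / q s) ^ e i)) = 0"
      by (elim exE conjE bexE)
    define P where "P k y = (\<Sum>e\<in>exponent_box m K. a k e * (\<Prod>i=1..m. G i y ^ e i))" for k y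
    have PF: "P k \<in> F" for k
      unfolding P_def[abs_def] using G(1)
      by (intro fa_sum[OF F(1)] fa_mult[OF F(1)] fa_prod[OF F(1)] fa_power[OF F(1)] fa_const[OF F(1)]) auto
    have "(\<Sum>k\<le>K. P k (\<phi> s) * s j ^ k) = 0" if s: "q s \<noteq> 0" for s
    proof -
      have "P k (\<phi> s) * s j ^ k = (\<Sum>e\<in>exponent_box m K. a k e * s j ^ k * (\<Prod>i=1..m. (p i s / q s) ^ e i))" for k
      proof -
        have "(\<Prod>i=1..m. G i (\<phi> s) ^ e i) = (\<Prod>i=1..m. (p i s / q s) ^ e i)" for e
          using pq s by (intro prod.cong refl) simp
        then show ?thesis by (simp add: P_def sum_distrib_left mult_ac)
      qed
      then show ?thesis using r s by simp
    qed
    moreover have "\<exists>w. leading m (\<lambda>s. \<Sum>e\<in>exponent_box m K. a k0 e * (\<Prod>i=1..m. G i (\<phi> s) ^ e i)) w"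
      by (rule independent_leading[where f = "\<lambda>i s. G i (\<phi> s)" and a = "a k0", OF G(2) ind ke(2,3)])
    then obtain w where "leading m (\<lambda>s. P k0 (\<phi> s)) w" unfolding P_def by (elim exE)
    then have "\<exists>n\<in>poly_functions m. (\<exists>s. n s \<noteq> 0) \<and> (\<forall>s. n s \<noteq> 0 \<longrightarrow> P k0 (\<phi> s) \<noteq> 0)"
      using rational_nonvanishing[OF F(3)[OF PF]] by blast
    ultimately show ?thesis using PF ke(1) by (intro exI[of _ K] exI[of _ P]) blast
  qed
  define good where "good j KPn \<longleftrightarrow> (\<forall>k. fst (snd KPn) k \<in> F) \<and> (\<forall>s. q s \<noteq> 0 \<longrightarrow> (\<Sum>k\<le>fst KPn. fst (snd KPn) k (\<phi> s) * s j ^ k) = 0) \<and>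
      (\<exists>k\<le>fst KPn. snd (snd KPn) \<in> poly_functions m \<and> (\<exists>s. snd (snd KPn) s \<noteq> 0) \<and> (\<forall>s. snd (snd KPn) s \<noteq> 0 \<longrightarrow> fst (snd KPn) k (\<phi> s) \<noteq> 0))"
    for j and KPn :: "nat \<times> (nat \<Rightarrow> 'b \<Rightarrow> complex) \<times> ((nat \<Rightarrow> complex) \<Rightarrow> complex)"
  have "\<forall>j. \<exists>KPn. j \<in> {1..m} \<longrightarrow> good j KPn"
  proof
    fix j
    show "\<exists>KPn. j \<in> {1..m} \<longrightarrow> good j KPn"
    proof (cases "j \<in> {1..m}")
      case True
      from rel[OF True] obtain K P k n z where "\<forall>k. P k \<in> F" "\<forall>s. q s \<noteq> 0 \<longrightarrow> (\<Sum>k\<le>K. P k (\<phi> s) * s j ^ k) = 0"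
        "k \<le> K" "n \<in> poly_functions m" "n z \<noteq> 0" "\<forall>s. n s \<noteq> 0 \<longrightarrow> P k (\<phi> s) \<noteq> 0"
        by (elim exE conjE bexE)
      then have "good j (K, P, n)" unfolding good_def fst_conv snd_conv by (intro conjI exI[of _ k] exI[of _ z])
      then show ?thesis by blast
    qed blast
  qed
  from choice[OF this] obtain KPn where KPn: "\<forall>j. j \<in> {1..m} \<longrightarrow> good j (KPn j)" by (elim exE)
  define K where "K j = fst (KPn j)" for j
  define P where "P j = fst (snd (KPn j))" for j
  define nn where "nn j = snd (snd (KPn j))" for j
  have PF: "P j k \<in> F" if "j \<in> {1..m}" for j k
    using KPn that unfolding good_def P_def by blast
  have Prel: "(\<Sum>k\<le>K j. P j k (\<phi> s) * s j ^ k) = 0" if "j \<in> {1..m}" "q s \<noteq> 0" for j s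
    using KPn that unfolding good_def P_def K_def by blast
  have nn: "nn j \<in> poly_functions m" "\<exists>s. nn j s \<noteq> 0" if "j \<in> {1..m}" for j
    using KPn that unfolding good_def nn_def by blast+
  have Pnz: "\<exists>k\<le>K j. P j k (\<phi> s) \<noteq> 0" if "j \<in> {1..m}" "nn j s \<noteq> 0" for j s
    using KPn that unfolding good_def P_def K_def nn_def by blast
  have "\<exists>H'\<in>poly_functions m. (\<exists>s. H' s \<noteq> 0) \<and> (\<forall>s. H' s \<noteq> 0 \<longrightarrow> H s \<noteq> 0 \<and> q s \<noteq> 0 \<and> (\<forall>j\<in>J. nn j s \<noteq> 0))"
    if "J \<subseteq> {1..m}" for J
  proof -
    have "finite J" using that finite_subset by blast
    then show ?thesis using that
    proof (induction J rule: finite_induct)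
      case empty
      from poly_mult_nonzero[OF H q] obtain z where "H z * q z \<noteq> 0" by (elim exE)
      then show ?case
        by (intro bexI[of _ "\<lambda>s. H s * q s"] poly_functions.mult H q) auto
    next
      case (insert j J)
      then obtain H' z where H': "H' \<in> poly_functions m" "H' z \<noteq> 0"
        "\<forall>s. H' s \<noteq> 0 \<longrightarrow> H s \<noteq> 0 \<and> q s \<noteq> 0 \<and> (\<forall>j\<in>J. nn j s \<noteq> 0)" by blast
      obtain z' where z': "nn j z' \<noteq> 0" using nn(2)[of j] insert.prems by blast
      have njp: "nn j \<in> poly_functions m" using nn(1)[of j] insert.prems by blast
      from poly_mult_nonzero[OF H'(1,2) njp z'] obtain z where "H' z * nn j z \<noteq> 0" by blast
      then show ?case using H'(3)
        by (intro bexI[of _ "\<lambda>s. H' s * nn j s"] poly_functions.mult H'(1) njp) auto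
    qed
  qed
  from this[of "{1..m}"] obtain H' e where H': "H' \<in> poly_functions m" "H' e \<noteq> 0"
    and H'H: "\<And>s. H' s \<noteq> 0 \<Longrightarrow> H s \<noteq> 0" and H'q: "\<And>s. H' s \<noteq> 0 \<Longrightarrow> q s \<noteq> 0"
    and H'n: "\<And>s j. H' s \<noteq> 0 \<Longrightarrow> j \<in> {1..m} \<Longrightarrow> nn j s \<noteq> 0" by blast
  \<comment> \<open>The relation with coordinate \<open>j\<close> frozen at \<open>c\<close>: it
    vanishes at \<open>\<phi> s\<close> whenever \<open>s j = c\<close> and
    \<open>q s \<noteq> 0\<close>.\<close>
  define Q where "Q j c y = (\<Sum>k\<le>K j. P j k y * c ^ k)" for j c y
  have QF: "Q j c \<in> F" if "j \<in> {1..m}" for j c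
    unfolding Q_def[abs_def] using PF[OF that]
    by (intro fa_sum[OF F(1)] fa_mult[OF F(1)] fa_const[OF F(1)])
  have step: "\<exists>c. H' (s(j := c)) \<noteq> 0 \<and> Q j c (\<phi> s) \<noteq> 0" if s: "H' s \<noteq> 0" and j: "j \<in> {1..m}" for s j
  proof -
    have "(\<lambda>c. H' (s(j := c))) \<in> range poly"
    proof (rule poly_functions_compose[OF H'(1) fun_algebra_range_poly])
      fix i
      have "(\<lambda>x. x) = poly [:0, 1::complex:]" by auto
      then have "(\<lambda>x::complex. x) \<in> range poly" by (rule image_eqI) simp
      then show "(\<lambda>x. (s(j := x)) i) \<in> range poly"
        by (cases "i = j") (auto intro: fa_const[OF fun_algebra_range_poly])
    qed
    from range_poly_finite_zeros[OF this, of "s j"] have f1: "finite {c. H' (s(j := c)) = 0}" using s by simp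
    define R where "R = (\<Sum>k\<le>K j. Polynomial.monom (P j k (\<phi> s)) k)"
    have R: "poly R c = Q j c (\<phi> s)" for c by (simp add: R_def Q_def poly_sum poly_monom)
    obtain k where k: "k \<le> K j" "P j k (\<phi> s) \<noteq> 0" using Pnz[OF j H'n[OF s j]] by blast
    have "Polynomial.coeff R k \<noteq> 0" using k by (simp add: R_def coeff_sum)
    then have "R \<noteq> 0" by auto
    then have f2: "finite {c. Q j c (\<phi> s) = 0}" using poly_roots_finite[of R] by (simp add: R)
    have "infinite (UNIV :: complex set)" by (rule infinite_UNIV_char_0)
    from ex_new_if_finite[OF this finite_UnI[OF f1 f2]] show ?thesis by blast
  qed
  define x where "x = rec_nat e (\<lambda>j s. s(Suc j := (SOME c. H' (s(Suc j := c)) \<noteq> 0 \<and> Q (Suc j) c (\<phi> s) \<noteq> 0)))"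
  have x0: "x 0 = e" by (simp add: x_def)
  have xS: "x (Suc j) = (x j)(Suc j := (SOME c. H' ((x j)(Suc j := c)) \<noteq> 0 \<and> Q (Suc j) c (\<phi> (x j)) \<noteq> 0))" for j
    by (simp add: x_def)
  have xH: "H' (x j) \<noteq> 0" if "j \<le> m" for j
    using that
  proof (induction j)
    case 0
    then show ?case using x0 H' by simp
  next
    case (Suc j)
    then have "H' (x j) \<noteq> 0" "Suc j \<in> {1..m}" by auto
    from someI_ex[OF step[OF this]] show ?case unfolding xS by (rule conjunct1)
  qed
  have xQ: "Q (Suc j) (x (Suc j) (Suc j)) (\<phi> (x j)) \<noteq> 0" if "Suc j \<le> m" for j
  proof -
    have "H' (x j) \<noteq> 0" "Suc j \<in> {1..m}" using that xH by auto
    from someI_ex[OF step[OF this]] show ?thesis by (simp add: xS)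
  qed
  have xeq: "x j i = x i i" if "i \<le> j" for i j
    using that by (induction j) (auto simp: xS le_Suc_eq)
  define y where "y i = x i i" for i
  define S where "S j = {s. H' s \<noteq> 0 \<and> (\<forall>i\<in>{1..j}. s i = y i)}" for j
  define Zc where "Zc j = T closure_of (\<phi> ` S j)" for j
  have xS': "x j \<in> S j" if "j \<le> m" for j
    unfolding S_def y_def
    by (intro CollectI conjI ballI xH[OF that] xeq) simp
  have imV: "\<phi> ` S j \<subseteq> V" for j using top H'H by (auto simp: S_def)
  then have imT: "\<phi> ` S j \<subseteq> topspace T" for j using V by blast
  have inZ: "\<phi> s \<in> Zc j" if "s \<in> S j" for s j
    unfolding Zc_def using closure_of_subset[OF imT[of j]] that by blast
  have irr: "irreducible_in T (Zc j)" if j: "j \<le> m" for j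
    unfolding irreducible_in_def
  proof (intro conjI allI impI)
    show "Zc j \<subseteq> topspace T" unfolding Zc_def by (rule closure_of_subset_topspace)
    show "Zc j \<noteq> {}" using inZ[OF xS'[OF j]] by blast
    fix A B assume AB: "closedin T A \<and> closedin T B \<and> Zc j \<subseteq> A \<union> B"
    show "Zc j \<subseteq> A \<or> Zc j \<subseteq> B"
    proof (rule ccontr)
      assume "\<not> ?thesis"
      then have "\<not> \<phi> ` S j \<subseteq> A" "\<not> \<phi> ` S j \<subseteq> B"
        using AB closure_of_minimal[of "\<phi> ` S j" _ T] unfolding Zc_def by blast+
      then obtain s s' where s: "s \<in> S j" "\<phi> s \<notin> A" "s' \<in> S j" "\<phi> s' \<notin> B" by blast
      have oA: "openin T (topspace T - A)" and oB: "openin T (topspace T - B)" using AB by auto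
      have "\<phi> s \<in> topspace T - A" "H s \<noteq> 0" using s imT H'H by (auto simp: S_def)
      from cont[OF oA this(2,1)] obtain h where h: "h \<in> poly_functions m" "h s \<noteq> 0"
        "\<And>s'. h s' \<noteq> 0 \<Longrightarrow> H s' \<noteq> 0 \<Longrightarrow> \<phi> s' \<in> topspace T - A" by blast
      have "\<phi> s' \<in> topspace T - B" "H s' \<noteq> 0" using s imT H'H by (auto simp: S_def)
      from cont[OF oB this(2,1)] obtain h' where h': "h' \<in> poly_functions m" "h' s' \<noteq> 0"
        "\<And>s'. h' s' \<noteq> 0 \<Longrightarrow> H s' \<noteq> 0 \<Longrightarrow> \<phi> s' \<in> topspace T - B" by blast
      \<comment> \<open>The complex line through \<open>s\<close> and \<open>s'\<close> stays in the
        affine subspace and leaves each of the three nonvanishing loci at finitely many points only,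
        so both open sets are met at once.\<close>
      define l where "l c i = s i + c * (s' i - s i)" for c i
      have l01: "l 0 = s" "l 1 = s'" by (auto simp: l_def)
      have lp: "(\<lambda>c. f (l c)) \<in> range poly" if "f \<in> poly_functions m" for f
      proof (rule poly_functions_compose[OF that fun_algebra_range_poly])
        fix i
        have "(\<lambda>x. l x i) = poly [:s i, s' i - s i:]" by (auto simp: l_def)
        then show "(\<lambda>x. l x i) \<in> range poly" by (rule image_eqI) simp
      qed
      have "finite ({c. h (l c) = 0} \<union> {c. h' (l c) = 0} \<union> {c. H' (l c) = 0})"
        using range_poly_finite_zeros[OF lp[OF h(1)], of 0] range_poly_finite_zeros[OF lp[OF h'(1)], of 1]
          range_poly_finite_zeros[OF lp[OF H'(1)], of 0] h(2) h'(2) s(1) by (simp add: l01 S_def)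
      from ex_new_if_finite[OF infinite_UNIV_char_0 this]
      obtain c where c: "h (l c) \<noteq> 0" "h' (l c) \<noteq> 0" "H' (l c) \<noteq> 0" by blast
      have "l c \<in> S j" using s c(3) by (simp add: S_def l_def)
      then have "\<phi> (l c) \<in> A \<union> B" using inZ AB by blast
      then show False using h(3) h'(3) c H'H by blast
    qed
  qed
  have mono: "Zc (Suc j) \<subseteq> Zc j" for j
    unfolding Zc_def by (intro closure_of_mono image_mono) (auto simp: S_def)
  have strict: "Zc (Suc j) \<subset> Zc j" if j: "Suc j \<le> m" for j
  proof -
    have j1: "Suc j \<in> {1..m}" using j by simp
    let ?U = "{z \<in> V. Q (Suc j) (y (Suc j)) z \<noteq> 0}"
    have "openin T ?U" by (rule F(2)[OF QF[OF j1]])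
    moreover have "\<phi> ` S (Suc j) \<subseteq> topspace T - ?U"
    proof
      fix z assume "z \<in> \<phi> ` S (Suc j)"
      then obtain s where s: "s \<in> S (Suc j)" "z = \<phi> s" by blast
      have "s (Suc j) = y (Suc j)" "q s \<noteq> 0" using s(1) H'q by (auto simp: S_def)
      then have "Q (Suc j) (y (Suc j)) z = 0" using Prel[OF j1, of s] by (simp add: Q_def s(2))
      then show "z \<in> topspace T - ?U" using imT s by blast
    qed
    ultimately have "Zc (Suc j) \<subseteq> topspace T - ?U"
      unfolding Zc_def by (intro closure_of_minimal) auto
    moreover have "\<phi> (x j) \<in> Zc j" using inZ[OF xS'] j by simp
    moreover have "\<phi> (x j) \<in> ?U" using xQ[OF j] imV[of j] xS'[of j] j by (auto simp: y_def)
    ultimately show ?thesis using mono[of j] by blast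
  qed
  \<comment> \<open>Fixing more coordinates gives smaller sets, so the chain is listed
    backwards.\<close>
  have "enat m \<in> {enat k | k Z. (\<forall>i\<le>k. closedin T (Z i) \<and> irreducible_in T (Z i)) \<and> (\<forall>i<k. Z i \<subset> Z (Suc i))}"
  proof (intro CollectI exI[of _ m] exI[of _ "\<lambda>i. Zc (m - i)"] conjI refl allI impI)
    fix i assume "i \<le> m"
    show "closedin T (Zc (m - i))" by (simp add: Zc_def)
    show "irreducible_in T (Zc (m - i))" by (rule irr) simp
  next
    fix i assume i: "i < m"
    have "m - i = Suc (m - Suc i)" using i by simp
    then show "Zc (m - i) \<subset> Zc (m - Suc i)" using strict[of "m - Suc i"] i by simp
  qed
  then show ?thesis unfolding krull_dim_def by (rule Sup_upper)
qed

section \<open>Spaces with functions presented by an algebra\<close>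

definition local_fraction :: "('a \<Rightarrow> complex) set \<Rightarrow> 'a set \<Rightarrow> 'a \<Rightarrow> ('a \<Rightarrow> complex) \<Rightarrow> bool" where
  "local_fraction P S p f \<longleftrightarrow> (\<exists>a\<in>P. \<exists>b\<in>P. b p \<noteq> 0 \<and> (\<forall>q\<in>S. b q \<noteq> 0 \<longrightarrow> f q = a q / b q))"

lemma local_fractionI:
  "a \<in> P \<Longrightarrow> b \<in> P \<Longrightarrow> b p \<noteq> 0 \<Longrightarrow> (\<And>q. q \<in> S \<Longrightarrow> b q \<noteq> 0 \<Longrightarrow> f q = a q / b q) \<Longrightarrow> local_fraction P S p f"
  unfolding local_fraction_def by (intro bexI conjI ballI impI)

lemma local_fractionE:
  assumes "local_fraction P S p f"
  obtains a b where "a \<in> P" "b \<in> P" "b p \<noteq> 0" "\<forall>q\<in>S. b q \<noteq> 0 \<longrightarrow> f q = a q / b q"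
  using assms unfolding local_fraction_def by (elim bexE conjE)

lemma fun_algebra_local_fraction:
  assumes P: "fun_algebra P"
  shows "fun_algebra {f. local_fraction P S p f}"
proof (rule fun_algebraI)
  fix c show "(\<lambda>_. c) \<in> {f. local_fraction P S p f}"
    by (intro CollectI local_fractionI[of "\<lambda>_. c" P "\<lambda>_. 1"] fa_const[OF P]) auto
next
  fix f g assume "f \<in> {f. local_fraction P S p f}" "g \<in> {f. local_fraction P S p f}"
  then have "local_fraction P S p f" "local_fraction P S p g" by auto
  then obtain a b a' b' where *: "a \<in> P" "b \<in> P" "b p \<noteq> 0" "\<forall>q\<in>S. b q \<noteq> 0 \<longrightarrow> f q = a q / b q"
    "a' \<in> P" "b' \<in> P" "b' p \<noteq> 0" "\<forall>q\<in>S. b' q \<noteq> 0 \<longrightarrow> g q = a' q / b' q"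
    by (elim local_fractionE)
  show "(\<lambda>x. f x + g x) \<in> {f. local_fraction P S p f}"
  proof (intro CollectI local_fractionI[of "\<lambda>x. a x * b' x + a' x * b x" P "\<lambda>x. b x * b' x"])
    show "(\<lambda>x. a x * b' x + a' x * b x) \<in> P" by (intro fa_add[OF P] fa_mult[OF P] *)
    show "(\<lambda>x. b x * b' x) \<in> P" by (intro fa_mult[OF P] *)
  qed (use * in \<open>auto simp: field_simps\<close>)
  show "(\<lambda>x. f x * g x) \<in> {f. local_fraction P S p f}"
  proof (intro CollectI local_fractionI[of "\<lambda>x. a x * a' x" P "\<lambda>x. b x * b' x"])
    show "(\<lambda>x. a x * a' x) \<in> P" by (intro fa_mult[OF P] *)
    show "(\<lambda>x. b x * b' x) \<in> P" by (intro fa_mult[OF P] *)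
  qed (use * in auto)
qed

text \<open>An upper bound on the topology and the sheaf: open sets contain nonvanishing loci of
  elements of \<open>P\<close> around each of their points, and regular functions are locally
  fractions from \<open>P\<close>. The property passes to subspaces and products, so
  \<open>disc_variety n\<close> and its product with the line get explicit algebras.\<close>

definition presented_by :: "'a fspace \<Rightarrow> ('a \<Rightarrow> complex) set \<Rightarrow> bool" where
  "presented_by X P \<longleftrightarrow> fun_algebra P \<and>
     (\<forall>U p. openin (zar X) U \<longrightarrow> p \<in> U \<longrightarrow> (\<exists>h\<in>P. h p \<noteq> 0 \<and> (\<forall>q\<in>points X. h q \<noteq> 0 \<longrightarrow> q \<in> U))) \<and>
     (\<forall>U f p. openin (zar X) U \<longrightarrow> f \<in> reg X U \<longrightarrow> p \<in> U \<longrightarrow> local_fraction P U p f)"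

lemma presented_byD:
  assumes "presented_by X P"
  shows "fun_algebra P"
    "\<And>U p. openin (zar X) U \<Longrightarrow> p \<in> U \<Longrightarrow> \<exists>h\<in>P. h p \<noteq> 0 \<and> (\<forall>q\<in>points X. h q \<noteq> 0 \<longrightarrow> q \<in> U)"
    "\<And>U f p. openin (zar X) U \<Longrightarrow> f \<in> reg X U \<Longrightarrow> p \<in> U \<Longrightarrow> local_fraction P U p f"
  using assms unfolding presented_by_def by blast+

text \<open>Intersections correspond to products of functions, so it suffices to treat a
  subbasis.\<close>

lemma generated_topology_nonvanishing:
  assumes P: "fun_algebra P"
    and basis: "\<And>B p. B \<in> \<B> \<Longrightarrow> p \<in> B \<Longrightarrow> \<exists>h\<in>P. h p \<noteq> 0 \<and> (\<forall>q\<in>S. h q \<noteq> 0 \<longrightarrow> q \<in> B)"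
    and U: "openin (topology_generated_by \<B>) U" "p \<in> U"
  shows "\<exists>h\<in>P. h p \<noteq> 0 \<and> (\<forall>q\<in>S. h q \<noteq> 0 \<longrightarrow> q \<in> U)"
proof -
  from U(1) have "generate_topology_on \<B> U" by (simp add: openin_topology_generated_by_iff)
  then show ?thesis using U(2)
  proof (induction arbitrary: p)
    case (Int A B)
    obtain h where h: "h \<in> P" "h p \<noteq> 0" "\<forall>q\<in>S. h q \<noteq> 0 \<longrightarrow> q \<in> A" using Int.IH(1)[of p] Int.prems by blast
    obtain h' where h': "h' \<in> P" "h' p \<noteq> 0" "\<forall>q\<in>S. h' q \<noteq> 0 \<longrightarrow> q \<in> B" using Int.IH(2)[of p] Int.prems by blast
    show ?case
      by (rule bexI[of _ "\<lambda>q. h q * h' q"]) (use h h' fa_mult[OF P] in auto)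
  next
    case (UN \<U>)
    then obtain A where A: "A \<in> \<U>" "p \<in> A" by blast
    from UN.IH[OF A] obtain h where h: "h \<in> P" "h p \<noteq> 0" "\<forall>q\<in>S. h q \<noteq> 0 \<longrightarrow> q \<in> A" by blast
    then show ?case using A(1) by (intro bexI[of _ h]) auto
  next
    case (Basis B)
    then show ?case using basis by blast
  qed simp
qed

lemma presented_alg_space:
  assumes P: "fun_algebra P"
  shows "presented_by (alg_space S P) P"
  unfolding presented_by_def
proof (intro conjI allI impI P)
  fix U p assume U: "openin (zar (alg_space S P)) U" "p \<in> U"
  show "\<exists>h\<in>P. h p \<noteq> 0 \<and> (\<forall>q\<in>points (alg_space S P). h q \<noteq> 0 \<longrightarrow> q \<in> U)"
    unfolding points_alg_space[OF fa_const[OF P, of 1]]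
  proof (rule generated_topology_nonvanishing[OF P _ _ U(2)])
    show "openin (topology_generated_by {{x \<in> S. f x \<noteq> 0} | f. f \<in> P}) U" using U(1) by (simp add: alg_space_def)
    fix B p assume "B \<in> {{x \<in> S. f x \<noteq> 0} | f. f \<in> P}" "p \<in> B"
    then obtain f where "f \<in> P" "B = {x \<in> S. f x \<noteq> 0}" "f p \<noteq> 0" by blast
    then show "\<exists>h\<in>P. h p \<noteq> 0 \<and> (\<forall>q\<in>S. h q \<noteq> 0 \<longrightarrow> q \<in> B)" by (intro bexI[of _ f]) auto
  qed
next
  fix U f p assume "openin (zar (alg_space S P)) U" "f \<in> reg (alg_space S P) U" "p \<in> U"
  then show "local_fraction P U p f" unfolding alg_space_def local_fraction_def by simp
qed

lemma presented_affine_space: "presented_by (affine_space N) (poly_functions N)"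
  unfolding affine_space_def by (intro presented_alg_space fun_algebra_poly_functions)

lemma presented_affine_line: "presented_by affine_line (range poly)"
  unfolding affine_line_def by (intro presented_alg_space fun_algebra_range_poly)

lemma presented_sub_space:
  assumes X: "presented_by X P"
  shows "presented_by (sub_space X S) P"
  unfolding presented_by_def
proof (intro conjI allI impI presented_byD(1)[OF X])
  fix U p assume U: "openin (zar (sub_space X S)) U" "p \<in> U"
  then obtain O' where O': "openin (zar X) O'" "U = O' \<inter> S" by (auto simp: sub_space_def openin_subtopology)
  from presented_byD(2)[OF X O'(1), of p] U(2) O'(2)
  show "\<exists>h\<in>P. h p \<noteq> 0 \<and> (\<forall>q\<in>points (sub_space X S). h q \<noteq> 0 \<longrightarrow> q \<in> U)" by auto
next
  fix U f p assume U: "openin (zar (sub_space X S)) U" and f: "f \<in> reg (sub_space X S) U" and p: "p \<in> U"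
  have UX: "U \<subseteq> points X" using U by (auto simp: sub_space_def openin_subtopology dest: openin_subset)
  obtain O' g where O': "openin (zar X) O'" "p \<in> O'" "g \<in> reg X O'" "\<forall>y\<in>O' \<inter> U. f y = g y"
    using f p by (auto simp: sub_space_def)
  obtain h where h: "h \<in> P" "h p \<noteq> 0" "\<forall>q\<in>points X. h q \<noteq> 0 \<longrightarrow> q \<in> O'"
    using presented_byD(2)[OF X O'(1,2)] by blast
  obtain a b where ab: "a \<in> P" "b \<in> P" "b p \<noteq> 0" "\<forall>q\<in>O'. b q \<noteq> 0 \<longrightarrow> g q = a q / b q"
    by (rule local_fractionE[OF presented_byD(3)[OF X O'(1,3,2)]])
  \<comment> \<open>The factor \<open>h\<close> in numerator and denominator confines the identity
    to \<open>O'\<close>, where \<open>g\<close> represents \<open>f\<close>.\<close>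
  show "local_fraction P U p f"
    by (rule local_fractionI[of "\<lambda>q. a q * h q" P "\<lambda>q. b q * h q"])
      (use ab h O' UX fa_mult[OF presented_byD(1)[OF X]] in auto)
qed

definition product_algebra :: "('a \<Rightarrow> complex) set \<Rightarrow> ('b \<Rightarrow> complex) set \<Rightarrow> ('a \<times> 'b \<Rightarrow> complex) set" where
  "product_algebra P Q = alg_gen ({\<lambda>x. f (fst x) | f. f \<in> P} \<union> {\<lambda>x. g (snd x) | g. g \<in> Q})"

lemma fun_algebra_product_algebra: "fun_algebra (product_algebra P Q)"
  unfolding product_algebra_def by (rule fun_algebra_alg_gen)

lemma product_algebra_fst: "f \<in> P \<Longrightarrow> (\<lambda>x. f (fst x)) \<in> product_algebra P Q"
  unfolding product_algebra_def by (intro alg_gen.gen UnI1 CollectI exI[of _ f]) simp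

lemma product_algebra_snd: "g \<in> Q \<Longrightarrow> (\<lambda>x. g (snd x)) \<in> product_algebra P Q"
  unfolding product_algebra_def by (intro alg_gen.gen UnI2 CollectI exI[of _ g]) simp

text \<open>Tensor functions are built from functions that are themselves only local fractions, so
  their quotients become compound fractions over the product algebra.\<close>

lemma presented_prod_space:
  assumes X: "presented_by X P" and Y: "presented_by Y Q"
  shows "presented_by (prod_space X Y) (product_algebra P Q)"
proof -
  let ?R = "product_algebra P Q"
  note R = fun_algebra_product_algebra[of P Q]
  have tensor: "local_fraction ?R (U \<times> V) p h"
    if U: "openin (zar X) U" and V: "openin (zar Y) V" and h: "h \<in> tensor_functions X Y U V" and p: "p \<in> U \<times> V" for U V h p
  proof -
    obtain k :: nat and f g where h': "h = (\<lambda>(x, y). \<Sum>i<k. f i x * g i y)"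
      and fg: "\<forall>i<k. f i \<in> reg X U \<and> g i \<in> reg Y V"
      using h unfolding tensor_functions_def by (elim CollectE exE conjE)
    have p': "fst p \<in> U" "snd p \<in> V" using p by auto
    have lf: "local_fraction ?R (U \<times> V) p (\<lambda>x. f i (fst x))" if i: "i < k" for i
    proof -
      have "f i \<in> reg X U" using fg i by blast
      from presented_byD(3)[OF X U this p'(1)]
      obtain a b where ab: "a \<in> P" "b \<in> P" "b (fst p) \<noteq> 0" "\<forall>q\<in>U. b q \<noteq> 0 \<longrightarrow> f i q = a q / b q"
        by (rule local_fractionE)
      show ?thesis
        by (rule local_fractionI[OF product_algebra_fst[OF ab(1)] product_algebra_fst[OF ab(2)]]) (use ab in auto)
    qed
    have lg: "local_fraction ?R (U \<times> V) p (\<lambda>x. g i (snd x))" if i: "i < k" for i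
    proof -
      have "g i \<in> reg Y V" using fg i by blast
      from presented_byD(3)[OF Y V this p'(2)]
      obtain a b where ab: "a \<in> Q" "b \<in> Q" "b (snd p) \<noteq> 0" "\<forall>q\<in>V. b q \<noteq> 0 \<longrightarrow> g i q = a q / b q"
        by (rule local_fractionE)
      show ?thesis
        by (rule local_fractionI[OF product_algebra_snd[OF ab(1)] product_algebra_snd[OF ab(2)]]) (use ab in auto)
    qed
    note A = fun_algebra_local_fraction[OF R, of "U \<times> V" p]
    have "(\<lambda>x. \<Sum>i<k. f i (fst x) * g i (snd x)) \<in> {f. local_fraction ?R (U \<times> V) p f}"
      by (intro fa_sum[OF A] fa_mult[OF A]) (use lf lg in auto)
    then show ?thesis by (simp add: h' split_beta')
  qed
  have nbhd: "\<exists>h\<in>?R. h p \<noteq> 0 \<and> (\<forall>q\<in>points X \<times> points Y. h q \<noteq> 0 \<longrightarrow> q \<in> U \<times> V)"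
    if U: "openin (zar X) U" and V: "openin (zar Y) V" and p: "p \<in> U \<times> V" for U V p
  proof -
    have p': "fst p \<in> U" "snd p \<in> V" using p by auto
    obtain h where h: "h \<in> P" "h (fst p) \<noteq> 0" "\<forall>q\<in>points X. h q \<noteq> 0 \<longrightarrow> q \<in> U"
      using presented_byD(2)[OF X U p'(1)] by blast
    obtain k where k: "k \<in> Q" "k (snd p) \<noteq> 0" "\<forall>q\<in>points Y. k q \<noteq> 0 \<longrightarrow> q \<in> V"
      using presented_byD(2)[OF Y V p'(2)] by blast
    show ?thesis
      by (rule bexI[of _ "\<lambda>x. h (fst x) * k (snd x)"])
        (use h k fa_mult[OF R product_algebra_fst product_algebra_snd] in auto)
  qed
  let ?B = "{{q \<in> U \<times> V. h q \<noteq> 0} | U V h.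
                 openin (zar X) U \<and> openin (zar Y) V \<and> h \<in> tensor_functions X Y U V}"
  have pts: "points (prod_space X Y) \<subseteq> points X \<times> points Y"
    unfolding prod_space_def fspace.simps topology_generated_by_topspace by (auto dest: openin_subset)
  show ?thesis
    unfolding presented_by_def
  proof (intro conjI allI impI R)
    fix U p assume U: "openin (zar (prod_space X Y)) U" "p \<in> U"
    have "\<exists>h\<in>?R. h p \<noteq> 0 \<and> (\<forall>q\<in>points X \<times> points Y. h q \<noteq> 0 \<longrightarrow> q \<in> U)"
    proof (rule generated_topology_nonvanishing[OF R _ _ U(2)])
      show "openin (topology_generated_by ?B) U" using U(1) by (simp add: prod_space_def)
      fix B p assume B: "B \<in> ?B" and p: "p \<in> B"
      then obtain U V h where UV: "B = {q \<in> U \<times> V. h q \<noteq> 0}" "openin (zar X) U" "openin (zar Y) V"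
        "h \<in> tensor_functions X Y U V" by (elim CollectE exE conjE)
      have p': "p \<in> U \<times> V" "h p \<noteq> 0" using p UV(1) by auto
      obtain a b where ab: "a \<in> ?R" "b \<in> ?R" "b p \<noteq> 0" "\<forall>q\<in>U \<times> V. b q \<noteq> 0 \<longrightarrow> h q = a q / b q"
        by (rule local_fractionE[OF tensor[OF UV(2-4) p'(1)]])
      obtain k where k: "k \<in> ?R" "k p \<noteq> 0" "\<forall>q\<in>points X \<times> points Y. k q \<noteq> 0 \<longrightarrow> q \<in> U \<times> V"
        using nbhd[OF UV(2,3) p'(1)] by blast
      have "a p \<noteq> 0" using ab(3,4) p' by auto
      then show "\<exists>h\<in>?R. h p \<noteq> 0 \<and> (\<forall>q\<in>points X \<times> points Y. h q \<noteq> 0 \<longrightarrow> q \<in> B)"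
        using ab k UV(1) fa_mult[OF R fa_mult[OF R ab(1,2)] k(1)]
        by (intro bexI[of _ "\<lambda>q. a q * b q * k q"]) auto
    qed
    then show "\<exists>h\<in>?R. h p \<noteq> 0 \<and> (\<forall>q\<in>points (prod_space X Y). h q \<noteq> 0 \<longrightarrow> q \<in> U)" using pts by blast
  next
    fix W F p assume W: "openin (zar (prod_space X Y)) W" and F: "F \<in> reg (prod_space X Y) W" and p: "p \<in> W"
    have WX: "W \<subseteq> points X \<times> points Y" using openin_subset[OF W] pts by blast
    from F have "\<forall>p\<in>W. \<exists>U V. openin (zar X) U \<and> openin (zar Y) V \<and> p \<in> U \<times> V \<and>
                  (\<exists>a\<in>tensor_functions X Y U V. \<exists>b\<in>tensor_functions X Y U V.
                     b p \<noteq> 0 \<and> (\<forall>q\<in>W \<inter> U \<times> V. b q \<noteq> 0 \<longrightarrow> F q = a q / b q))"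
      unfolding prod_space_def fspace.simps by (rule CollectD)
    from bspec[OF this p] obtain U V a b where UV: "openin (zar X) U" "openin (zar Y) V" "p \<in> U \<times> V"
      and a: "a \<in> tensor_functions X Y U V" and b: "b \<in> tensor_functions X Y U V" "b p \<noteq> 0"
      and Fab: "\<forall>q\<in>W \<inter> U \<times> V. b q \<noteq> 0 \<longrightarrow> F q = a q / b q"
      by (elim exE conjE bexE)
    obtain a1 b1 where 1: "a1 \<in> ?R" "b1 \<in> ?R" "b1 p \<noteq> 0" "\<forall>q\<in>U \<times> V. b1 q \<noteq> 0 \<longrightarrow> a q = a1 q / b1 q"
      by (rule local_fractionE[OF tensor[OF UV(1,2) a UV(3)]])
    obtain a2 b2 where 2: "a2 \<in> ?R" "b2 \<in> ?R" "b2 p \<noteq> 0" "\<forall>q\<in>U \<times> V. b2 q \<noteq> 0 \<longrightarrow> b q = a2 q / b2 q"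
      by (rule local_fractionE[OF tensor[OF UV(1,2) b(1) UV(3)]])
    obtain k where k: "k \<in> ?R" "k p \<noteq> 0" "\<forall>q\<in>points X \<times> points Y. k q \<noteq> 0 \<longrightarrow> q \<in> U \<times> V"
      using nbhd[OF UV] by blast
    have "a2 p \<noteq> 0" using 2(3,4) UV(3) b(2) by auto
    \<comment> \<open>Beyond the compound fraction, \<open>b2 * k\<close> is inserted above and
      below: \<open>k\<close> keeps the point in \<open>U \<times> V\<close>, and \<open>b2\<close>
      keeps the representation of \<open>b\<close> valid.\<close>
    show "local_fraction ?R W p F"
    proof (rule local_fractionI[of "\<lambda>q. a1 q * b2 q * (b2 q * k q)" ?R "\<lambda>q. b1 q * a2 q * (b2 q * k q)"])
      show "(\<lambda>q. a1 q * b2 q * (b2 q * k q)) \<in> ?R" "(\<lambda>q. b1 q * a2 q * (b2 q * k q)) \<in> ?R"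
        by (intro fa_mult[OF R] 1 2 k)+
      show "b1 p * a2 p * (b2 p * k p) \<noteq> 0" using 1 2 k \<open>a2 p \<noteq> 0\<close> by simp
      fix q assume q: "q \<in> W" "b1 q * a2 q * (b2 q * k q) \<noteq> 0"
      then have nz: "b1 q \<noteq> 0" "a2 q \<noteq> 0" "b2 q \<noteq> 0" "k q \<noteq> 0" by auto
      have qUV: "q \<in> U \<times> V" using k(3) nz(4) q(1) WX by blast
      have bq: "b q = a2 q / b2 q" and aq: "a q = a1 q / b1 q" using 1(4)[rule_format, OF qUV nz(1)] 2(4)[rule_format, OF qUV nz(3)] by auto
      have "b q \<noteq> 0" using bq nz by simp
      then have "F q = a q / b q" using Fab q(1) qUV by blast
      then show "F q = a1 q * b2 q * (b2 q * k q) / (b1 q * a2 q * (b2 q * k q))"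
        using nz by (simp add: aq bq field_simps)
    qed
  qed
qed

section \<open>Affine charts and integral dependence of the values of a covering\<close>

lemma openin_affine_nonvanishing:
  assumes "h \<in> poly_functions N"
  shows "openin (zar (affine_space N)) {x \<in> affine_points N. h x \<noteq> 0}"
proof -
  have "{x \<in> affine_points N. h x \<noteq> 0} \<in> {{x \<in> affine_points N. f x \<noteq> 0} | f. f \<in> poly_functions N}"
    using assms by (intro CollectI exI[of _ h]) simp
  then show ?thesis
    unfolding affine_space_def alg_space_def fspace.simps openin_topology_generated_by_iff
    by (rule generate_topology_on.Basis)
qed

text \<open>Where \<open>f\<close> is the fraction \<open>a / b\<close>, the locus of
  \<open>a * b \<noteq> 0\<close> is an open set inside the nonvanishing locus of
  \<open>f\<close>.\<close>

lemma openin_sub_affine_nonvanishing: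
  assumes "\<And>p. p \<in> points (sub_space (affine_space N) S) \<Longrightarrow>
    local_fraction (poly_functions N) (points (sub_space (affine_space N) S)) p f"
  shows "openin (zar (sub_space (affine_space N) S)) {p \<in> points (sub_space (affine_space N) S). f p \<noteq> 0}"
proof (subst openin_subopen, intro ballI)
  let ?A = "sub_space (affine_space N) S"
  fix p assume p: "p \<in> {p \<in> points ?A. f p \<noteq> 0}"
  then obtain a b where ab: "a \<in> poly_functions N" "b \<in> poly_functions N" "b p \<noteq> 0"
    "\<forall>q\<in>points ?A. b q \<noteq> 0 \<longrightarrow> f q = a q / b q"
    using local_fractionE[OF assms[of p]] by blast
  let ?h = "\<lambda>x. a x * b x"
  have "?h \<in> poly_functions N" by (intro poly_functions.mult ab)
  from openin_affine_nonvanishing[OF this]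
  have "openin (zar ?A) ({x \<in> affine_points N. ?h x \<noteq> 0} \<inter> S)"
    unfolding sub_space_def fspace.simps openin_subtopology by blast
  moreover have "p \<in> {x \<in> affine_points N. ?h x \<noteq> 0} \<inter> S" using p ab(3,4) by auto
  moreover have "{x \<in> affine_points N. ?h x \<noteq> 0} \<inter> S \<subseteq> {p \<in> points ?A. f p \<noteq> 0}" using ab(4) by auto
  ultimately show "\<exists>T. openin (zar ?A) T \<and> p \<in> T \<and> T \<subseteq> {p \<in> points ?A. f p \<noteq> 0}" by blast
qed

lemma affine_chart:
  assumes "affine_variety Z"
  obtains N S f g where "morphism Z (sub_space (affine_space N) S) f" "morphism (sub_space (affine_space N) S) Z g"
    "\<And>x. x \<in> points Z \<Longrightarrow> g (f x) = x" "\<And>x. x \<in> points Z \<Longrightarrow> f x \<in> points (sub_space (affine_space N) S)"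
    "\<And>y. y \<in> points (sub_space (affine_space N) S) \<Longrightarrow> g y \<in> points Z"
    "\<And>h. h \<in> reg Z (points Z) \<Longrightarrow> h \<circ> g \<in> reg (sub_space (affine_space N) S) (points (sub_space (affine_space N) S))"
    "\<And>h. h \<in> reg (sub_space (affine_space N) S) (points (sub_space (affine_space N) S)) \<Longrightarrow> h \<circ> f \<in> reg Z (points Z)"
proof -
  obtain N S f g where fg: "morphism Z (sub_space (affine_space N) S) f" "morphism (sub_space (affine_space N) S) Z g"
    "\<forall>x\<in>points Z. g (f x) = x"
    using assms unfolding affine_variety_def isomorphic_def by (elim exE conjE)
  let ?A = "sub_space (affine_space N) S"
  have f: "f x \<in> points ?A" if "x \<in> points Z" for x
    using fg(1) that unfolding morphism_def continuous_map_def by blast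
  have g: "g y \<in> points Z" if "y \<in> points ?A" for y
    using fg(2) that unfolding morphism_def continuous_map_def by blast
  have "h \<circ> g \<in> reg ?A (points ?A)" if "h \<in> reg Z (points Z)" for h
  proof -
    have "h \<circ> g \<in> reg ?A {x \<in> points ?A. g x \<in> points Z}"
      using fg(2) that openin_topspace unfolding morphism_def by blast
    moreover have "{x \<in> points ?A. g x \<in> points Z} = points ?A" using g by auto
    ultimately show ?thesis by simp
  qed
  moreover have "h \<circ> f \<in> reg Z (points Z)" if "h \<in> reg ?A (points ?A)" for h
  proof -
    have "h \<circ> f \<in> reg Z {x \<in> points Z. f x \<in> points ?A}"
      using fg(1) that openin_topspace unfolding morphism_def by blast
    moreover have "{x \<in> points Z. f x \<in> points ?A} = points Z" using f by auto
    ultimately show ?thesis by simp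
  qed
  ultimately show thesis using that[OF fg(1,2)] fg(3) f g by blast
qed

text \<open>In a chart, take all functions that are fractions of polynomials near every point. They
  form an algebra containing the regular functions, and their nonvanishing loci are open; sums of
  regular functions are thereby covered.\<close>

lemma affine_variety_algebra:
  assumes "affine_variety Z"
  shows "\<exists>F. fun_algebra F \<and> reg Z (points Z) \<subseteq> F \<and> (\<forall>h\<in>F. openin (zar Z) {y \<in> points Z. h y \<noteq> 0})"
proof -
  obtain N S f g where *: "morphism Z (sub_space (affine_space N) S) f"
    "\<And>x. x \<in> points Z \<Longrightarrow> g (f x) = x" "\<And>x. x \<in> points Z \<Longrightarrow> f x \<in> points (sub_space (affine_space N) S)"
    "\<And>h. h \<in> reg Z (points Z) \<Longrightarrow> h \<circ> g \<in> reg (sub_space (affine_space N) S) (points (sub_space (affine_space N) S))"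
    using affine_chart[OF assms] by metis
  let ?A = "sub_space (affine_space N) S"
  define F where "F = {h. \<forall>p\<in>points ?A. (\<lambda>x. h (g x)) \<in> {k. local_fraction (poly_functions N) (points ?A) p k}}"
  have F: "fun_algebra F"
  proof (rule fun_algebraI)
    note A = fun_algebra_local_fraction[OF fun_algebra_poly_functions]
    show "(\<lambda>_. c) \<in> F" for c unfolding F_def using fa_const[OF A] by blast
    fix h k assume hk: "h \<in> F" "k \<in> F"
    show "(\<lambda>x. h x + k x) \<in> F" unfolding F_def
    proof (rule CollectI, rule ballI)
      fix p assume "p \<in> points ?A"
      then show "(\<lambda>x. h (g x) + k (g x)) \<in> {k. local_fraction (poly_functions N) (points ?A) p k}"
        using hk unfolding F_def by (intro fa_add[OF A]) blast+
    qed
    show "(\<lambda>x. h x * k x) \<in> F" unfolding F_def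
    proof (rule CollectI, rule ballI)
      fix p assume "p \<in> points ?A"
      then show "(\<lambda>x. h (g x) * k (g x)) \<in> {k. local_fraction (poly_functions N) (points ?A) p k}"
        using hk unfolding F_def by (intro fa_mult[OF A]) blast+
    qed
  qed
  moreover have "reg Z (points Z) \<subseteq> F"
  proof
    fix h assume "h \<in> reg Z (points Z)"
    from presented_byD(3)[OF presented_sub_space[OF presented_affine_space] openin_topspace *(4)[OF this]]
    show "h \<in> F" unfolding F_def comp_def by blast
  qed
  moreover have "openin (zar Z) {y \<in> points Z. h y \<noteq> 0}" if h: "h \<in> F" for h
  proof -
    have "openin (zar ?A) {p \<in> points ?A. h (g p) \<noteq> 0}"
      by (rule openin_sub_affine_nonvanishing) (use h in \<open>auto simp: F_def\<close>)
    then have "openin (zar Z) {y \<in> points Z. f y \<in> {p \<in> points ?A. h (g p) \<noteq> 0}}"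
      using *(1) unfolding morphism_def continuous_map_def by blast
    moreover have "{y \<in> points Z. f y \<in> {p \<in> points ?A. h (g p) \<noteq> 0}} = {y \<in> points Z. h y \<noteq> 0}"
      using *(2,3) by auto
    ultimately show ?thesis by simp
  qed
  ultimately show ?thesis by blast
qed

section \<open>Regular functions on affine open subsets\<close>

lemma sub_affine_reg_mult:
  assumes "a \<in> reg (sub_space (affine_space N) S) V" "b \<in> reg (sub_space (affine_space N) S) V"
  shows "(\<lambda>x. a x * b x) \<in> reg (sub_space (affine_space N) S) V"
  unfolding sub_space_def fspace.simps
proof (intro CollectI ballI)
  fix x assume x: "x \<in> V"
  obtain U g where U: "openin (zar (affine_space N)) U" "x \<in> U" "g \<in> reg (affine_space N) U" "\<forall>y\<in>U \<inter> V. a y = g y"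
    using assms(1) x by (auto simp: sub_space_def)
  obtain U' g' where U': "openin (zar (affine_space N)) U'" "x \<in> U'" "g' \<in> reg (affine_space N) U'" "\<forall>y\<in>U' \<inter> V. b y = g' y"
    using assms(2) x by (auto simp: sub_space_def)
  have "(\<lambda>y. g y * g' y) \<in> reg (affine_space N) (U \<inter> U')"
    unfolding affine_space_def alg_space_def fspace.simps
  proof (intro CollectI ballI)
    fix z assume z: "z \<in> U \<inter> U'"
    obtain p q where pq: "p \<in> poly_functions N" "q \<in> poly_functions N" "q z \<noteq> 0" "\<forall>y\<in>U. q y \<noteq> 0 \<longrightarrow> g y = p y / q y"
      using U(3) z unfolding affine_space_def alg_space_def fspace.simps by blast
    obtain p' q' where pq': "p' \<in> poly_functions N" "q' \<in> poly_functions N" "q' z \<noteq> 0" "\<forall>y\<in>U'. q' y \<noteq> 0 \<longrightarrow> g' y = p' y / q' y"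
      using U'(3) z unfolding affine_space_def alg_space_def fspace.simps by blast
    show "\<exists>f\<in>poly_functions N. \<exists>h\<in>poly_functions N. h z \<noteq> 0 \<and> (\<forall>y\<in>U \<inter> U'. h y \<noteq> 0 \<longrightarrow> g y * g' y = f y / h y)"
      by (rule bexI[OF _ poly_functions.mult[OF pq(1) pq'(1)]], rule bexI[OF _ poly_functions.mult[OF pq(2) pq'(2)]])
        (use pq pq' in auto)
  qed
  then show "\<exists>U g. openin (zar (affine_space N)) U \<and> x \<in> U \<and> g \<in> reg (affine_space N) U \<and> (\<forall>y\<in>U \<inter> V. a y * b y = g y)"
    using U U' by (intro exI[of _ "U \<inter> U'"] exI[of _ "\<lambda>y. g y * g' y"]) auto
qed

lemma reg_sub_space_self: "openin (zar X) U \<Longrightarrow> f \<in> reg X U \<Longrightarrow> f \<in> reg (sub_space X U) U"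
  unfolding sub_space_def fspace.simps
  by (intro CollectI ballI exI[of _ U] exI[of _ f]) auto

lemma function_sheaf_cong:
  assumes "function_sheaf X" "openin (zar X) U" "f \<in> reg X U" "\<forall>x\<in>U. g x = f x"
  shows "g \<in> reg X U"
proof -
  have "\<forall>U f g. openin (zar X) U \<and> f \<in> reg X U \<and> (\<forall>x\<in>U. g x = f x) \<longrightarrow> g \<in> reg X U"
    using assms(1) unfolding function_sheaf_def by (elim conjE)
  from this[THEN spec, THEN spec, THEN spec, THEN mp, of U f g] assms show ?thesis by simp
qed

lemma function_sheaf_restrict:
  assumes "function_sheaf X" "openin (zar X) U" "openin (zar X) V" "V \<subseteq> U" "f \<in> reg X U"
  shows "f \<in> reg X V"
proof -
  have "\<forall>U V f. openin (zar X) U \<and> openin (zar X) V \<and> V \<subseteq> U \<and> f \<in> reg X U \<longrightarrow> f \<in> reg X V"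
    using assms(1) unfolding function_sheaf_def by (elim conjE)
  from this[THEN spec, THEN spec, THEN spec, THEN mp, of U V f] assms show ?thesis by simp
qed

lemma function_sheaf_glue:
  assumes "function_sheaf X" "openin (zar X) U"
    "\<forall>x\<in>U. \<exists>V. openin (zar X) V \<and> x \<in> V \<and> V \<subseteq> U \<and> f \<in> reg X V"
  shows "f \<in> reg X U"
proof -
  have "\<forall>U f. openin (zar X) U \<and> (\<forall>x\<in>U. \<exists>V. openin (zar X) V \<and> x \<in> V \<and> V \<subseteq> U \<and> f \<in> reg X V) \<longrightarrow> f \<in> reg X U"
    using assms(1) unfolding function_sheaf_def by (elim conjE)
  from this[THEN spec, THEN spec, THEN mp, OF conjI, OF assms(2,3)] show ?thesis .
qed

lemma reg_sub_space_open:
  assumes X: "function_sheaf X" and U: "openin (zar X) U" and f: "f \<in> reg (sub_space X U) U"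
  shows "f \<in> reg X U"
proof -
  have "\<exists>V. openin (zar X) V \<and> x \<in> V \<and> V \<subseteq> U \<and> f \<in> reg X V" if x: "x \<in> U" for x
  proof -
    obtain V g where V: "openin (zar X) V" "x \<in> V" "g \<in> reg X V" "\<forall>y\<in>V \<inter> U. f y = g y"
      using f x by (auto simp: sub_space_def)
    have VU: "openin (zar X) (V \<inter> U)" using V U by auto
    have "g \<in> reg X (V \<inter> U)" by (rule function_sheaf_restrict[OF X V(1) VU _ V(3)]) simp
    from function_sheaf_cong[OF X VU this V(4)] have "f \<in> reg X (V \<inter> U)" .
    then show ?thesis using VU V(2) x by (intro exI[of _ "V \<inter> U"]) simp
  qed
  then show ?thesis by (intro function_sheaf_glue[OF X U]) simp
qed

text \<open>Products are formed in affine space, where regular functions are explicit fractions, and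
  transported back along the chart.\<close>

lemma affine_open_reg_closed:
  assumes X: "function_sheaf X" and U: "openin (zar X) U" and aff: "affine_variety (sub_space X U)"
  shows "(\<lambda>_. 1) \<in> reg X U" "a \<in> reg X U \<Longrightarrow> b \<in> reg X U \<Longrightarrow> (\<lambda>x. a x * b x) \<in> reg X U"
proof -
  let ?Z = "sub_space X U"
  have pZ: "points ?Z = U" using openin_subset[OF U] by auto
  obtain N S f g where *: "\<And>x. x \<in> points ?Z \<Longrightarrow> g (f x) = x"
    "\<And>h. h \<in> reg ?Z (points ?Z) \<Longrightarrow> h \<circ> g \<in> reg (sub_space (affine_space N) S) (points (sub_space (affine_space N) S))"
    "\<And>h. h \<in> reg (sub_space (affine_space N) S) (points (sub_space (affine_space N) S)) \<Longrightarrow> h \<circ> f \<in> reg ?Z (points ?Z)"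
    using affine_chart[OF aff] by metis
  have "(\<lambda>_. 1) \<in> reg (sub_space (affine_space N) S) (points (sub_space (affine_space N) S))"
    by (intro one_reg_sub_space one_reg_affine_space) simp
  from *(3)[OF this] have "(\<lambda>_. 1) \<in> reg ?Z U" unfolding comp_def pZ .
  then show "(\<lambda>_. 1) \<in> reg X U" by (rule reg_sub_space_open[OF X U])
  assume ab: "a \<in> reg X U" "b \<in> reg X U"
  have "a \<in> reg ?Z (points ?Z)" "b \<in> reg ?Z (points ?Z)" unfolding pZ using ab reg_sub_space_self[OF U] by auto
  from *(3)[OF sub_affine_reg_mult[OF *(2)[OF this(1)] *(2)[OF this(2)]]]
  have "(\<lambda>x. a (g (f x)) * b (g (f x))) \<in> reg ?Z U" unfolding comp_def pZ .
  from reg_sub_space_open[OF X U this]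
  have r: "(\<lambda>x. a (g (f x)) * b (g (f x))) \<in> reg X U" .
  show "(\<lambda>x. a x * b x) \<in> reg X U"
    by (rule function_sheaf_cong[OF X U r]) (use *(1)[unfolded pZ] in auto)
qed

text \<open>The determinant trick for the finitely many module generators \<open>B\<close>:
  multiplication by the function on the covering is a matrix over \<open>reg Y V\<close>. At each
  point some generator is nonzero because 1 is a combination of them, so one equation holds for all
  values over \<open>V\<close>.\<close>

lemma covering_values_integral:
  assumes w: "algebraic_function Y w" and y0: "y0 \<in> points Y"
  shows "\<exists>V D q. openin (zar Y) V \<and> y0 \<in> V \<and> affine_variety (sub_space Y V) \<and> D \<ge> 1 \<and>
     (\<forall>k<D. q k \<in> alg_gen (reg Y V)) \<and> (\<forall>y\<in>V. \<forall>t\<in>af_values w y. monic_val D q y t = 0)"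
proof -
  let ?C = "cover w" and ?p = "cover_map w" and ?W = "cover_fun w"
  have C: "function_sheaf ?C" and fin: "finite_morphism ?C Y ?p" and surj: "?p ` points ?C = points Y"
    and W: "?W \<in> reg ?C (points ?C)"
    using w unfolding algebraic_function_def branched_covering_def variety_def by blast+
  from fin have "\<forall>y\<in>points Y. \<exists>V. openin (zar Y) V \<and> y \<in> V \<and> affine_variety (sub_space Y V) \<and>
        (let U = {x \<in> points ?C. ?p x \<in> V} in
           affine_variety (sub_space ?C U) \<and>
           (\<exists>B. finite B \<and> B \<subseteq> reg ?C U \<and>
              (\<forall>f\<in>reg ?C U. \<exists>c. (\<forall>b\<in>B. c b \<in> reg Y V) \<and> (\<forall>x\<in>U. f x = (\<Sum>b\<in>B. c b (?p x) * b x)))))"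
    unfolding finite_morphism_def by (rule conjunct2)
  from bspec[OF this y0] obtain V where V: "openin (zar Y) V" "y0 \<in> V" "affine_variety (sub_space Y V)"
    and V': "let U = {x \<in> points ?C. ?p x \<in> V} in affine_variety (sub_space ?C U) \<and>
           (\<exists>B. finite B \<and> B \<subseteq> reg ?C U \<and>
              (\<forall>f\<in>reg ?C U. \<exists>c. (\<forall>b\<in>B. c b \<in> reg Y V) \<and> (\<forall>x\<in>U. f x = (\<Sum>b\<in>B. c b (?p x) * b x))))"
    by (elim exE conjE)
  define U where "U = {x \<in> points ?C. ?p x \<in> V}"
  have aff: "affine_variety (sub_space ?C U)" using V' unfolding U_def Let_def by (elim conjE)
  from V' obtain B where B: "finite B" "B \<subseteq> reg ?C U"
    "\<forall>f\<in>reg ?C U. \<exists>c. (\<forall>b\<in>B. c b \<in> reg Y V) \<and> (\<forall>x\<in>U. f x = (\<Sum>b\<in>B. c b (?p x) * b x))"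
    unfolding U_def Let_def by (elim exE conjE)
  have U: "openin (zar ?C) U"
    using fin V(1) unfolding finite_morphism_def morphism_def continuous_map_def U_def by blast
  have WU: "?W \<in> reg ?C U"
    by (rule function_sheaf_restrict[OF C openin_topspace U openin_subset[OF U] W])
  have "\<forall>b. \<exists>c. b \<in> B \<longrightarrow> (\<forall>b'\<in>B. c b' \<in> reg Y V) \<and> (\<forall>x\<in>U. ?W x * b x = (\<Sum>b'\<in>B. c b' (?p x) * b' x))"
  proof
    fix b
    show "\<exists>c. b \<in> B \<longrightarrow> (\<forall>b'\<in>B. c b' \<in> reg Y V) \<and> (\<forall>x\<in>U. ?W x * b x = (\<Sum>b'\<in>B. c b' (?p x) * b' x))"
    proof (cases "b \<in> B")
      case True
      then have "(\<lambda>x. ?W x * b x) \<in> reg ?C U" using affine_open_reg_closed(2)[OF C U aff WU, of b] B(2) by blast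
      from B(3)[rule_format, OF this] show ?thesis by (elim exE) (intro exI impI)
    qed blast
  qed
  from choice[OF this] obtain c where c: "\<forall>b. b \<in> B \<longrightarrow> (\<forall>b'\<in>B. c b b' \<in> reg Y V) \<and> (\<forall>x\<in>U. ?W x * b x = (\<Sum>b'\<in>B. c b b' (?p x) * b' x))"
    by (elim exE)
  from B(3)[rule_format, OF affine_open_reg_closed(1)[OF C U aff]]
  obtain e where e: "\<forall>x\<in>U. 1 = (\<Sum>b\<in>B. e b (?p x) * b x)" by (elim exE conjE)
  have nz: "\<exists>b\<in>B. b x \<noteq> 0" if "x \<in> U" for x
  proof (rule ccontr)
    assume "\<not> ?thesis"
    then have "(\<Sum>b\<in>B. e b (?p x) * b x) = 0" by (intro sum.neutral) simp
    then show False using e that by simp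
  qed
  \<comment> \<open>Surjectivity excludes an empty set of generators, which would give an equation
    of degree 0.\<close>
  have "y0 \<in> ?p ` points ?C" using surj y0 by simp
  then obtain x0 where "y0 = ?p x0" "x0 \<in> points ?C" by (rule imageE)
  then have "x0 \<in> U" using V(2) by (simp add: U_def)
  then have "B \<noteq> {}" using nz by blast
  then have D: "card B \<ge> 1" using B(1) by (simp add: Suc_le_eq card_gt_0_iff)
  have "\<forall>b\<in>B. \<forall>b'\<in>B. c b b' \<in> alg_gen (reg Y V)" using c by (intro ballI alg_gen.gen) blast
  from eigenvalue_monic[OF fun_algebra_alg_gen B(1) this]
  obtain q where q: "\<forall>k<card B. q k \<in> alg_gen (reg Y V)"
    and r: "\<forall>x l b. (\<exists>i\<in>B. b i \<noteq> 0) \<longrightarrow> (\<forall>i\<in>B. l * b i = (\<Sum>j\<in>B. c i j x * b j)) \<longrightarrow> monic_val (card B) q x l = 0"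
    by (elim exE conjE)
  have "monic_val (card B) q y t = 0" if y: "y \<in> V" and t: "t \<in> af_values w y" for y t
  proof -
    obtain x where x: "x \<in> points ?C" "?p x = y" "t = ?W x" using t by (auto simp: af_values_def)
    have xU: "x \<in> U" using x y by (simp add: U_def)
    show ?thesis
      by (rule r[THEN spec, THEN spec, THEN spec, THEN mp, THEN mp, of "\<lambda>b. b x"])
        (use nz[OF xU] c xU x in auto)
  qed
  then show ?thesis using V D q by (intro exI[of _ V] exI[of _ "card B"] exI[of _ q]) blast
qed

section \<open>A family of polynomials with Klein four-group symmetries\<close>

text \<open>The product of the differences of an ordered list, a square root of the discriminant
  whose sign depends on the order.\<close>

fun root_vandermonde :: "complex list \<Rightarrow> complex" where
  "root_vandermonde [] = 1"
| "root_vandermonde (a # zs) = (\<Prod>z\<leftarrow>zs. a - z) * root_vandermonde zs"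

lemma root_vandermonde_square: "roots_discriminant zs = (root_vandermonde zs)\<^sup>2"
proof (induction zs)
  case Nil
  show ?case by (simp add: roots_discriminant_def)
next
  case (Cons a zs)
  have "(\<Prod>z\<leftarrow>zs. (a - z)\<^sup>2) = (\<Prod>z\<leftarrow>zs. a - z)\<^sup>2"
    by (induction zs) (auto simp: power_mult_distrib)
  then show ?case using Cons.IH by (simp add: roots_discriminant_Cons power_mult_distrib)
qed

lemma root_vandermonde_append:
  "root_vandermonde (xs @ ys) = root_vandermonde xs * root_vandermonde ys * (\<Prod>x\<leftarrow>xs. \<Prod>y\<leftarrow>ys. x - y)"
  by (induction xs) (auto simp: mult_ac)

lemma root_vandermonde_nonzero: "root_vandermonde zs \<noteq> 0 \<longleftrightarrow> distinct zs"
  by (induction zs) (auto simp: prod_list_zero_iff)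

text \<open>The differences between entries of the two parts enter symmetrically, so they depend
  only on the multisets.\<close>

lemma root_vandermonde_append_cong:
  assumes "mset xs = mset xs'" "mset ys = mset ys'" "root_vandermonde xs = root_vandermonde xs'"
    "root_vandermonde ys = root_vandermonde ys'"
  shows "root_vandermonde (xs @ ys) = root_vandermonde (xs' @ ys')"
proof -
  have *: "(\<Prod>x\<leftarrow>xs. f x) = (\<Prod>x\<leftarrow>ys. f x)" if "mset xs = mset ys" for f :: "complex \<Rightarrow> complex" and xs ys
    using arg_cong[OF that, of "\<lambda>M. prod_mset (image_mset f M)"] by (simp flip: prod_mset_prod_list)
  have "(\<Prod>x\<leftarrow>xs. \<Prod>y\<leftarrow>ys. x - y) = (\<Prod>x\<leftarrow>xs'. \<Prod>y\<leftarrow>ys'. x - y)"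
    using *[OF assms(1), of "\<lambda>x. \<Prod>y\<leftarrow>ys. x - y"] *[OF assms(2)] by simp
  then show ?thesis using assms(3,4) by (simp add: root_vandermonde_append)
qed

definition klein_orbit :: "complex \<Rightarrow> complex \<Rightarrow> complex \<Rightarrow> complex \<Rightarrow> complex list" where
  "klein_orbit p q r w = [p + q + r + w, p + q - r - w, p - q + r - w, p - q - r + w]"

text \<open>Each difference of two entries is twice a sum or difference of two of \<open>q\<close>,
  \<open>r\<close>, \<open>w\<close>. They pair up to differences of squares, which no sign change
  affects.\<close>

lemma root_vandermonde_klein_orbit:
  "root_vandermonde (klein_orbit p q r w) = 64 * ((r\<^sup>2 - w\<^sup>2) * (q\<^sup>2 - w\<^sup>2) * (q\<^sup>2 - r\<^sup>2))"
proof -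
  have "root_vandermonde (klein_orbit p q r w) =
     (2 * (r + w)) * (2 * (q + w)) * (2 * (q + r)) * (2 * (q - r)) * (2 * (q - w)) * (2 * (r - w))"
    by (simp add: klein_orbit_def)
  also have "\<dots> = 64 * (((r + w) * (r - w)) * ((q + w) * (q - w)) * ((q + r) * (q - r)))"
    by (simp only: mult_ac) simp
  finally show ?thesis by (simp only: power2_eq_square square_diff_square_factored)
qed

lemma mset_klein_orbit:
  "mset (klein_orbit p (- q) r (- w)) = mset (klein_orbit p q r w)"
  "mset (klein_orbit p q (- r) (- w)) = mset (klein_orbit p q r w)"
  by (simp_all only: klein_orbit_def mset.simps add_uminus_conv_diff diff_minus_eq_add add_mset_commute)

text \<open>The four fractions are the transform of \<open>a, b, c, d\<close> by the characters of
  the Klein four-group, so that \<open>s = t = 1\<close> gives back the four numbers. One nontrivial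
  character is the product of the other two, hence the factor \<open>s * t\<close>.\<close>

definition klein_block :: "complex \<Rightarrow> complex \<Rightarrow> complex \<Rightarrow> complex \<Rightarrow> complex \<Rightarrow> complex \<Rightarrow> complex list" where
  "klein_block a b c d s t = klein_orbit ((a + b + c + d) / 4) ((a + b - c - d) / 4 * s)
     ((a - b + c - d) / 4 * t) ((a - b - c + d) / 4 * (s * t))"

text \<open>A block of four roots consumes the two parameters \<open>s j\<close> and
  \<open>s (Suc j)\<close>; up to three remaining roots are kept constant.\<close>

fun klein_family :: "complex list \<Rightarrow> nat \<Rightarrow> (nat \<Rightarrow> complex) \<Rightarrow> complex list" where
  "klein_family (a # b # c # d # zs) j s = klein_block a b c d (s j) (s (Suc j)) @ klein_family zs (Suc (Suc j)) s"
| "klein_family [] j s = []"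
| "klein_family [a] j s = [a]"
| "klein_family [a, b] j s = [a, b]"
| "klein_family [a, b, c] j s = [a, b, c]"

lemma length_klein_block: "length (klein_block a b c d s t) = 4"
  by (simp add: klein_block_def klein_orbit_def)

lemma length_klein_family: "length (klein_family zs j s) = length zs"
  by (induction zs j s rule: klein_family.induct) (auto simp: length_klein_block)

lemma klein_family_one: "klein_family zs j (\<lambda>_. 1) = zs"
proof (induction zs j "\<lambda>_::nat. 1::complex" rule: klein_family.induct)
  case (1 a b c d zs j)
  have "klein_block a b c d 1 1 = [a, b, c, d]" by (simp add: klein_block_def klein_orbit_def field_simps)
  then show ?case using 1 by simp
qed simp_all

text \<open>A sign change of \<open>s\<close> or of \<open>t\<close> also changes
  \<open>s * t\<close>, so it changes two of the three variable terms, which is a double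
  transposition of the roots.\<close>

lemma klein_block_flip:
  assumes "s' = s \<or> s' = - s" "t' = t \<or> t' = - t"
  shows "mset (klein_block a b c d s' t') = mset (klein_block a b c d s t)"
    "root_vandermonde (klein_block a b c d s' t') = root_vandermonde (klein_block a b c d s t)"
proof -
  have m: "mset (klein_block a b c d (- s) t) = mset (klein_block a b c d s t)"
    "mset (klein_block a b c d s (- t)) = mset (klein_block a b c d s t)" for s t
    using mset_klein_orbit by (simp_all add: klein_block_def)
  have "mset (klein_block a b c d s' t') = mset (klein_block a b c d s t')"
    using assms(1) m(1) by auto
  also have "\<dots> = mset (klein_block a b c d s t)" using assms(2) m(2) by auto
  finally show "mset (klein_block a b c d s' t') = mset (klein_block a b c d s t)" .
  have sq: "s'\<^sup>2 = s\<^sup>2" "t'\<^sup>2 = t\<^sup>2" using assms by auto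
  show "root_vandermonde (klein_block a b c d s' t') = root_vandermonde (klein_block a b c d s t)"
    by (simp only: klein_block_def root_vandermonde_klein_orbit power_mult_distrib sq)
qed

text \<open>The Klein four-group acts on distinct entries without fixed points, so watching the
  first entry is enough.\<close>

lemma hd_klein_orbit_neq:
  assumes "distinct (klein_orbit p q r w)"
  shows "hd (klein_orbit p (- q) r (- w)) \<noteq> hd (klein_orbit p q r w)"
    "hd (klein_orbit p q (- r) (- w)) \<noteq> hd (klein_orbit p q r w)"
    "hd (klein_orbit p (- q) (- r) w) \<noteq> hd (klein_orbit p q r w)"
proof -
  have A: "p + q + r + w \<noteq> p - q + r - w" "p + q + r + w \<noteq> p + q - r - w" "p + q + r + w \<noteq> p - q - r + w"
    using assms unfolding klein_orbit_def by (simp_all only: distinct.simps list.set insert_iff de_Morgan_disj simp_thms)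
  show "hd (klein_orbit p (- q) r (- w)) \<noteq> hd (klein_orbit p q r w)"
    "hd (klein_orbit p q (- r) (- w)) \<noteq> hd (klein_orbit p q r w)"
    "hd (klein_orbit p (- q) (- r) w) \<noteq> hd (klein_orbit p q r w)"
    unfolding klein_orbit_def list.sel add_uminus_conv_diff by (rule A[symmetric])+
qed

lemma klein_family_flip:
  "mset (klein_family zs j (flip u s)) = mset (klein_family zs j s) \<and>
   root_vandermonde (klein_family zs j (flip u s)) = root_vandermonde (klein_family zs j s)"
proof (induction zs j s rule: klein_family.induct)
  case (1 a b c d zs j s)
  have f: "flip u s i = s i \<or> flip u s i = - s i" for i by (simp add: flip_def)
  note k = klein_block_flip[OF f[of j] f[of "Suc j"]]
  show ?case
    using 1 k(1)[of a b c d]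
      root_vandermonde_append_cong[OF k(1) conjunct1[OF 1] k(2) conjunct2[OF 1]] by simp
qed simp_all

text \<open>Ordered lists are compared, since the multisets agree. In the first block with a changed
  parameter the first root moves.\<close>

lemma klein_family_flip_neq:
  assumes "j \<le> i" "i < j + 2 * (length zs div 4)" "odd (u i)" "distinct (klein_family zs j s)"
  shows "klein_family zs j (flip u s) \<noteq> klein_family zs j s"
  using assms
proof (induction zs j s rule: klein_family.induct)
  case (1 a b c d zs j s)
  define s' where "s' = flip u s j"
  define t' where "t' = flip u s (Suc j)"
  have dist: "distinct (klein_block a b c d (s j) (s (Suc j)))" "distinct (klein_family zs (Suc (Suc j)) s)"
    using 1(5) by auto
  have fam: "klein_family (a # b # c # d # zs) j (flip u s) = klein_block a b c d s' t' @ klein_family zs (Suc (Suc j)) (flip u s)"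
    by (simp add: s'_def t'_def)
  show ?case
  proof (cases "odd (u j) \<or> odd (u (Suc j))")
    case True
    then have "s' = - s j \<and> t' = s (Suc j) \<or> s' = - s j \<and> t' = - s (Suc j) \<or> s' = s j \<and> t' = - s (Suc j)"
      by (auto simp: s'_def t'_def flip_def)
    then have "hd (klein_block a b c d s' t') \<noteq> hd (klein_block a b c d (s j) (s (Suc j)))"
      using hd_klein_orbit_neq[OF dist(1)[unfolded klein_block_def]]
      by (elim disjE conjE) (simp_all add: klein_block_def)
    moreover have "hd (klein_block a b c d x y @ zs') = hd (klein_block a b c d x y)" for x y zs'
      by (simp add: klein_block_def klein_orbit_def)
    ultimately have "hd (klein_family (a # b # c # d # zs) j (flip u s)) \<noteq> hd (klein_family (a # b # c # d # zs) j s)"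
      by (simp add: s'_def t'_def)
    then show ?thesis by (rule contrapos_nn) (rule arg_cong)
  next
    case False
    then have "i \<noteq> j" "i \<noteq> Suc j" using 1(4) by auto
    moreover have "j \<le> i" "i < j + 2 * (length (a # b # c # d # zs) div 4)" using 1(2,3) by auto
    ultimately have "Suc (Suc j) \<le> i" "i < Suc (Suc j) + 2 * (length zs div 4)" by auto
    from 1(1)[OF this 1(4) dist(2)] show ?thesis
      unfolding fam klein_family.simps(1) by (simp add: length_klein_block)
  qed
qed auto

lemma klein_family_poly:
  assumes "j \<ge> 1" "j + 2 * (length zs div 4) \<le> Suc m" "i < length zs"
  shows "(\<lambda>s. klein_family zs j s ! i) \<in> poly_functions m"
proof -
  note A = fun_algebra_poly_functions[of m]
  have "\<forall>i<length zs. (\<lambda>s. klein_family zs j s ! i) \<in> poly_functions m"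
    if "j \<ge> 1" "j + 2 * (length zs div 4) \<le> Suc m" for zs j
    using that
  \<comment> \<open>The parameter argument of the recursion is filled with a dummy, as the functions
    in the claim bind their own \<open>s\<close>.\<close>
  proof (induction zs j "\<lambda>_::nat. 0::complex" rule: klein_family.induct)
    case (1 a b c d zs j)
    have j: "(\<lambda>s. s j) \<in> poly_functions m" "(\<lambda>s. s (Suc j)) \<in> poly_functions m"
      using 1(2,3) by (auto intro!: poly_functions.coord)
    have blk: "(\<lambda>s. klein_block a b c d (s j) (s (Suc j)) ! k) \<in> poly_functions m" if "k < 4" for k
    proof -
      have "k = 0 \<or> k = 1 \<or> k = 2 \<or> k = 3" using that by auto
      then show ?thesis
        by (elim disjE)
          (simp_all only: klein_block_def klein_orbit_def nth_Cons_0 nth_Cons_Suc numeral_2_eq_2 numeral_3_eq_3 One_nat_def,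
            (intro fa_add[OF A] fa_diff[OF A] fa_mult[OF A] fa_const[OF A] j)+)
    qed
    have "Suc (Suc j) + 2 * (length zs div 4) \<le> Suc m" using 1(3) by simp
    then have IH: "\<forall>i<length zs. (\<lambda>s. klein_family zs (Suc (Suc j)) s ! i) \<in> poly_functions m"
      using 1(1) by simp
    show ?case
    proof (intro allI impI)
      fix i assume i: "i < length (a # b # c # d # zs)"
      show "(\<lambda>s. klein_family (a # b # c # d # zs) j s ! i) \<in> poly_functions m"
      proof (cases "i < 4")
        case True
        then show ?thesis using blk[OF True] by (simp add: nth_append length_klein_block)
      next
        case False
        have "i - 4 < length zs" using i False by simp
        then show ?thesis using IH False by (simp add: nth_append length_klein_block)
      qed
    qed
  qed (auto simp: less_Suc_eq intro: fa_const[OF A])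
  then show ?thesis using assms by blast
qed

section \<open>Points of the discriminant variety from lists of roots\<close>

definition root_poly :: "complex list \<Rightarrow> complex poly" where
  "root_poly zs = (\<Prod>z\<leftarrow>zs. [:- z, 1:])"

text \<open>The first component uses the indexing of \<open>generic_poly\<close> and is symmetric in
  the roots; their order enters only through the sign of the second component.\<close>

definition root_point :: "complex list \<Rightarrow> (nat \<Rightarrow> complex) \<times> complex" where
  "root_point zs =
     (\<lambda>i. if i \<in> {1..length zs} then Polynomial.coeff (root_poly zs) (length zs - i) else 0, root_vandermonde zs)"

lemma root_poly_monic: "degree (root_poly zs) = length zs" "Polynomial.coeff (root_poly zs) (length zs) = 1"
proof -
  have "degree (root_poly zs) = length zs \<and> lead_coeff (root_poly zs) = 1"
  proof (induction zs)
    case (Cons z zs)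
    have r: "root_poly (z # zs) = [:- z, 1:] * root_poly zs" by (simp add: root_poly_def)
    have "root_poly zs \<noteq> 0" using Cons by auto
    then have "degree (root_poly (z # zs)) = Suc (length zs)"
      unfolding r using Cons by (subst degree_mult_eq) auto
    moreover have "lead_coeff (root_poly (z # zs)) = 1" 
      unfolding r lead_coeff_mult conjunct2[OF Cons] by simp
    ultimately show ?case unfolding length_Cons by (rule conjI)
  qed (simp add: root_poly_def)
  note dl = this
  show "degree (root_poly zs) = length zs" by (rule conjunct1[OF dl])
  show "Polynomial.coeff (root_poly zs) (length zs) = 1" using conjunct2[OF dl] unfolding conjunct1[OF dl] .
qed

lemma poly_root_poly: "poly (root_poly zs) t = (\<Prod>z\<leftarrow>zs. t - z)"
  unfolding root_poly_def by (induction zs) (auto simp: algebra_simps)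

lemma coeff_generic_poly:
  "Polynomial.coeff (generic_poly n x) k = (if k = n then 1 else if k < n then x (n - k) else 0)"
proof -
  have "Polynomial.coeff (generic_poly n x) k = (if k = n then 1 else 0) + (\<Sum>i=1..n. if n - i = k then x i else 0)"
    by (simp add: generic_poly_def coeff_sum)
  also have "(\<Sum>i=1..n. if n - i = k then x i else 0) = (\<Sum>i\<in>{i\<in>{1..n}. n - i = k}. x i)"
    by (rule sum.inter_filter[symmetric]) simp
  also have "{i\<in>{1..n}. n - i = k} = (if k < n then {n - k} else {})" by auto
  finally show ?thesis by auto
qed

lemma generic_poly_root_point:
  assumes "length zs = n"
  shows "generic_poly n (fst (root_point zs)) = root_poly zs"
proof (rule poly_eqI)
  fix k
  show "Polynomial.coeff (generic_poly n (fst (root_point zs))) k = Polynomial.coeff (root_poly zs) k"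
    using root_poly_monic[of zs] assms by (auto simp: coeff_generic_poly root_point_def coeff_eq_0)
qed

lemma root_point_in_disc_variety:
  assumes "length zs = n"
  shows "root_point zs \<in> points (disc_variety n)"
proof -
  have "discriminant (generic_poly n (fst (root_point zs))) = (snd (root_point zs))\<^sup>2"
    unfolding generic_poly_root_point[OF assms] root_poly_def discriminant_eq root_vandermonde_square
    by (simp add: root_point_def)
  moreover have "fst (root_point zs) \<in> affine_points n"
    using assms by (simp add: affine_points_def root_point_def)
  ultimately show ?thesis unfolding points_disc_variety by (simp add: split_beta')
qed

text \<open>Any list of the roots gives \<open>d\<close> up to sign, and exchanging its first two
  entries corrects a wrong sign; this is where two roots are required.\<close>

lemma disc_variety_root_point:
  assumes p: "p \<in> points (disc_variety n)" and n: "n \<ge> 2"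
  shows "\<exists>zs. length zs = n \<and> root_point zs = p"
proof -
  obtain x d where xd: "p = (x, d)" "x \<in> affine_points n" "d\<^sup>2 = discriminant (generic_poly n x)"
    using p unfolding points_disc_variety by blast
  let ?P = "generic_poly n x"
  have "degree ?P = n"
    by (rule antisym) (auto intro!: degree_le le_degree simp: coeff_generic_poly)
  moreover from this have "lead_coeff ?P = 1" by (simp add: coeff_generic_poly)
  moreover obtain zs where "Polynomial.smult (lead_coeff ?P) (\<Prod>a\<leftarrow>zs. [:- a, 1:]) = ?P" "length zs = degree ?P"
    using fundamental_theorem_algebra_factorized[of ?P] by blast
  ultimately have zs: "root_poly zs = ?P" "length zs = n" by (auto simp: root_poly_def)
  have fst_eq: "fst (root_point ws) = x" if "root_poly ws = ?P" "length ws = n" for ws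
  proof
    fix i
    show "fst (root_point ws) i = x i"
      using xd(2) that by (cases "i \<in> {1..n}") (auto simp: root_point_def coeff_generic_poly affine_points_def)
  qed
  have "d\<^sup>2 = (root_vandermonde zs)\<^sup>2"
    using xd(3) unfolding zs(1)[symmetric] root_poly_def discriminant_eq root_vandermonde_square by simp
  then consider "d = root_vandermonde zs" | "d = - root_vandermonde zs" by (auto simp: power2_eq_iff)
  then show ?thesis
  proof cases
    case 1
    then have "snd (root_point zs) = d" by (simp add: root_point_def)
    then have "root_point zs = p" using fst_eq[OF zs] xd(1) by (simp add: prod_eq_iff)
    then show ?thesis using zs(2) by blast
  next
    case 2
    obtain a b ws where ws: "zs = a # b # ws" using zs(2) n by (cases zs; cases "tl zs") auto
    let ?ys = "b # a # ws"
    have "root_poly ?ys = root_poly zs"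
      by (simp only: ws root_poly_def list.map prod_list.Cons mult.left_commute)
    then have y: "root_poly ?ys = ?P" "length ?ys = n" using zs by (auto simp: ws)
    have "snd (root_point ?ys) = d" using 2 by (simp add: root_point_def ws algebra_simps)
    then have "root_point ?ys = p" using fst_eq[OF y] xd(1) by (simp add: prod_eq_iff)
    then show ?thesis using y(2) by blast
  qed
qed

lemma af_values_root_point:
  assumes "length zs = n" "z \<in> set zs"
  shows "z \<in> af_values (root_function n) (root_point zs)"
proof -
  have "poly (generic_poly n (fst (root_point zs))) z = 0"
    unfolding generic_poly_root_point[OF assms(1)] poly_root_poly using assms(2) by (auto simp: prod_list_zero_iff)
  then have "z ^ n + (\<Sum>i=1..n. fst (root_point zs) i * z ^ (n - i)) = 0"
    by (simp add: generic_poly_def poly_monom poly_sum)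
  then show ?thesis
    using af_values_root_function[of "fst (root_point zs)" "snd (root_point zs)" n] root_point_in_disc_variety[OF assms(1)]
    by simp
qed

section \<open>Pulling back functions on the discriminant variety\<close>

lemma poly_in_algebra:
  assumes "fun_algebra P" "d \<in> P"
  shows "(\<lambda>x. poly q (d x)) \<in> P"
  unfolding poly_altdef by (intro fa_sum[OF assms(1)] fa_mult[OF assms(1)] fa_const[OF assms(1)] fa_power[OF assms])

lemma root_vandermonde_in_algebra:
  assumes P: "fun_algebra P" and G: "set G \<subseteq> P"
  shows "(\<lambda>x. root_vandermonde (map (\<lambda>g. g x) G)) \<in> P"
  using G
proof (induction G)
  case Nil
  show ?case using fa_const[OF P, of 1] by simp
next
  case (Cons g G)
  have "(\<lambda>x. \<Prod>z\<leftarrow>map (\<lambda>g. g x) H. g x - z) \<in> P" if "set H \<subseteq> P" for H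
    using that
  proof (induction H)
    case Nil
    show ?case using fa_const[OF P, of 1] by simp
  next
    case (Cons h H)
    have "(\<lambda>x. g x - h x) \<in> P" using \<open>set (g # G) \<subseteq> P\<close> Cons.prems by (intro fa_diff[OF P]) auto
    moreover have "(\<lambda>x. \<Prod>z\<leftarrow>map (\<lambda>g. g x) H. g x - z) \<in> P" using Cons by simp
    ultimately show ?case using fa_mult[OF P] by simp
  qed
  then have "(\<lambda>x. \<Prod>z\<leftarrow>map (\<lambda>g. g x) G. g x - z) \<in> P" using Cons.prems by simp
  moreover have "(\<lambda>x. root_vandermonde (map (\<lambda>g. g x) G)) \<in> P" using Cons by simp
  ultimately show ?case using fa_mult[OF P] by simp
qed

lemma root_poly_coeffs_in:
  assumes P: "fun_algebra P" and G: "set G \<subseteq> P"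
  shows "coeffs_in P (\<lambda>x. root_poly (map (\<lambda>g. g x) G))"
  using G
proof (induction G)
  case Nil
  show ?case using coeffs_in_const[OF P, of 1] by (simp add: root_poly_def)
next
  case (Cons g G)
  have r: "root_poly (map (\<lambda>g. g x) (g # G)) = [:- g x, 1:] * root_poly (map (\<lambda>g. g x) G)" for x
    by (simp add: root_poly_def)
  have "(\<lambda>x. - g x) \<in> P" using Cons.prems by (intro fa_uminus[OF P]) auto
  then have "coeffs_in P (\<lambda>x. [:- g x, 1:])"
    by (rule coeffs_in_pCons[OF P _ coeffs_in_const[OF P]])
  moreover have "coeffs_in P (\<lambda>x. root_poly (map (\<lambda>g. g x) G))" using Cons by simp
  ultimately show ?case unfolding r by (rule coeffs_in_mult[OF P])
qed

definition disc_algebra :: "nat \<Rightarrow> ((nat \<Rightarrow> complex) \<times> complex \<Rightarrow> complex) set" where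
  "disc_algebra n = product_algebra (poly_functions n) (range poly)"

lemma presented_disc_variety: "presented_by (disc_variety n) (disc_algebra n)"
  unfolding disc_variety_def disc_algebra_def
  by (intro presented_sub_space presented_prod_space presented_affine_space presented_affine_line)

text \<open>The coefficients and the product of differences are polynomial in the roots, so an
  algebra containing the root functions contains these pullbacks.\<close>

lemma root_point_pullback:
  assumes P: "fun_algebra P" and G: "set G \<subseteq> P" and f: "f \<in> disc_algebra n"
  shows "(\<lambda>x. f (root_point (map (\<lambda>g. g x) G))) \<in> P"
proof -
  let ?xi = "\<lambda>x. root_point (map (\<lambda>g. g x) G)"
  have "alg_gen ({\<lambda>x. f (fst x) | f. f \<in> poly_functions n} \<union> {\<lambda>x. g (snd x) | g. g \<in> range poly}) \<subseteq> {f. (\<lambda>x. f (?xi x)) \<in> P}"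
  proof (rule alg_gen_least[OF fun_algebra_vimage[OF P]], rule Un_least)
    show "{\<lambda>x. f (fst x) | f. f \<in> poly_functions n} \<subseteq> {f. (\<lambda>x. f (?xi x)) \<in> P}"
    proof
      fix h :: "(nat \<Rightarrow> complex) \<times> complex \<Rightarrow> complex" assume "h \<in> {\<lambda>x. f (fst x) | f. f \<in> poly_functions n}"
      then obtain f where f: "h = (\<lambda>x. f (fst x))" "f \<in> poly_functions n" by (elim CollectE exE conjE)
      have "(\<lambda>x. f (fst (?xi x))) \<in> P"
      proof (rule poly_functions_compose[OF f(2) P])
        fix i
        have "(\<lambda>x. Polynomial.coeff (root_poly (map (\<lambda>g. g x) G)) (length G - i)) \<in> P"
          using root_poly_coeffs_in[OF P G] by (simp add: coeffs_in_def)
        moreover have "(\<lambda>x. fst (?xi x) i) = (if i \<in> {1..length G}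
          then (\<lambda>x. Polynomial.coeff (root_poly (map (\<lambda>g. g x) G)) (length G - i)) else (\<lambda>_. 0))"
          by (auto simp: root_point_def)
        ultimately show "(\<lambda>x. fst (?xi x) i) \<in> P" using fa_const[OF P, of 0] by (simp split: if_split)
      qed
      then show "h \<in> {f. (\<lambda>x. f (?xi x)) \<in> P}" by (simp add: f(1))
    qed
    show "{\<lambda>x. g (snd x) | g. g \<in> range poly} \<subseteq> {f. (\<lambda>x. f (?xi x)) \<in> P}"
    proof
      fix h :: "(nat \<Rightarrow> complex) \<times> complex \<Rightarrow> complex" assume "h \<in> {\<lambda>x. g (snd x) | g. g \<in> range poly}"
      then obtain g where "h = (\<lambda>x. g (snd x))" "g \<in> range poly" by (elim CollectE exE conjE)
      then obtain q where q: "h = (\<lambda>x. poly q (snd x))" by blast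
      show "h \<in> {f. (\<lambda>x. f (?xi x)) \<in> P}"
        unfolding q using poly_in_algebra[OF P root_vandermonde_in_algebra[OF P G], of q] by (simp add: root_point_def)
    qed
  qed
  then show ?thesis using f unfolding disc_algebra_def product_algebra_def by blast
qed

text \<open>Some point of \<open>U\<close> is deformed along a line of root lists; membership in
  \<open>U\<close> and distinctness each fail for finitely many parameter values only.\<close>

lemma disc_variety_open_distinct:
  assumes U: "zariski_open (disc_variety n) U" and n: "n \<ge> 2"
  shows "\<exists>zs. length zs = n \<and> distinct zs \<and> root_point zs \<in> U"
proof -
  have oU: "openin (zar (disc_variety n)) U" and "U \<noteq> {}" using U by (auto simp: zariski_open_def)
  then obtain p where p: "p \<in> U" by blast
  then obtain zs where zs: "length zs = n" "root_point zs = p"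
    using disc_variety_root_point[OF _ n] openin_subset[OF oU] by blast
  obtain h where h: "h \<in> disc_algebra n" "h p \<noteq> 0" "\<forall>q\<in>points (disc_variety n). h q \<noteq> 0 \<longrightarrow> q \<in> U"
    using presented_byD(2)[OF presented_disc_variety oU p] by blast
  \<comment> \<open>Moving the root with index \<open>i\<close> at speed \<open>i\<close> makes any
    two roots coincide at most once, and \<open>x = 0\<close> is the given point.\<close>
  define G where "G = map (\<lambda>i x. zs ! i + x * of_nat i) [0..<n]"
  have "set G \<subseteq> range poly"
  proof
    fix g assume "g \<in> set G"
    then obtain i where "g = (\<lambda>x. zs ! i + x * of_nat i)" by (auto simp: G_def)
    then have "g = poly [:zs ! i, of_nat i:]" by auto
    then show "g \<in> range poly" by (rule image_eqI) simp
  qed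
  from root_point_pullback[OF fun_algebra_range_poly this h(1)]
  have hp: "(\<lambda>x. h (root_point (map (\<lambda>g. g x) G))) \<in> range poly" .
  have G0: "map (\<lambda>g. g 0) G = zs" by (rule nth_equalityI) (simp_all add: G_def zs(1))
  have f1: "finite {x. h (root_point (map (\<lambda>g. g x) G)) = 0}"
    by (rule range_poly_finite_zeros[OF hp, of 0]) (simp add: G0 zs h)
  \<comment> \<open>These include all \<open>x\<close> at which two entries collide; diagonal pairs
    contribute only \<open>0 / 0 = 0\<close>.\<close>
  have f2: "finite ((\<lambda>(i, j). (zs ! i - zs ! j) / (of_nat j - of_nat i)) ` ({..<n} \<times> {..<n}))" by simp
  from ex_new_if_finite[OF infinite_UNIV_char_0 finite_UnI[OF f1 f2]]
  obtain x where x: "h (root_point (map (\<lambda>g. g x) G)) \<noteq> 0"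
    "x \<notin> (\<lambda>(i, j). (zs ! i - zs ! j) / (of_nat j - of_nat i)) ` ({..<n} \<times> {..<n})" by blast
  let ?ws = "map (\<lambda>g. g x) G"
  have lG: "length G = n" by (simp add: G_def)
  then have len: "length ?ws = n" by simp
  have "distinct ?ws"
    unfolding distinct_conv_nth
  proof (intro allI impI)
    fix i j assume ij: "i < length ?ws" "j < length ?ws" "i \<noteq> j"
    show "?ws ! i \<noteq> ?ws ! j"
    proof
      assume "?ws ! i = ?ws ! j"
      then have "zs ! i + x * of_nat i = zs ! j + x * of_nat j" using ij by (simp add: G_def)
      then have "x = (zs ! i - zs ! j) / (of_nat j - of_nat i)"
        using ij(3) by (simp add: field_simps)
      then have "x \<in> (\<lambda>(i, j). (zs ! i - zs ! j) / (of_nat j - of_nat i)) ` ({..<n} \<times> {..<n})"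
        using ij lG by (intro image_eqI[of _ _ "(i, j)"]) auto
      then show False using x(2) by simp
    qed
  qed
  moreover have "root_point ?ws \<in> U" using h(3) x(1) root_point_in_disc_variety[OF len] by blast
  ultimately show ?thesis using len by blast
qed

text \<open>The algebra is generated by \<open>y\<close> and the \<open>m\<close> coordinates, so it
  is Noetherian.\<close>

lemma poly_functions_line_subcover:
  assumes "S \<subseteq> poly_functions_line m"
  shows "\<exists>T. finite T \<and> T \<subseteq> S \<and> (\<forall>x. (\<exists>f\<in>S. f x \<noteq> 0) \<longrightarrow> (\<exists>f\<in>T. f x \<noteq> 0))"
proof -
  let ?G = "insert snd ((\<lambda>i x. fst x i) ` {1..m}) :: ((nat \<Rightarrow> complex) \<times> complex \<Rightarrow> complex) set"
  have "poly_functions_line m \<subseteq> alg_gen ?G"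
    unfolding poly_functions_line_def
  proof (rule alg_gen_least[OF fun_algebra_alg_gen], rule insert_subsetI)
    show "snd \<in> alg_gen ?G" by (rule alg_gen.gen) simp
    show "{\<lambda>x. f (fst x) | f. f \<in> poly_functions m} \<subseteq> alg_gen ?G"
    proof
      fix h :: "(nat \<Rightarrow> complex) \<times> complex \<Rightarrow> complex" assume "h \<in> {\<lambda>x. f (fst x) | f. f \<in> poly_functions m}"
      then obtain f where f: "h = (\<lambda>x. f (fst x))" "f \<in> poly_functions m" by (elim CollectE exE conjE)
      show "h \<in> alg_gen ?G" unfolding f(1)
        by (rule poly_functions_compose[OF f(2) fun_algebra_alg_gen]) (auto intro!: alg_gen.gen)
    qed
  qed
  then have "S \<subseteq> alg_gen ?G" using assms by blast
  from noetherian_finite_subcover[OF noetherian_finitely_generated this] show ?thesis by simp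
qed

section \<open>The resolvent theorem\<close>

lemma openin_sub_spaceD:
  "openin (zar (sub_space X V)) U \<Longrightarrow> openin (zar X) V \<Longrightarrow> openin (zar X) U"
  by (auto simp: sub_space_def openin_subtopology)

theorem theorem18:
  fixes n :: nat and Y :: "'b fspace" and E :: "'b set" and w :: "('b, 'c) alg_fun"
  assumes "n \<ge> 1"
    and "irreducible_variety Y"
    and "zariski_open Y E"
    and "algebraic_function (sub_space Y E) w"
    and "krull_dim (zar Y) < enat (2 * (n div 4))"
  shows "\<not> rationally_induced (disc_variety n) (points (disc_variety n)) (root_function n) Y E w"
proof
  let ?X = "disc_variety n"
  assume "rationally_induced ?X (points ?X) (root_function n) Y E w"
  then obtain U Vr r W R where U: "zariski_open ?X U" and r: "rational_map ?X Y Vr r"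
    and R: "rational_function (prod_space ?X affine_line) W R"
    and dfd: "\<forall>x\<in>U. x \<in> points ?X \<and> x \<in> Vr \<and> r x \<in> E \<and> (\<forall>t\<in>af_values w (r x). (x, t) \<in> W)"
    and branch: "\<forall>x\<in>U. af_values (root_function n) x \<subseteq> (\<lambda>t. R (x, t)) ` af_values w (r x)"
    unfolding rationally_induced_def by (elim exE conjE)
  define m where "m = 2 * (n div 4)"
  \<comment> \<open>For \<open>n < 4\<close> the assumed bound would say that a dimension is below
    0.\<close>
  have "m \<noteq> 0"
  proof
    assume "m = 0"
    then have "krull_dim (zar Y) < 0" using assms(5) by (simp add: m_def zero_enat_def)
    then show False by simp
  qed
  then have n4: "n \<ge> 4" by (simp add: m_def)
  \<comment> \<open>The family built on \<open>zs\<close> passes through this point of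
    \<open>U\<close> at the parameter \<open>one\<close>; distinctness there makes its roots
    distinct generically.\<close>
  obtain zs where zs: "length zs = n" "distinct zs" "root_point zs \<in> U"
    using disc_variety_open_distinct[OF U] n4 by auto
  define one :: "nat \<Rightarrow> complex" where "one = (\<lambda>_. 1)"
  define G where "G = map (\<lambda>i s. klein_family zs 1 s ! i) [0..<n]"
  define \<xi> where "\<xi> s = root_point (klein_family zs 1 s)" for s
  define \<phi> where "\<phi> s = r (\<xi> s)" for s
  note A = fun_algebra_poly_functions[of m]
  have Gm: "map (\<lambda>g. g s) G = klein_family zs 1 s" for s
    by (rule nth_equalityI) (simp_all add: G_def length_klein_family zs(1))
  have GP: "set G \<subseteq> poly_functions m"
  proof
    fix g assume "g \<in> set G"
    then obtain i where "i < n" "g = (\<lambda>s. klein_family zs 1 s ! i)" by (auto simp: G_def)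
    then show "g \<in> poly_functions m" using klein_family_poly[of 1 zs m i] zs(1) by (simp add: m_def)
  qed
  have \<xi>pull: "(\<lambda>s. f (\<xi> s)) \<in> poly_functions m" if "f \<in> disc_algebra n" for f
    using root_point_pullback[OF A GP that] unfolding Gm \<xi>_def .
  have \<xi>pts: "\<xi> s \<in> points ?X" for s
    unfolding \<xi>_def by (rule root_point_in_disc_variety) (simp add: length_klein_family zs(1))
  have \<xi>flip: "\<xi> (flip u s) = \<xi> s" for u s
  proof -
    have ms: "mset (klein_family zs 1 (flip u s)) = mset (klein_family zs 1 s)"
      and vd: "root_vandermonde (klein_family zs 1 (flip u s)) = root_vandermonde (klein_family zs 1 s)"
      using klein_family_flip[of zs 1 u s] by auto
    have "root_poly (klein_family zs 1 (flip u s)) = root_poly (klein_family zs 1 s)"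
      using arg_cong[OF ms, of "\<lambda>M. prod_mset (image_mset (\<lambda>z. [:- z, 1:]) M)"]
      unfolding root_poly_def by (simp flip: prod_mset_prod_list)
    then show ?thesis using vd by (simp only: \<xi>_def root_point_def length_klein_family)
  qed
  have \<xi>1: "\<xi> one = root_point zs" by (simp add: \<xi>_def one_def klein_family_one)
  have pull_open: "\<exists>h\<in>poly_functions m. h s \<noteq> 0 \<and> (\<forall>s'. h s' \<noteq> 0 \<longrightarrow> \<xi> s' \<in> O')"
    if O': "openin (zar ?X) O'" "\<xi> s \<in> O'" for O' s
  proof -
    obtain h where h: "h \<in> disc_algebra n" "h (\<xi> s) \<noteq> 0" "\<forall>q\<in>points ?X. h q \<noteq> 0 \<longrightarrow> q \<in> O'"
      using presented_byD(2)[OF presented_disc_variety O'] by blast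
    show ?thesis
      by (rule bexI[OF _ \<xi>pull[OF h(1)]]) (use h \<xi>pts in blast)
  qed
  have Vr: "openin (zar ?X) Vr" and rm: "morphism (sub_space ?X Vr) Y r"
    using r by (auto simp: rational_map_def zariski_open_def)
  have pVr: "points (sub_space ?X Vr) = Vr" using openin_subset[OF Vr] by auto
  have r_open: "openin (zar ?X) {x \<in> Vr. r x \<in> O'}" if "openin (zar Y) O'" for O'
  proof -
    have "openin (zar (sub_space ?X Vr)) {x \<in> points (sub_space ?X Vr). r x \<in> O'}"
      using rm that unfolding morphism_def continuous_map_def by (elim conjE) (drule spec, drule mp)
    then show ?thesis unfolding pVr by (rule openin_sub_spaceD[OF _ Vr])
  qed
  have \<phi>_open: "\<exists>h\<in>poly_functions m. h s \<noteq> 0 \<and> (\<forall>s'. h s' \<noteq> 0 \<longrightarrow> \<xi> s' \<in> Vr \<and> \<phi> s' \<in> O')"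
    if "openin (zar Y) O'" "\<xi> s \<in> Vr" "\<phi> s \<in> O'" for O' s
    using pull_open[OF r_open[OF that(1)], of s] that(2,3) by (simp add: \<phi>_def)
  let ?YE = "sub_space Y E"
  have E: "openin (zar Y) E" using assms(3) by (simp add: zariski_open_def)
  have pYE: "points ?YE = E" using openin_subset[OF E] by auto
  have \<xi>1U: "\<xi> one \<in> U" "\<xi> one \<in> Vr" "\<phi> one \<in> E" using zs(3) dfd \<xi>1 by (auto simp: \<phi>_def)
  have "\<phi> one \<in> points ?YE" using \<xi>1U(3) pYE by simp
  \<comment> \<open>A neighbourhood \<open>V\<close> of the image of the base point suffices: the
    parameters mapped into it include the nonvanishing locus of a polynomial, which large spirals
    never leave.\<close>
  from covering_values_integral[OF assms(4) this]
  obtain V D q where V: "openin (zar ?YE) V" "\<phi> one \<in> V" "affine_variety (sub_space ?YE V)" and D: "D \<ge> 1"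
    and q: "\<forall>k<D. q k \<in> alg_gen (reg ?YE V)" and qw: "\<forall>y\<in>V. \<forall>t\<in>af_values w y. monic_val D q y t = 0"
    by (elim exE conjE)
  have VY: "openin (zar Y) V" by (rule openin_sub_spaceD[OF V(1) E])
  obtain h1 where h1: "h1 \<in> poly_functions m" "h1 one \<noteq> 0" "\<forall>s. h1 s \<noteq> 0 \<longrightarrow> \<xi> s \<in> U"
    using pull_open[of U one] U \<xi>1U(1) unfolding zariski_open_def by blast
  obtain h2 where h2: "h2 \<in> poly_functions m" "h2 one \<noteq> 0" "\<forall>s. h2 s \<noteq> 0 \<longrightarrow> \<xi> s \<in> Vr \<and> \<phi> s \<in> V"
    using \<phi>_open[OF VY \<xi>1U(2) V(2)] by blast
  define H where "H s = h1 s * h2 s" for s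
  have H: "H \<in> poly_functions m" "H one \<noteq> 0"
    unfolding H_def using h1 h2 by (auto intro: poly_functions.mult)
  have HU: "\<xi> s \<in> U" "\<xi> s \<in> Vr" "\<phi> s \<in> V" if "H s \<noteq> 0" for s
    using that h1(3) h2(3) by (auto simp: H_def)
  define F where "F = alg_gen (reg ?YE V)"
  have F: "fun_algebra F" unfolding F_def by (rule fun_algebra_alg_gen)
  have pV: "points (sub_space ?YE V) = V" using openin_subset[OF V(1)] by auto
  have F_open: "openin (zar Y) {y \<in> V. g y \<noteq> 0}" if g: "g \<in> F" for g
  proof -
    obtain F' where F': "fun_algebra F'" "reg (sub_space ?YE V) V \<subseteq> F'"
      "\<forall>h\<in>F'. openin (zar (sub_space ?YE V)) {y \<in> V. h y \<noteq> 0}"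
      using affine_variety_algebra[OF V(3)] unfolding pV by (elim exE conjE)
    have "reg ?YE V \<subseteq> F'" using reg_sub_space_self[OF V(1)] F'(2) by blast
    then have "F \<subseteq> F'" unfolding F_def by (rule alg_gen_least[OF F'(1)])
    then have "openin (zar (sub_space ?YE V)) {y \<in> V. g y \<noteq> 0}" using g F'(3) by blast
    from openin_sub_spaceD[OF openin_sub_spaceD[OF this V(1)] E] show ?thesis .
  qed
  have F_rat: "rational_fun m (\<lambda>s. g (\<phi> s))" if "g \<in> F" for g
  proof -
    have "reg ?YE V \<subseteq> {g. (\<lambda>s. g (\<phi> s)) \<in> {f. rational_fun m f}}"
    proof
      fix g assume g: "g \<in> reg ?YE V"
      \<comment> \<open>One representative near the base point is enough, since
        \<open>rational_fun\<close> asks for a fraction only on the nonvanishing locus of a single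
        polynomial.\<close>
      obtain O' g' where O': "openin (zar Y) O'" "\<phi> one \<in> O'" "g' \<in> reg Y O'" "\<forall>y\<in>O' \<inter> V. g y = g' y"
        using g V(2) by (auto simp: sub_space_def)
      have "g' \<circ> r \<in> reg (sub_space ?X Vr) {x \<in> points (sub_space ?X Vr). r x \<in> O'}"
        using rm O'(1,3) unfolding morphism_def by blast
      then have gr: "g' \<circ> r \<in> reg (sub_space ?X Vr) {x \<in> Vr. r x \<in> O'}" unfolding pVr .
      have op: "openin (zar (sub_space ?X Vr)) {x \<in> Vr. r x \<in> O'}"
        using r_open[OF O'(1)] unfolding sub_space_def fspace.simps openin_subtopology
        by (intro exI[of _ "{x \<in> Vr. r x \<in> O'}"]) auto
      have mem: "\<xi> one \<in> {x \<in> Vr. r x \<in> O'}" using \<xi>1U(2) O'(2) by (simp add: \<phi>_def)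
      obtain a b where ab: "a \<in> disc_algebra n" "b \<in> disc_algebra n" "b (\<xi> one) \<noteq> 0"
        "\<forall>x\<in>{x \<in> Vr. r x \<in> O'}. b x \<noteq> 0 \<longrightarrow> (g' \<circ> r) x = a x / b x"
        by (rule local_fractionE[OF presented_byD(3)[OF presented_sub_space[OF presented_disc_variety] op gr mem]])
      obtain h where h: "h \<in> poly_functions m" "h one \<noteq> 0" "\<forall>s. h s \<noteq> 0 \<longrightarrow> \<xi> s \<in> Vr \<and> \<phi> s \<in> O'"
        using \<phi>_open[OF O'(1) \<xi>1U(2) O'(2)] by blast
      \<comment> \<open>The common factor \<open>h s * H s\<close> restricts to parameters at which
        all representations apply.\<close>
      have "rational_fun m (\<lambda>s. g (\<phi> s))"
      proof (rule rational_funI[of "\<lambda>s. a (\<xi> s) * (h s * H s)" m "\<lambda>s. b (\<xi> s) * (h s * H s)" one])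
        show "(\<lambda>s. a (\<xi> s) * (h s * H s)) \<in> poly_functions m" "(\<lambda>s. b (\<xi> s) * (h s * H s)) \<in> poly_functions m"
          by (intro poly_functions.mult \<xi>pull ab h H)+
        show "b (\<xi> one) * (h one * H one) \<noteq> 0" using ab h H by simp
        fix s assume s: "b (\<xi> s) * (h s * H s) \<noteq> 0"
        then have nz: "b (\<xi> s) \<noteq> 0" "h s \<noteq> 0" "H s \<noteq> 0" by auto
        have "\<xi> s \<in> Vr" "\<phi> s \<in> O'" "\<phi> s \<in> V" using h(3) nz HU[OF nz(3)] by auto
        then have "g (\<phi> s) = g' (\<phi> s)" "g' (\<phi> s) = a (\<xi> s) / b (\<xi> s)"
          using O'(4) ab(4)[THEN bspec, of "\<xi> s"] nz(1) by (simp_all add: \<phi>_def)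
        then show "g (\<phi> s) = a (\<xi> s) * (h s * H s) / (b (\<xi> s) * (h s * H s))" using nz by simp
      qed
      then show "g \<in> {g. (\<lambda>s. g (\<phi> s)) \<in> {f. rational_fun m f}}" by simp
    qed
    then have "F \<subseteq> {g. (\<lambda>s. g (\<phi> s)) \<in> {f. rational_fun m f}}"
      unfolding F_def by (rule alg_gen_least[OF fun_algebra_vimage[OF fun_algebra_rational]])
    then show ?thesis using that by blast
  qed
  define Fp where "Fp = (\<lambda>g s. g (\<phi> s)) ` F"
  have Fp: "fun_algebra Fp"
  proof (rule fun_algebraI)
    show "(\<lambda>_. c) \<in> Fp" for c
      unfolding Fp_def by (rule image_eqI[of _ _ "\<lambda>_. c"]) (auto intro: fa_const[OF F])
    fix f g assume "f \<in> Fp" "g \<in> Fp"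
    then obtain f' g' where *: "f = (\<lambda>s. f' (\<phi> s))" "f' \<in> F" "g = (\<lambda>s. g' (\<phi> s))" "g' \<in> F"
      unfolding Fp_def by (elim imageE)
    show "(\<lambda>s. f s + g s) \<in> Fp"
      unfolding Fp_def by (rule image_eqI[OF _ fa_add[OF F *(2,4)]]) (simp add: *)
    show "(\<lambda>s. f s * g s) \<in> Fp"
      unfolding Fp_def by (rule image_eqI[OF _ fa_mult[OF F *(2,4)]]) (simp add: *)
  qed
  have Fp_rat: "\<forall>f\<in>Fp. rational_fun m f" unfolding Fp_def using F_rat by blast
  \<comment> \<open>The exponents of functions that come from \<open>Y\<close>. Full rank would
    contradict the dimension bound; otherwise an orthogonal direction exists.\<close>
  define L where "L = {v. \<exists>f\<in>Fp. leading m f v}"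
  consider v where "\<forall>j<m. v j \<in> L" "\<forall>c. (\<forall>i\<in>{1..m}. (\<Sum>j<m. c j * v j i) = (0::int)) \<longrightarrow> (\<forall>j<m. c j = 0)"
    | u where "\<exists>i\<in>{1..m}. u i \<noteq> 0" "\<forall>v\<in>L. pairing m u v = 0"
    using rank_dichotomy[of m L] by (elim disjE exE conjE)
  then show False
  proof cases
    case 1
    have "\<forall>j. \<exists>g. j < m \<longrightarrow> g \<in> F \<and> leading m (\<lambda>s. g (\<phi> s)) (v j)"
    proof
      fix j
      show "\<exists>g. j < m \<longrightarrow> g \<in> F \<and> leading m (\<lambda>s. g (\<phi> s)) (v j)"
      proof (cases "j < m")
        case True
        then have "\<exists>f\<in>Fp. leading m f (v j)" using 1(1) by (simp add: L_def)
        then obtain g where "g \<in> F" "leading m (\<lambda>s. g (\<phi> s)) (v j)" unfolding Fp_def by (elim bexE imageE) simp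
        then show ?thesis by (intro exI[of _ g]) simp
      qed simp
    qed
    from choice[OF this] obtain g where g: "\<forall>j. j < m \<longrightarrow> g j \<in> F \<and> leading m (\<lambda>s. g j (\<phi> s)) (v j)" by (elim exE)
    \<comment> \<open>The independent exponents are indexed from 0 and the coordinates from 1, hence
      the shifts by one.\<close>
    have "enat m \<le> krull_dim (zar Y)"
    proof (rule krull_dim_ge[where H = H and V = V and F = F and \<phi> = \<phi> and G = "\<lambda>i. g (i - 1)" and v = "\<lambda>i. v (i - 1)"])
      show "H \<in> poly_functions m" "H one \<noteq> 0" by (rule H)+
      show "\<phi> s \<in> V" if "H s \<noteq> 0" for s by (rule HU(3)[OF that])
      show "\<exists>h\<in>poly_functions m. h s \<noteq> 0 \<and> (\<forall>s'. h s' \<noteq> 0 \<longrightarrow> H s' \<noteq> 0 \<longrightarrow> \<phi> s' \<in> O')"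
        if "openin (zar Y) O'" "H s \<noteq> 0" "\<phi> s \<in> O'" for O' s
        using \<phi>_open[OF that(1) HU(2)[OF that(2)] that(3)] by blast
      show "V \<subseteq> points Y" by (rule openin_subset[OF VY])
      show "fun_algebra F" by (rule F)
      show "openin (zar Y) {y \<in> V. g y \<noteq> 0}" if "g \<in> F" for g by (rule F_open[OF that])
      show "rational_fun m (\<lambda>s. g (\<phi> s))" if "g \<in> F" for g by (rule F_rat[OF that])
      show "\<forall>i\<in>{1..m}. g (i - 1) \<in> F" "\<forall>i\<in>{1..m}. leading m (\<lambda>s. g (i - 1) (\<phi> s)) (v (i - 1))"
        using g by auto
      fix c :: "nat \<Rightarrow> int" assume c: "\<forall>i\<in>{1..m}. (\<Sum>j=1..m. c j * v (j - 1) i) = 0"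
      have "(\<Sum>j=1..m. c j * v (j - 1) i) = (\<Sum>j<m. c (Suc j) * v j i)" for i
        by (simp add: sum.atLeast1_atMost_eq)
      then have "\<forall>j<m. c (Suc j) = 0" using c 1(2)[THEN spec, of "\<lambda>j. c (Suc j)"] by simp
      then show "\<forall>j\<in>{1..m}. c j = 0" by (metis atLeastAtMost_iff Suc_le_eq One_nat_def Suc_pred)
    qed
    then show False using assms(5) by (simp add: m_def)
  next
    case 2
    from odd_orthogonal_vector[OF this] obtain u where
      u: "\<exists>i\<in>{1..m}. odd (u i)" "\<forall>v\<in>L. pairing m u v = 0" by (elim exE conjE)
    have Wo: "openin (zar (prod_space ?X affine_line)) W" and Rr: "R \<in> reg (prod_space ?X affine_line) W"
      using R by (auto simp: rational_function_def zariski_open_def)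
    let ?P = "product_algebra (disc_algebra n) (range poly)"
    have XA: "presented_by (prod_space ?X affine_line) ?P"
      by (intro presented_prod_space presented_disc_variety presented_affine_line)
    define pb where "pb A = (\<lambda>x. A (\<xi> (fst x), snd x))" for A :: "((nat \<Rightarrow> complex) \<times> complex) \<times> complex \<Rightarrow> complex"
    have pb: "pb A \<in> poly_functions_line m" if "A \<in> ?P" for A
    proof -
      note PL = fun_algebra_poly_functions_line[of m]
      have PLf: "(\<lambda>x. f (fst x)) \<in> poly_functions_line m" if "f \<in> poly_functions m" for f
        unfolding poly_functions_line_def by (rule alg_gen.gen) (use that in blast)
      have PLs: "snd \<in> poly_functions_line m" unfolding poly_functions_line_def by (rule alg_gen.gen) simp
      have "?P \<subseteq> {A. (\<lambda>x. A (\<xi> (fst x), snd x)) \<in> poly_functions_line m}"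
        unfolding product_algebra_def
      proof (rule alg_gen_least[OF fun_algebra_vimage[OF PL]], rule Un_least)
        show "{\<lambda>x. f (fst x) | f. f \<in> disc_algebra n} \<subseteq> {A. (\<lambda>x. A (\<xi> (fst x), snd x)) \<in> poly_functions_line m}"
        proof
          fix h :: "((nat \<Rightarrow> complex) \<times> complex) \<times> complex \<Rightarrow> complex"
          assume "h \<in> {\<lambda>x. f (fst x) | f. f \<in> disc_algebra n}"
          then obtain f where "h = (\<lambda>x. f (fst x))" "f \<in> disc_algebra n" by (elim CollectE exE conjE)
          then show "h \<in> {A. (\<lambda>x. A (\<xi> (fst x), snd x)) \<in> poly_functions_line m}"
            using PLf[OF \<xi>pull, of f] by simp
        qed
        show "{\<lambda>x. g (snd x) | g. g \<in> range poly} \<subseteq> {A. (\<lambda>x. A (\<xi> (fst x), snd x)) \<in> poly_functions_line m}"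
        proof
          fix h :: "((nat \<Rightarrow> complex) \<times> complex) \<times> complex \<Rightarrow> complex"
          assume "h \<in> {\<lambda>x. g (snd x) | g. g \<in> range poly}"
          then obtain g where "h = (\<lambda>x. g (snd x))" "g \<in> range poly" by (elim CollectE exE conjE)
          then obtain p where "h = (\<lambda>x. poly p (snd x))" by blast
          then show "h \<in> {A. (\<lambda>x. A (\<xi> (fst x), snd x)) \<in> poly_functions_line m}"
            using poly_in_algebra[OF PL PLs, of p] by simp
        qed
      qed
      then show ?thesis using that unfolding pb_def by blast
    qed
    define frac where "frac A B \<longleftrightarrow> A \<in> ?P \<and> B \<in> ?P \<and> (\<forall>x\<in>W. B x \<noteq> 0 \<longrightarrow> R x = A x / B x)" for A B
    \<comment> \<open>The denominators of all presentations of \<open>R\<close> as a fraction on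
      part of \<open>W\<close>, pulled back to the family. Wherever \<open>R\<close> is defined one
      of them is nonzero; \<open>T\<close> keeps finitely many with the same property.\<close>
    define S where "S = {pb B | B. \<exists>A. frac A B}"
    have "S \<subseteq> poly_functions_line m"
    proof
      fix f assume "f \<in> S"
      then obtain A B where "f = pb B" "frac A B" unfolding S_def by (elim CollectE exE conjE)
      then show "f \<in> poly_functions_line m" using pb[of B] by (simp add: frac_def)
    qed
    from poly_functions_line_subcover[OF this]
    obtain T where T: "finite T" "T \<subseteq> S" "\<forall>x. (\<exists>f\<in>S. f x \<noteq> 0) \<longrightarrow> (\<exists>f\<in>T. f x \<noteq> 0)"
      by (elim exE conjE)
    have "\<forall>f. \<exists>AB. f \<in> T \<longrightarrow> frac (fst AB) (snd AB) \<and> f = pb (snd AB)"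
    proof
      fix f
      show "\<exists>AB. f \<in> T \<longrightarrow> frac (fst AB) (snd AB) \<and> f = pb (snd AB)"
      proof (cases "f \<in> T")
        case True
        then have "f \<in> S" using T(2) by blast
        then obtain A B where "f = pb B" "frac A B" unfolding S_def by (elim CollectE exE conjE)
        then show ?thesis by (intro exI[of _ "(A, B)"]) simp
      qed simp
    qed
    from choice[OF this] obtain AB where AB: "\<forall>f. f \<in> T \<longrightarrow> frac (fst (AB f)) (snd (AB f)) \<and> f = pb (snd (AB f))"
      by (elim exE)
    define K where "K = (\<lambda>f. (pb (fst (AB f)), pb (snd (AB f)))) ` T"
    have "eventually (\<lambda>r. \<forall>z\<in>set G. z (flip u (spiral u r 0)) = z (spiral u r 0)) at_top"
    proof (rule monodromy_trivial[where F = Fp and D = D and p = "\<lambda>k s. q k (\<phi> s)" and K = K and H = H and ?s0.0 = one])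
      show "fun_algebra Fp" "\<forall>f\<in>Fp. rational_fun m f" by (fact Fp Fp_rat)+
      show "\<forall>f\<in>Fp. \<forall>s. f (flip u s) = f s"
        unfolding Fp_def by (auto simp: \<phi>_def \<xi>flip)
      show "\<forall>f\<in>Fp. \<forall>v. leading m f v \<longrightarrow> pairing m u v = 0" using u(2) unfolding L_def by blast
      show "D \<ge> 1" by (rule D)
      show "\<forall>k<D. (\<lambda>s. q k (\<phi> s)) \<in> Fp" using q unfolding Fp_def F_def by (intro allI impI imageI) simp
      show "finite K" using T(1) by (simp add: K_def)
      show "\<forall>(A, B)\<in>K. A \<in> poly_functions_line m \<and> B \<in> poly_functions_line m"
      proof
        fix x assume "x \<in> K"
        then obtain f where f: "x = (pb (fst (AB f)), pb (snd (AB f)))" "f \<in> T" unfolding K_def by (rule imageE)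
        then have "fst (AB f) \<in> ?P" "snd (AB f) \<in> ?P" using AB by (auto simp: frac_def)
        then show "case x of (A, B) \<Rightarrow> A \<in> poly_functions_line m \<and> B \<in> poly_functions_line m"
          unfolding f(1) prod.case using pb by blast
      qed
      show "\<forall>(A, B)\<in>K. \<forall>s y. A (flip u s, y) = A (s, y) \<and> B (flip u s, y) = B (s, y)"
        unfolding K_def by (auto simp: pb_def \<xi>flip)
      show "finite (set G)" "set G \<subseteq> poly_functions m" using GP by auto
      show "H \<in> poly_functions m" "H one \<noteq> 0" by (fact H)+
      fix s z assume s: "H s \<noteq> 0" and z: "z \<in> set G"
      have "z s \<in> set (klein_family zs 1 s)" unfolding Gm[symmetric] using z by auto
      then have "z s \<in> af_values (root_function n) (\<xi> s)"
        unfolding \<xi>_def by (intro af_values_root_point) (simp_all add: length_klein_family zs(1))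
      then have "z s \<in> (\<lambda>t. R (\<xi> s, t)) ` af_values w (\<phi> s)" using branch HU(1)[OF s] by (auto simp: \<phi>_def)
      then obtain y where y: "z s = R (\<xi> s, y)" "y \<in> af_values w (\<phi> s)" by (rule imageE)
      have yW: "(\<xi> s, y) \<in> W" using dfd HU(1)[OF s] y(2) by (simp add: \<phi>_def)
      have root: "monic_val D (\<lambda>k s. q k (\<phi> s)) s y = 0"
        using qw HU(3)[OF s] y(2) by (simp add: monic_val_def)
      from presented_byD(3)[OF XA Wo Rr yW]
      obtain A B where ab: "A \<in> ?P" "B \<in> ?P" "B (\<xi> s, y) \<noteq> 0" "\<forall>x\<in>W. B x \<noteq> 0 \<longrightarrow> R x = A x / B x"
        by (rule local_fractionE)
      then have fr: "frac A B" by (simp add: frac_def)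
      then have "pb B \<in> S" unfolding S_def by (intro CollectI exI[of _ B] conjI refl exI[of _ A])
      moreover have "pb B (s, y) \<noteq> 0" using ab(3) by (simp add: pb_def)
      ultimately obtain f where f: "f \<in> T" "f (s, y) \<noteq> 0" using T(3) by blast
      define A' where "A' = fst (AB f)"
      define B' where "B' = snd (AB f)"
      have AB': "frac A' B'" "f = pb B'" using AB f(1) by (auto simp: A'_def B'_def)
      have "B' (\<xi> s, y) \<noteq> 0" using f(2) unfolding AB'(2) by (simp add: pb_def)
      then have "R (\<xi> s, y) = A' (\<xi> s, y) / B' (\<xi> s, y)" "B' (\<xi> s, y) \<noteq> 0"
        using AB'(1) yW by (auto simp: frac_def)
      then have "pb B' (s, y) \<noteq> 0 \<and> z s * pb B' (s, y) = pb A' (s, y)"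
        by (simp add: pb_def y(1))
      moreover have "(pb A', pb B') \<in> K" unfolding K_def A'_def B'_def using f(1) by (rule imageI)
      ultimately have "\<exists>(A, B)\<in>K. B (s, y) \<noteq> 0 \<and> z s * B (s, y) = A (s, y)"
        by (intro bexI[of _ "(pb A', pb B')"]) simp_all
      then show "\<exists>y. monic_val D (\<lambda>k s. q k (\<phi> s)) s y = 0 \<and> (\<exists>(A, B)\<in>K. B (s, y) \<noteq> 0 \<and> z s * B (s, y) = A (s, y))"
        using root by (intro exI[of _ y] conjI)
    qed
    \<comment> \<open>The product of root differences is a polynomial that is nonzero at
      \<open>one\<close>, so it is nonzero far out on every spiral.\<close>
    moreover have "eventually (\<lambda>r. distinct (klein_family zs 1 (spiral u r 0))) at_top"
    proof -
      have "(\<lambda>s. root_vandermonde (klein_family zs 1 s)) \<in> poly_functions m"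
        using root_vandermonde_in_algebra[OF A GP] unfolding Gm .
      moreover have "root_vandermonde (klein_family zs 1 one) \<noteq> 0"
        using zs(2) by (simp add: one_def klein_family_one root_vandermonde_nonzero)
      ultimately have "eventually (\<lambda>(r, t). root_vandermonde (klein_family zs 1 (spiral u r t)) \<noteq> 0) strip"
        by (rule poly_nonzero_eventually)
      then show ?thesis unfolding eventually_strip_at_top
        by (rule eventually_mono) (simp add: root_vandermonde_nonzero)
    qed
    ultimately have "eventually (\<lambda>r. (\<forall>z\<in>set G. z (flip u (spiral u r 0)) = z (spiral u r 0)) \<and>
       distinct (klein_family zs 1 (spiral u r 0))) at_top" by (rule eventually_conj)
    from eventually_happens[OF this] obtain r where
      r: "\<forall>z\<in>set G. z (flip u (spiral u r 0)) = z (spiral u r 0)" "distinct (klein_family zs 1 (spiral u r 0))"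
      by auto
    obtain i where i: "i \<in> {1..m}" "odd (u i)" using u(1) by blast
    \<comment> \<open>Every root, in its place in the list, would survive the sign change, although
      an odd entry of \<open>u\<close> moves one.\<close>
    have "map (\<lambda>g. g (flip u (spiral u r 0))) G = map (\<lambda>g. g (spiral u r 0)) G" using r(1) by simp
    then have "klein_family zs 1 (flip u (spiral u r 0)) = klein_family zs 1 (spiral u r 0)" unfolding Gm .
    moreover have "klein_family zs 1 (flip u (spiral u r 0)) \<noteq> klein_family zs 1 (spiral u r 0)"
      by (rule klein_family_flip_neq[where i = i and u = u, OF _ _ i(2) r(2)]) (use i(1) zs(1) in \<open>auto simp: m_def\<close>)
    ultimately show False by simp
  qed
qed

end
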